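(* Let $\alpha\in(-1,1)$, $r_0>0$, and let $(\vartheta_n)_{n\ge1}$ be a sequence of i.i.d. real-valued random variables admitting a moment of order $r_0$ (i.e. $\mathbb E[|\vartheta_1|^{r_0}]<\infty$). Let $(X_n)_{n\ge 0}$ be the linear autoregressive Markov chain on $\mathbb X=\mathbb R$ given by $X_n=\alpha X_{n-1}+\vartheta_n$ for $n\ge1$, where $X_0$ is a real-valued random variable independent of $(\vartheta_n)_{n\ge 1}$, and let $\pi$ be its invariant probability. Assume that $\vartheta_1$ has a continuous Lebesgue probability density function $p>0$ on $\mathbb R$ such that $$\forall x\in\mathbb R,\ \exists \varepsilon_x>0,\quad \int_{\mathbb R}\sup_{|z|<\varepsilon_x}p(y+x+z)\,dy<\infty .$$ Let $\xi:\mathbb R\to[0,+\infty)$ be continuous and coercive (i.e. $\lim_{|x|\to+\infty}\xi(x)=+\infty$), with $\xi(x)>0$ for Lebesgue almost every $x\in\mathbb R$ and $\sup_{x\in\mathbb R}\frac{\xi(x)}{(1+|x|)^{r_0}}<\infty$. Let $S_n=\sum_{k=0}^n\xi(X_k)$. Then: (1) for every $x\in\mathbb R$ and every $\gamma$, $\rho_{Y,x}(\gamma)=\rho_{Y,\pi}(\gamma)$, and $(S_n)_n$ is multiplicatively ergodic on $(0,+\infty)$ with respect to $\mathbb P_\pi$ and with respect to $\mathbb P_x$ for every $x\in\mathbb R$; (2) $\lim_{\gamma\to+\infty}\rho_{Y,\pi}(\gamma)=0$; hence, under $\mathbb P_\pi$ and under $\mathbb P_x$ for any $x\in\mathbb R$,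 $\nu:=\inf\{\gamma>0: g_Y(\gamma,2)<\infty\}<\infty$; (3) if moreover there exists $\tau>0$ such that $\sup_{x\in\mathbb R}\frac{\xi(x)^{1+\tau}}{(1+|x|)^{r_0}}<\infty$, then $\rho_{Y,\pi}$ is differentiable with negative derivative on $(0,+\infty)$, and, under $\mathbb P_\pi$ and under $\mathbb P_x$ for any $x\in\mathbb R$, the limit $C_\nu:=\lim_{\gamma\to\nu+}\frac{\gamma-\nu}{\gamma}\,g_Y(\gamma,2)$ exists and is finite.
   Context: $\mathbb P_\mu$ (resp. $\mathbb P_x$) denotes the law of the chain when $X_0$ has distribution $\mu$ (resp. $X_0=x$), with expectation $\mathbb E_\mu$ (resp. $\mathbb E_x$). Define $\rho_{Y,\mu}(\gamma):=\limsup_{n\to+\infty}(\mathbb E_\mu[e^{-\gamma S_n}])^{1/n}$ and $\rho_{Y,x}(\gamma):=\limsup_{n\to+\infty}(\mathbb E_x[e^{-\gamma S_n}])^{1/n}$. For a given law of the chain (with expectation $\mathbb E$), put $L_Y^{(n)}(\gamma)=\mathbb E[e^{-\gamma S_n}]$ and $g_Y(\gamma,\lambda)=\sum_{n\ge0}\lambda^nL_Y^{(n)}(\gamma)$ for $\gamma,\lambda\ge 0$ (the value $+\infty$ being allowed). $(S_n)_n$ is called multiplicatively ergodic on an interval $J=[0,\gamma_1)$ or $J=(0,\gamma_1)$ (with $0<\gamma_1\le+\infty$) if there exist two continuous maps $A,\rho:J\to(0,+\infty)$ such that for every compact $K\subset(0,\gamma_1)$ there exist $M_K>0$ and $\theta_K\in(0,1)$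 with, for every $n\ge1$, $\sup_{\gamma\in K}|L_Y^{(n)}(\gamma)-A(\gamma)\rho(\gamma)^n|\big/\rho(\gamma)^n\le M_K\theta_K^n$; that is, $|L_Y^{(n)}(\gamma)-A(\gamma)\rho(\gamma)^n|\le M_K(\rho(\gamma)\theta_K)^n$ for all $\gamma\in K$, $n\ge 1$. *)

theory Defs
  imports "HOL-Probability.Probability"
begin

primrec ar_chain :: "real \<Rightarrow> real \<Rightarrow> (nat \<Rightarrow> real) \<Rightarrow> nat \<Rightarrow> real" where
  "ar_chain \<alpha> x \<theta> 0 = x"
| "ar_chain \<alpha> x \<theta> (Suc n) = \<alpha> * ar_chain \<alpha> x \<theta> n + \<theta> (Suc n)"

text \<open>
  The law \<open>P\<^sub>\<mu>\<close> of the chain, a measure on the path space. The innovations live on \<open>M\<close>; on the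
  product of \<open>\<mu>\<close> and \<open>M\<close> the first coordinate is an \<open>X\<^sub>0\<close> with distribution \<open>\<mu>\<close> that is independent
  of the innovations, and the law of the chain does not depend on how such an \<open>X\<^sub>0\<close> is realised.
  \<open>P\<^sub>x\<close> is obtained for \<open>\<mu> = return borel x\<close>. Only the innovations with index at least 1 matter.
\<close>

definition ar_law ::
    "real \<Rightarrow> 'a measure \<Rightarrow> (nat \<Rightarrow> 'a \<Rightarrow> real) \<Rightarrow> real measure \<Rightarrow> (nat \<Rightarrow> real) measure" where
  "ar_law \<alpha> M \<theta> \<mu> =
     distr (\<mu> \<Otimes>\<^sub>M M) (\<Pi>\<^sub>M n\<in>UNIV. borel) (\<lambda>(x, \<omega>). ar_chain \<alpha> x (\<lambda>k. \<theta> k \<omega>))"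

definition invariant_probability ::
    "real \<Rightarrow> 'a measure \<Rightarrow> (nat \<Rightarrow> 'a \<Rightarrow> real) \<Rightarrow> real measure \<Rightarrow> bool" where
  "invariant_probability \<alpha> M \<theta> \<pi> \<longleftrightarrow>
     prob_space \<pi> \<and> sets \<pi> = sets borel \<and> distr (ar_law \<alpha> M \<theta> \<pi>) borel (\<lambda>X. X 1) = \<pi>"

definition additive_functional :: "(real \<Rightarrow> real) \<Rightarrow> nat \<Rightarrow> (nat \<Rightarrow> real) \<Rightarrow> real" where
  "additive_functional \<xi> n X = (\<Sum>k=0..n. \<xi> (X k))"

text \<open>In what follows \<open>P\<close> is the law of the chain, and \<open>\<gamma>\<close> and \<open>s\<close> are meant to be nonnegative.\<close>

definition L_Y :: "(nat \<Rightarrow> real) measure \<Rightarrow> (real \<Rightarrow> real) \<Rightarrow> nat \<Rightarrow> real \<Rightarrow> real" where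
  "L_Y P \<xi> n \<gamma> = (\<integral>X. exp (- \<gamma> * additive_functional \<xi> n X) \<partial>P)"

text \<open>For \<open>\<xi> \<ge> 0\<close> and \<open>\<gamma> \<ge> 0\<close> the roots lie in \<open>[0, 1]\<close>, so the upper limit is finite.\<close>

definition \<rho>_Y :: "(nat \<Rightarrow> real) measure \<Rightarrow> (real \<Rightarrow> real) \<Rightarrow> real \<Rightarrow> real" where
  "\<rho>_Y P \<xi> \<gamma> = real_of_ereal (limsup (\<lambda>n. ereal (root n (L_Y P \<xi> n \<gamma>))))"

definition g_Y :: "(nat \<Rightarrow> real) measure \<Rightarrow> (real \<Rightarrow> real) \<Rightarrow> real \<Rightarrow> real \<Rightarrow> ennreal" where
  "g_Y P \<xi> \<gamma> s = (\<Sum>n. ennreal (s ^ n * L_Y P \<xi> n \<gamma>))"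

text \<open>The infimum is taken in the extended reals, so it is \<open>\<infinity>\<close> when the set is empty.\<close>

definition \<nu>_Y :: "(nat \<Rightarrow> real) measure \<Rightarrow> (real \<Rightarrow> real) \<Rightarrow> ereal" where
  "\<nu>_Y P \<xi> = Inf (ereal ` {\<gamma>. 0 < \<gamma> \<and> g_Y P \<xi> \<gamma> 2 < \<infinity>})"

text \<open>
  Here \<open>J\<close> is \<open>[0, \<gamma>\<^sub>1)\<close> or \<open>(0, \<gamma>\<^sub>1)\<close>, with \<open>\<gamma>\<^sub>1 = \<infinity>\<close> allowed; in both cases
  \<open>J - {0}\<close> is \<open>(0, \<gamma>\<^sub>1)\<close>.
\<close>

definition multiplicatively_ergodic ::
    "(nat \<Rightarrow> real) measure \<Rightarrow> (real \<Rightarrow> real) \<Rightarrow> real set \<Rightarrow> bool" where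
  "multiplicatively_ergodic P \<xi> J \<longleftrightarrow>
     (\<exists>\<gamma>\<^sub>1::ereal. 0 < \<gamma>\<^sub>1 \<and>
        (J = {\<gamma>. 0 \<le> \<gamma> \<and> ereal \<gamma> < \<gamma>\<^sub>1} \<or> J = {\<gamma>. 0 < \<gamma> \<and> ereal \<gamma> < \<gamma>\<^sub>1})) \<and>
     (\<exists>A \<rho> :: real \<Rightarrow> real.
        continuous_on J A \<and> continuous_on J \<rho> \<and> (\<forall>\<gamma>\<in>J. 0 < A \<gamma> \<and> 0 < \<rho> \<gamma>) \<and>
        (\<forall>K. compact K \<and> K \<subseteq> J - {0} \<longrightarrow>
           (\<exists>M>0. \<exists>\<theta>. 0 < \<theta> \<and> \<theta> < 1 \<and>
              (\<forall>n\<ge>1. \<forall>\<gamma>\<in>K. \<bar>L_Y P \<xi> n \<gamma> - A \<gamma> * \<rho> \<gamma> ^ n\<bar> \<le> M * (\<rho> \<gamma> * \<theta>) ^ n))))"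

end

theory Submission
  imports Defs "HOL-Complex_Analysis.Great_Picard"
begin

text \<open>
  Fix \<open>\<gamma> > 0\<close> and consider the operator \<open>(Q f)(x) = exp (- \<gamma> \<xi>(x)) \<integral> p(y - \<alpha> x) f(y) dy\<close>. The Markov
  property gives \<open>E\<^sub>x[exp (- \<gamma> S\<^sub>n)] = (Q\<^sup>n\<^sup>+\<^sup>1 1)(x)\<close>, so everything is a statement about the powers of \<open>Q\<close>.
  The exponential factor stands in front of the transition; for this reason \<open>\<bar>Q f\<bar>\<close> is at most
  \<open>exp (- \<gamma> \<xi>)\<close> times the supremum of \<open>\<bar>f\<bar>\<close>, and coercivity of \<open>\<xi>\<close> makes the mass at infinity negligible.
  Together with the continuity of the transition density in the \<open>L\<^sup>1\<close> norm this makes \<open>Q\<close> behave like a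
  positive matrix, and the proof is a quantitative Perron-Frobenius theory for it.

  A positive eigenfunction \<open>Q h = \<rho> h\<close> is found as a limit of normalised resolvents
  (\<open>eigenpair_exists\<close>): the resolvent must blow up at the spectral radius, and bounded sequences have
  subsequences along which their images under the transition operator converge. Given \<open>h\<close>, the operator
  contracts, modulo multiples of \<open>h\<close>, the norm with weight \<open>h + \<beta>\<close> for a small constant \<open>\<beta>\<close>
  (\<open>contraction_step\<close>). In a bounded zone a minorization pulls every function towards \<open>h\<close>, and far out
  the killing makes the constant \<open>\<beta>\<close> contract. Consequently \<open>Q\<^sup>n f = \<rho>\<^sup>n \<Lambda>(f) h + O((\<theta> \<rho>)\<^sup>n)\<close> with
  \<open>\<theta> < 1\<close>. All constants depend only on a lower and an upper bound for the killing factor, so they serve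
  for all \<open>\<gamma>\<close> in a compact subset of \<open>(0, \<infinity>)\<close> at once (\<open>uniform_spectral_gap\<close>). Integrating against the
  initial distribution gives multiplicative ergodicity, with a rate \<open>\<rho>(\<gamma>)\<close> common to all of them.

  Since \<open>t exp (- t)\<close> is bounded, \<open>Q\<close> is locally Lipschitz in \<open>\<gamma>\<close> for the operator norm, and by the
  uniform convergence \<open>\<rho>(\<gamma>)\<close> and the normalised eigenfunction \<open>h\<^sub>\<gamma>\<close> are continuous. Let \<open>\<Lambda>\<^sub>\<gamma>\<close> be the
  functional in the expansion. It satisfies \<open>\<Lambda>\<^sub>\<gamma>(Q\<^sub>\<gamma> f) = \<rho>(\<gamma>) \<Lambda>\<^sub>\<gamma>(f)\<close>, and applying it to the
  eigenfunction of another parameter \<open>g\<close> yields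
  \<open>(\<rho>(g) - \<rho>(\<gamma>)) \<Lambda>\<^sub>\<gamma>(h\<^sub>g) = \<Lambda>\<^sub>\<gamma>((Q\<^sub>g - Q\<^sub>\<gamma>) h\<^sub>g)\<close>. Dividing by \<open>g - \<gamma>\<close> shows
  \<open>\<rho>'(\<gamma>) = - \<rho>(\<gamma>) \<Lambda>\<^sub>\<gamma>(\<xi> h\<^sub>\<gamma>)\<close>, which is negative because \<open>\<xi>\<close> is positive almost everywhere
  (\<open>rho_has_derivative\<close>, \<open>rho_derivative_neg\<close>).

  For large \<open>\<gamma>\<close> the function \<open>Q\<^sup>2 1\<close> is uniformly small, so \<open>\<rho>\<close> tends to \<open>0\<close>. For small \<open>\<gamma>\<close> it exceeds
  \<open>1/2\<close>: as \<open>\<bar>\<alpha>\<bar> < 1\<close>, a step of the chain leaves a long interval only with small probability, and on this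
  interval the killing is weak. Hence \<open>\<rho>(\<nu>) = 1/2\<close> for exactly one \<open>\<nu> > 0\<close>. The series
  \<open>g\<^sub>Y(\<gamma>, 2)\<close> is \<open>A(\<gamma>) / (1 - 2 \<rho>(\<gamma>))\<close> plus a remainder that is bounded near \<open>\<nu>\<close> when \<open>\<gamma> > \<nu>\<close>, and infinite when
  \<open>0 < \<gamma> \<le> \<nu>\<close>; as \<open>\<rho>'(\<nu>) \<noteq> 0\<close>, it has a simple pole at \<open>\<nu>\<close> (\<open>g_Y_simple_pole\<close>).
\<close>

section \<open>Markov operators with a positive continuous density\<close>

definition bounded_measurable :: "(real \<Rightarrow> real) \<Rightarrow> bool" where
  "bounded_measurable f \<longleftrightarrow> f \<in> borel_measurable borel \<and> (\<exists>B. \<forall>x. \<bar>f x\<bar> \<le> B)"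

lemma bounded_measurableI:
  "f \<in> borel_measurable borel \<Longrightarrow> (\<And>x. \<bar>f x\<bar> \<le> B) \<Longrightarrow> bounded_measurable f"
  by (auto simp: bounded_measurable_def)

lemma bounded_measurable_measurable: "bounded_measurable f \<Longrightarrow> f \<in> borel_measurable borel"
  by (simp add: bounded_measurable_def)

lemma bounded_measurable_bound:
  assumes "bounded_measurable f"
  obtains B where "0 < B" "\<And>x. \<bar>f x\<bar> \<le> B"
proof -
  obtain B where B: "\<And>x. \<bar>f x\<bar> \<le> B" using assms by (auto simp: bounded_measurable_def)
  show ?thesis
  proof (rule that[of "\<bar>B\<bar> + 1"])
    fix x show "\<bar>f x\<bar> \<le> \<bar>B\<bar> + 1" using B[of x] by simp
  qed simp
qed

lemma bounded_measurable_const: "bounded_measurable (\<lambda>_. c)"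
  by (rule bounded_measurableI[of _ "\<bar>c\<bar>"]) auto

lemma bounded_measurable_mult:
  assumes "bounded_measurable f" "bounded_measurable g"
  shows "bounded_measurable (\<lambda>x. f x * g x)"
proof -
  obtain A where A: "0 < A" "\<And>x. \<bar>f x\<bar> \<le> A" using bounded_measurable_bound[OF assms(1)] by blast
  obtain B where B: "0 < B" "\<And>x. \<bar>g x\<bar> \<le> B" using bounded_measurable_bound[OF assms(2)] by blast
  have "\<bar>f x * g x\<bar> \<le> A * B" for x
    unfolding abs_mult using A B by (intro mult_mono) auto
  then show ?thesis
    using assms by (intro bounded_measurableI[of _ "A * B"])
      (auto intro: borel_measurable_times bounded_measurable_measurable)
qed

lemma bounded_measurable_add:
  assumes "bounded_measurable f" "bounded_measurable g"
  shows "bounded_measurable (\<lambda>x. f x + g x)"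
proof -
  obtain A where A: "0 < A" "\<And>x. \<bar>f x\<bar> \<le> A" using bounded_measurable_bound[OF assms(1)] by blast
  obtain B where B: "0 < B" "\<And>x. \<bar>g x\<bar> \<le> B" using bounded_measurable_bound[OF assms(2)] by blast
  have "\<bar>f x + g x\<bar> \<le> A + B" for x
    using A(2)[of x] B(2)[of x] by linarith
  then show ?thesis
    using assms by (intro bounded_measurableI[of _ "A + B"])
      (auto intro: borel_measurable_add bounded_measurable_measurable)
qed

lemma bounded_measurable_cmult: "bounded_measurable f \<Longrightarrow> bounded_measurable (\<lambda>x. c * f x)"
  by (intro bounded_measurable_mult bounded_measurable_const)

lemma bounded_measurable_diff:
  assumes "bounded_measurable f" "bounded_measurable g"
  shows "bounded_measurable (\<lambda>x. f x - g x)"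
  using bounded_measurable_add[OF assms(1) bounded_measurable_cmult[OF assms(2), of "-1"]] by simp

lemma bounded_measurable_indicator: "S \<in> sets borel \<Longrightarrow> bounded_measurable (indicator S)"
  by (rule bounded_measurableI[of _ 1]) (auto simp: indicator_def)

lemmas bounded_measurable_intros =
  bounded_measurable_const bounded_measurable_mult bounded_measurable_add
  bounded_measurable_cmult bounded_measurable_diff bounded_measurable_indicator

locale positive_markov_density =
  fixes k :: "real \<Rightarrow> real \<Rightarrow> real"
  assumes k_continuous: "continuous_on UNIV (\<lambda>z. k (fst z) (snd z))"
    and k_pos: "\<And>x y. 0 < k x y"
    and k_integral: "\<And>x. has_bochner_integral lborel (k x) 1"
begin

definition P :: "(real \<Rightarrow> real) \<Rightarrow> real \<Rightarrow> real" where
  "P f x = (\<integral>y. k x y * f y \<partial>lborel)"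

lemma k_continuous_on: "continuous_on S (\<lambda>z. k (fst z) (snd z))"
  using k_continuous continuous_on_subset by blast

lemma k_continuous_fst: "continuous_on S (\<lambda>x. k x y)"
  using continuous_on_compose2[OF k_continuous, of S "\<lambda>x. (x, y)"]
  by (simp add: continuous_on_Pair continuous_on_id continuous_on_const)

lemma k_measurable_snd[measurable]: "k x \<in> borel_measurable borel"
  using k_integral[of x] by (auto elim!: has_bochner_integral.cases)

lemma k_integrable: "integrable lborel (k x)"
  using k_integral by (rule integrable.intros)

lemma P_integrable:
  assumes "bounded_measurable f"
  shows "integrable lborel (\<lambda>y. k x y * f y)"
proof -
  obtain B where B: "0 < B" "\<And>x. \<bar>f x\<bar> \<le> B" using bounded_measurable_bound[OF assms] by blast
  have [measurable]: "f \<in> borel_measurable borel" by (rule bounded_measurable_measurable[OF assms])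
  have "integrable lborel (\<lambda>y. B * k x y)" using k_integrable by simp
  then show ?thesis
  proof (rule Bochner_Integration.integrable_bound)
    show "AE y in lborel. norm (k x y * f y) \<le> norm (B * k x y)"
      using B(2) k_pos[of x] B(1) by (intro AE_I2) (auto simp: abs_mult less_imp_le intro: mult_right_mono)
  qed simp
qed

lemma P_add: "bounded_measurable f \<Longrightarrow> bounded_measurable g \<Longrightarrow> P (\<lambda>x. f x + g x) x = P f x + P g x"
  unfolding P_def by (simp add: distrib_left P_integrable)

lemma P_diff: "bounded_measurable f \<Longrightarrow> bounded_measurable g \<Longrightarrow> P (\<lambda>x. f x - g x) x = P f x - P g x"
  unfolding P_def by (simp add: right_diff_distrib P_integrable)

lemma P_cmult: "P (\<lambda>x. c * f x) x = c * P f x"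
proof -
  have "P (\<lambda>x. c * f x) x = (\<integral>y. c * (k x y * f y) \<partial>lborel)" by (simp add: P_def mult.left_commute)
  then show ?thesis unfolding P_def by simp
qed

lemma P_const: "P (\<lambda>_. c) x = c"
  unfolding P_def using k_integral[of x] by (simp add: has_bochner_integral_integral_eq)

lemma P_mono:
  assumes "bounded_measurable f" "bounded_measurable g" "\<And>y. f y \<le> g y"
  shows "P f x \<le> P g x"
  unfolding P_def using assms k_pos[of x]
  by (intro integral_mono P_integrable mult_left_mono) (auto simp: less_imp_le)

lemma P_abs_le:
  assumes "bounded_measurable f" "bounded_measurable g" "\<And>y. \<bar>f y\<bar> \<le> g y"
  shows "\<bar>P f x\<bar> \<le> P g x"
proof -
  have "P f x \<le> P g x" using assms by (intro P_mono) (auto intro: order_trans[OF abs_ge_self])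
  moreover have "P (\<lambda>y. (-1) * f y) x \<le> P g x"
    using assms by (intro P_mono bounded_measurable_cmult) (auto intro: order_trans[OF abs_ge_minus_self])
  ultimately show ?thesis unfolding P_cmult by (simp add: abs_le_iff)
qed

lemma P_abs_le_const: "bounded_measurable f \<Longrightarrow> (\<And>y. \<bar>f y\<bar> \<le> B) \<Longrightarrow> \<bar>P f x\<bar> \<le> B"
  using P_abs_le[of f "\<lambda>_. B"] by (simp add: P_const bounded_measurable_const)

lemma P_nonneg: "bounded_measurable f \<Longrightarrow> (\<And>y. 0 \<le> f y) \<Longrightarrow> 0 \<le> P f x"
  using P_mono[of "\<lambda>_. 0" f] by (simp add: P_const bounded_measurable_const)

text \<open>
  Positivity improving: the density charges every set of positive measure. The set \<open>S\<close> only serves to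
  witness that \<open>f\<close> is not almost everywhere zero.
\<close>

lemma P_pos:
  assumes "bounded_measurable f" "\<And>y. 0 \<le> f y" "0 < (\<integral>y. indicator S y * f y \<partial>lborel)"
  shows "0 < P f x"
proof (rule ccontr)
  assume "\<not> 0 < P f x"
  with P_nonneg[OF assms(1,2)] have "P f x = 0" by (simp add: order.antisym)
  then have "AE y in lborel. k x y * f y = 0"
    unfolding P_def using assms k_pos[of x]
    by (subst (asm) integral_nonneg_eq_0_iff_AE) (auto simp: P_integrable less_imp_le)
  then have "AE y in lborel. indicator S y * f y = 0"
    using k_pos[of x] by (auto elim!: eventually_mono simp: less_le)
  then have "(\<integral>y. indicator S y * f y \<partial>lborel) = 0"
    by (rule integral_eq_zero_AE)
  with assms(3) show False by simp
qed

text \<open>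
  Pointwise convergence of probability densities implies convergence in \<open>L\<^sup>1\<close> (Scheffe).
\<close>

lemma k_L1_continuous:
  assumes "X \<longlonglongrightarrow> x"
  shows "(\<lambda>n. \<integral>y. \<bar>k (X n) y - k x y\<bar> \<partial>lborel) \<longlonglongrightarrow> 0"
proof -
  have norm1: "(\<integral>\<^sup>+ y. ennreal \<bar>k z y\<bar> \<partial>lborel) = 1" for z
  proof -
    have "\<bar>k z y\<bar> = k z y" for y using k_pos[of z y] by simp
    then show ?thesis
      using k_integral[of z] k_pos[of z]
      by (simp add: nn_integral_eq_integral[OF k_integrable] less_imp_le has_bochner_integral_integral_eq)
  qed
  have "(\<lambda>n. \<integral>\<^sup>+ y. norm (k (X n) y - k x y) \<partial>lborel) \<longlonglongrightarrow> 0"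
  proof (rule Scheffe_lemma2)
    show "AE y in lborel. (\<lambda>n. k (X n) y) \<longlonglongrightarrow> k x y"
      using continuous_on_tendsto_compose[OF k_continuous_fst[of UNIV] assms] by simp
  qed (auto simp: norm1 k_integrable)
  then have "(\<lambda>n. enn2real (\<integral>\<^sup>+ y. norm (k (X n) y - k x y) \<partial>lborel)) \<longlonglongrightarrow> enn2real 0"
    by (intro tendsto_enn2real) auto
  then show ?thesis
    by (simp add: integral_eq_nn_integral)
qed

text \<open>
  The modulus of continuity at a point is common to all measurable functions bounded by \<open>1\<close>. This is the
  only compactness that the construction of an eigenfunction needs.
\<close>

lemma P_equicontinuous:
  assumes "0 < e"
  shows "\<exists>d>0. \<forall>x'. \<bar>x' - x\<bar> < d \<longrightarrow>
    (\<forall>f. f \<in> borel_measurable borel \<longrightarrow> (\<forall>y. \<bar>f y\<bar> \<le> 1) \<longrightarrow> \<bar>P f x' - P f x\<bar> < e)"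
proof -
  have "(\<lambda>x'. \<integral>y. \<bar>k x' y - k x y\<bar> \<partial>lborel) \<midarrow>x\<rightarrow> 0"
    by (auto simp: tendsto_at_iff_sequentially comp_def intro: k_L1_continuous)
  from tendstoD[OF this assms] obtain d where d: "d > 0"
    "\<And>x'. x' \<noteq> x \<Longrightarrow> dist x' x < d \<Longrightarrow> \<bar>\<integral>y. \<bar>k x' y - k x y\<bar> \<partial>lborel\<bar> < e"
    by (auto simp: eventually_at)
  have "\<bar>P f x' - P f x\<bar> < e"
    if "\<bar>x' - x\<bar> < d" and [measurable]: "f \<in> borel_measurable borel" and f1: "\<And>y. \<bar>f y\<bar> \<le> 1" for f x'
  proof (cases "x' = x")
    case False
    have bm: "bounded_measurable f" by (rule bounded_measurableI[OF that(2) f1])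
    have int: "integrable lborel (\<lambda>y. \<bar>k x' y - k x y\<bar>)"
      by (intro integrable_abs Bochner_Integration.integrable_diff k_integrable)
    have "P f x' - P f x = (\<integral>y. k x' y * f y - k x y * f y \<partial>lborel)"
      unfolding P_def by (rule Bochner_Integration.integral_diff[symmetric]) (auto intro: P_integrable bm)
    also have "\<bar>\<dots>\<bar> \<le> (\<integral>y. \<bar>k x' y * f y - k x y * f y\<bar> \<partial>lborel)"
      by (rule integral_abs_bound)
    also have "\<dots> \<le> (\<integral>y. \<bar>k x' y - k x y\<bar> \<partial>lborel)"
    proof (rule integral_mono[OF _ int])
      show "integrable lborel (\<lambda>y. \<bar>k x' y * f y - k x y * f y\<bar>)"
        by (intro integrable_abs Bochner_Integration.integrable_diff P_integrable bm)
      show "\<bar>k x' y * f y - k x y * f y\<bar> \<le> \<bar>k x' y - k x y\<bar>" for y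
        using f1[of y] by (simp add: abs_mult flip: left_diff_distrib) (simp add: mult_left_le)
    qed
    also have "\<dots> < e" using d(2)[OF False] that(1) by (simp add: dist_real_def)
    finally show ?thesis .
  qed (use assms in simp)
  with d(1) show ?thesis by blast
qed

lemma P_continuous:
  assumes "bounded_measurable f"
  shows "continuous_on S (P f)"
proof -
  obtain B where B: "0 < B" "\<And>x. \<bar>f x\<bar> \<le> B" using bounded_measurable_bound[OF assms] by blast
  have "continuous_on UNIV (P (\<lambda>y. (1/B) * f y))"
    unfolding continuous_on_iff
  proof (intro ballI allI impI)
    fix x e :: real assume "0 < e"
    from P_equicontinuous[OF this, of x] obtain d where d: "d > 0" "\<And>x' f. \<bar>x' - x\<bar> < d \<Longrightarrow>
      f \<in> borel_measurable borel \<Longrightarrow> (\<forall>y. \<bar>f y\<bar> \<le> 1) \<Longrightarrow> \<bar>P f x' - P f x\<bar> < e" by blast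
    have "\<bar>1/B * f y\<bar> \<le> 1" for y using B by (simp add: abs_mult divide_le_eq)
    moreover have "(\<lambda>y. 1/B * f y) \<in> borel_measurable borel"
      using bounded_measurable_measurable[OF assms] by simp
    ultimately show "\<exists>d>0. \<forall>x'\<in>UNIV. dist x' x < d \<longrightarrow>
        dist (P (\<lambda>y. 1/B * f y) x') (P (\<lambda>y. 1/B * f y) x) < e"
      using d by (intro exI[of _ d]) (auto simp: dist_real_def)
  qed
  then have "continuous_on UNIV (\<lambda>x. B * P (\<lambda>y. (1/B) * f y) x)"
    by (intro continuous_intros)
  then have "continuous_on UNIV (P f)" using B(1) unfolding P_cmult by simp
  then show ?thesis by (rule continuous_on_subset) simp
qed

lemma P_bounded_measurable:
  assumes "bounded_measurable f"
  shows "bounded_measurable (P f)"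
proof -
  obtain B where B: "0 < B" "\<And>x. \<bar>f x\<bar> \<le> B" using bounded_measurable_bound[OF assms] by blast
  show ?thesis
    by (rule bounded_measurableI[of _ B])
      (auto intro!: borel_measurable_continuous_onI P_continuous assms P_abs_le_const B)
qed

lemma P_limit:
  assumes "\<And>n. f n \<in> borel_measurable borel" "g \<in> borel_measurable borel"
    and "\<And>n y. \<bar>f n y\<bar> \<le> B" "\<And>y. (\<lambda>n. f n y) \<longlonglongrightarrow> g y"
  shows "(\<lambda>n. P (f n) x) \<longlonglongrightarrow> P g x"
  unfolding P_def
proof (rule integral_dominated_convergence[where w = "\<lambda>y. B * k x y"])
  show "integrable lborel (\<lambda>y. B * k x y)" using k_integrable by simp
  show "AE y in lborel. norm (k x y * f n y) \<le> B * k x y" for n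
    using assms(3)[of n] k_pos[of x]
    by (intro AE_I2) (auto simp: abs_mult less_imp_le mult.commute[of _ "k x _"] intro!: mult_left_mono)
  show "AE y in lborel. (\<lambda>n. k x y * f n y) \<longlonglongrightarrow> k x y * g y"
    using assms(4) by (intro AE_I2 tendsto_mult_left) auto
qed (use assms in auto)

end

section \<open>Killed transition operators\<close>

definition vanishing_weight :: "(real \<Rightarrow> real) \<Rightarrow> bool" where
  "vanishing_weight w \<longleftrightarrow>
     continuous_on UNIV w \<and> (\<forall>x. 0 < w x \<and> w x \<le> 1) \<and> (w \<longlongrightarrow> 0) at_infinity"

lemma vanishing_at_infinity_tail:
  fixes w :: "real \<Rightarrow> real"
  assumes "(w \<longlongrightarrow> 0) at_infinity" "0 < e"
  shows "\<exists>N>0. \<forall>y. N < \<bar>y\<bar> \<longrightarrow> w y < e"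
proof -
  have "eventually (\<lambda>y. dist (w y) 0 < e) at_infinity" using assms by (rule tendstoD)
  then obtain b where b: "\<And>y. b \<le> \<bar>y\<bar> \<Longrightarrow> \<bar>w y\<bar> < e" by (auto simp: eventually_at_infinity)
  show ?thesis
  proof (intro exI[of _ "\<bar>b\<bar> + 1"] conjI allI impI)
    fix y assume "\<bar>b\<bar> + 1 < \<bar>y\<bar>"
    then show "w y < e" using b[of y] by linarith
  qed simp
qed

lemma vanishing_weight_tail:
  "vanishing_weight w \<Longrightarrow> 0 < e \<Longrightarrow> \<exists>N>0. \<forall>y. N < \<bar>y\<bar> \<longrightarrow> w y < e"
  by (rule vanishing_at_infinity_tail) (simp_all add: vanishing_weight_def)

text \<open>
  Masses of compact intervals measure how large a function is on the part of the line where the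
  transition density is bounded away from \<open>0\<close> and \<open>\<infinity>\<close>.
\<close>

definition mass :: "real \<Rightarrow> (real \<Rightarrow> real) \<Rightarrow> real" where
  "mass N f = (\<integral>y. indicator {-N..N} y * f y \<partial>lborel)"

lemma mass_integrable:
  assumes "bounded_measurable f"
  shows "integrable lborel (\<lambda>y. indicator {-N..N} y * f y)"
proof -
  obtain B where B: "0 < B" "\<And>x. \<bar>f x\<bar> \<le> B" using bounded_measurable_bound[OF assms] by blast
  have [measurable]: "f \<in> borel_measurable borel" by (rule bounded_measurable_measurable[OF assms])
  have "integrable lborel (\<lambda>y. B * indicator {-N..N} y)"
    by (intro integrable_mult_right integrable_real_indicator) (auto simp: emeasure_lborel_Icc_eq)
  then show ?thesis
    by (rule Bochner_Integration.integrable_bound)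
      (use B in \<open>auto simp: indicator_def intro!: AE_I2\<close>)
qed

lemma mass_mono:
  assumes "bounded_measurable f" "bounded_measurable g" "\<And>y. f y \<le> g y"
  shows "mass N f \<le> mass N g"
  unfolding mass_def using assms
  by (intro integral_mono mass_integrable) (auto simp: indicator_def)

lemma mass_add:
  "bounded_measurable f \<Longrightarrow> bounded_measurable g \<Longrightarrow> mass N (\<lambda>x. f x + g x) = mass N f + mass N g"
  unfolding mass_def by (simp add: distrib_left mass_integrable)

lemma mass_cmult: "mass N (\<lambda>x. c * f x) = c * mass N f"
  unfolding mass_def by (simp add: mult.left_commute)

lemma mass_const: "0 \<le> N \<Longrightarrow> mass N (\<lambda>_. c) = 2 * N * c"
  unfolding mass_def by simp

lemma mass_abs_le:
  assumes "bounded_measurable f" "bounded_measurable g" "\<And>y. \<bar>f y\<bar> \<le> g y"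
  shows "\<bar>mass N f\<bar> \<le> mass N g"
proof -
  have "mass N f \<le> mass N g" using assms by (intro mass_mono) (auto intro: order_trans[OF abs_ge_self])
  moreover have "mass N (\<lambda>y. (-1) * f y) \<le> mass N g"
    using assms by (intro mass_mono bounded_measurable_cmult) (auto intro: order_trans[OF abs_ge_minus_self])
  ultimately show ?thesis unfolding mass_cmult by (simp add: abs_le_iff)
qed

lemma mass_limit:
  assumes "\<And>n. f n \<in> borel_measurable borel" "g \<in> borel_measurable borel"
    and "\<And>n y. \<bar>f n y\<bar> \<le> B" "\<And>y. (\<lambda>n. f n y) \<longlonglongrightarrow> g y"
  shows "(\<lambda>n. mass N (f n)) \<longlonglongrightarrow> mass N g"
  unfolding mass_def
proof (rule integral_dominated_convergence[where w = "\<lambda>y. B * indicator {-N..N} y"])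
  show "integrable lborel (\<lambda>y. B * indicator {-N..N} y)"
    by (intro integrable_mult_right integrable_real_indicator) (auto simp: emeasure_lborel_Icc_eq)
  show "AE y in lborel. (\<lambda>n. indicator {-N..N} y * f n y) \<longlonglongrightarrow> indicator {-N..N} y * g y"
    using assms(4) by (intro AE_I2 tendsto_mult_left) auto
  show "AE y in lborel. norm (indicator {-N..N} y * f n y) \<le> B * indicator {-N..N} y" for n
    using assms(3)[of n] by (intro AE_I2) (auto simp: indicator_def)
qed (use assms in auto)

context positive_markov_density
begin

lemma kernel_lower_bound:
  assumes "continuous_on UNIV w" "\<And>x. 0 < w x" "0 \<le> a" "0 \<le> b"
  shows "\<exists>s>0. \<forall>x y. \<bar>x\<bar> \<le> a \<longrightarrow> \<bar>y\<bar> \<le> b \<longrightarrow> s \<le> w x * k x y"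
proof -
  have "continuous_on ({-a..a} \<times> {-b..b}) (\<lambda>z. w (fst z) * k (fst z) (snd z))"
    by (intro continuous_on_mult k_continuous_on continuous_on_compose2[OF assms(1)] continuous_intros) auto
  moreover have "compact ({-a..a} \<times> {-b..b})" by (intro compact_Times) auto
  moreover have "{-a..a} \<times> {-b..b} \<noteq> {}" using assms(3,4) by auto
  ultimately obtain z where z: "z \<in> {-a..a} \<times> {-b..b}"
    "\<And>z'. z' \<in> {-a..a} \<times> {-b..b} \<Longrightarrow> w (fst z) * k (fst z) (snd z) \<le> w (fst z') * k (fst z') (snd z')"
    using continuous_attains_inf by (metis (no_types, lifting))
  show ?thesis
  proof (intro exI[of _ "w (fst z) * k (fst z) (snd z)"] conjI allI impI)
    show "0 < w (fst z) * k (fst z) (snd z)" using assms(2) k_pos by simp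
    fix x y assume "\<bar>x\<bar> \<le> a" "\<bar>y\<bar> \<le> b"
    then show "w (fst z) * k (fst z) (snd z) \<le> w x * k x y" using z(2)[of "(x, y)"] by (auto simp: abs_le_iff)
  qed
qed

lemma kernel_upper_bound: "\<exists>K>0. \<forall>x y. \<bar>x\<bar> \<le> a \<longrightarrow> \<bar>y\<bar> \<le> a \<longrightarrow> k x y \<le> K"
proof -
  have "compact ((\<lambda>z. k (fst z) (snd z)) ` ({-a..a} \<times> {-a..a}))"
    by (intro compact_continuous_image k_continuous_on compact_Times) auto
  then have "bounded ((\<lambda>z. k (fst z) (snd z)) ` ({-a..a} \<times> {-a..a}))" by (rule compact_imp_bounded)
  then obtain K where "K > 0" "\<And>z. z \<in> {-a..a} \<times> {-a..a} \<Longrightarrow> \<bar>k (fst z) (snd z)\<bar> \<le> K"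
    by (auto simp: bounded_pos)
  then show ?thesis by (intro exI[of _ K]) (fastforce simp: abs_le_iff)
qed

lemma P_lower:
  assumes "bounded_measurable f" "\<And>y. 0 \<le> f y" "\<And>y. \<bar>y\<bar> \<le> N \<Longrightarrow> s \<le> k x y"
  shows "s * mass N f \<le> P f x"
proof -
  have "s * mass N f = (\<integral>y. s * (indicator {-N..N} y * f y) \<partial>lborel)" by (simp add: mass_def)
  also have "\<dots> \<le> (\<integral>y. k x y * f y \<partial>lborel)"
  proof (rule integral_mono)
    show "s * (indicator {-N..N} y * f y) \<le> k x y * f y" for y
      using assms(2)[of y] assms(3)[of y] k_pos[of x y]
      by (cases "y \<in> {-N..N}") (auto intro!: mult_right_mono simp: indicator_def abs_le_iff)
  qed (use assms in \<open>auto intro: P_integrable mass_integrable\<close>)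
  finally show ?thesis by (simp add: P_def)
qed

lemma P_upper:
  assumes "bounded_measurable f" "\<And>y. 0 \<le> f y" "\<And>y. \<bar>y\<bar> \<le> N \<Longrightarrow> k x y \<le> K"
    and "\<And>y. N < \<bar>y\<bar> \<Longrightarrow> f y \<le> \<delta>" "0 \<le> \<delta>"
  shows "P f x \<le> K * mass N f + \<delta>"
proof -
  have bm: "bounded_measurable (\<lambda>y. indicator {-N..N} y * f y)"
    by (intro bounded_measurable_mult bounded_measurable_indicator assms) auto
  have "P f x \<le> P (\<lambda>y. indicator {-N..N} y * f y + \<delta>) x"
  proof (rule P_mono)
    show "f y \<le> indicator {-N..N} y * f y + \<delta>" for y
      using assms(4)[of y] assms(5) by (auto simp: indicator_def abs_if split: if_splits)
  qed (intro bm assms bounded_measurable_intros)+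
  also have "\<dots> = P (\<lambda>y. indicator {-N..N} y * f y) x + \<delta>"
    by (subst P_add) (auto intro: bm bounded_measurable_intros simp: P_const)
  also have "P (\<lambda>y. indicator {-N..N} y * f y) x \<le> (\<integral>y. K * (indicator {-N..N} y * f y) \<partial>lborel)"
    unfolding P_def
  proof (rule integral_mono)
    show "k x y * (indicator {-N..N} y * f y) \<le> K * (indicator {-N..N} y * f y)" for y
      using assms(2)[of y] assms(3)[of y]
      by (cases "y \<in> {-N..N}") (auto intro!: mult_right_mono simp: indicator_def abs_le_iff)
  qed (use assms bm in \<open>auto intro: P_integrable mass_integrable\<close>)
  also have "\<dots> = K * mass N f" by (simp add: mass_def)
  finally show ?thesis by simp
qed

definition Q :: "(real \<Rightarrow> real) \<Rightarrow> (real \<Rightarrow> real) \<Rightarrow> real \<Rightarrow> real" where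
  "Q w f x = w x * P f x"

lemma Q_bounded_measurable:
  assumes "vanishing_weight w" "bounded_measurable f"
  shows "bounded_measurable (Q w f)"
proof -
  have "bounded_measurable w"
    using assms(1) by (intro bounded_measurableI[of _ 1] borel_measurable_continuous_onI)
      (auto simp: vanishing_weight_def abs_of_pos)
  then show ?thesis
    unfolding Q_def[abs_def] using P_bounded_measurable[OF assms(2)] by (rule bounded_measurable_mult)
qed

lemma weight_pos: "vanishing_weight w \<Longrightarrow> 0 < w x"
  and weight_nonneg: "vanishing_weight w \<Longrightarrow> 0 \<le> w x"
  and weight_le_one: "vanishing_weight w \<Longrightarrow> w x \<le> 1"
  by (auto simp: vanishing_weight_def less_imp_le)

lemma Q_abs_le:
  assumes "vanishing_weight w" "bounded_measurable f" "bounded_measurable g" "\<And>y. \<bar>f y\<bar> \<le> g y"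
  shows "\<bar>Q w f x\<bar> \<le> Q w g x"
  unfolding Q_def abs_mult using weight_nonneg[OF assms(1)] P_abs_le[OF assms(2-4)]
  by (auto intro: mult_left_mono)

lemma Q_mono:
  assumes "vanishing_weight w" "bounded_measurable f" "bounded_measurable g" "\<And>y. f y \<le> g y"
  shows "Q w f x \<le> Q w g x"
  unfolding Q_def using weight_nonneg[OF assms(1)] P_mono[OF assms(2-4)]
  by (auto intro: mult_left_mono)

lemma Q_add: "bounded_measurable f \<Longrightarrow> bounded_measurable g \<Longrightarrow> Q w (\<lambda>x. f x + g x) = (\<lambda>x. Q w f x + Q w g x)"
  by (auto simp: Q_def P_add distrib_left)

lemma Q_diff: "bounded_measurable f \<Longrightarrow> bounded_measurable g \<Longrightarrow> Q w (\<lambda>x. f x - g x) = (\<lambda>x. Q w f x - Q w g x)"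
  by (auto simp: Q_def P_diff right_diff_distrib)

lemma Q_cmult: "Q w (\<lambda>x. c * f x) = (\<lambda>x. c * Q w f x)"
  by (auto simp: Q_def P_cmult)

lemma Q_const: "Q w (\<lambda>_. c) x = c * w x"
  by (simp add: Q_def P_const)

lemma Q_pow_bounded_measurable:
  "vanishing_weight w \<Longrightarrow> bounded_measurable f \<Longrightarrow> bounded_measurable ((Q w ^^ n) f)"
  by (induction n) (auto intro: Q_bounded_measurable)

lemma Q_pow_abs_le:
  assumes "vanishing_weight w" "bounded_measurable f" "bounded_measurable g" "\<And>y. \<bar>f y\<bar> \<le> g y"
  shows "\<bar>(Q w ^^ n) f x\<bar> \<le> (Q w ^^ n) g x"
  by (induction n arbitrary: x) (auto intro: Q_abs_le Q_pow_bounded_measurable assms)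

lemma Q_pow_mono:
  assumes "vanishing_weight w" "bounded_measurable f" "bounded_measurable g" "\<And>y. f y \<le> g y"
  shows "(Q w ^^ n) f x \<le> (Q w ^^ n) g x"
  by (induction n arbitrary: x) (auto intro: Q_mono Q_pow_bounded_measurable assms)

lemma Q_pow_add:
  assumes "vanishing_weight w" "bounded_measurable f" "bounded_measurable g"
  shows "(Q w ^^ n) (\<lambda>x. f x + g x) = (\<lambda>x. (Q w ^^ n) f x + (Q w ^^ n) g x)"
  by (induction n) (simp_all add: Q_add Q_pow_bounded_measurable assms)

lemma Q_pow_cmult: "(Q w ^^ n) (\<lambda>x. c * f x) = (\<lambda>x. c * (Q w ^^ n) f x)"
  by (induction n) (simp_all add: Q_cmult)

lemma Q_pow_bound:
  assumes "vanishing_weight w" "bounded_measurable f" "\<And>y. \<bar>f y\<bar> \<le> B"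
  shows "\<bar>(Q w ^^ n) f x\<bar> \<le> B * (Q w ^^ n) (\<lambda>_. 1) x"
  using Q_pow_abs_le[OF assms(1,2) bounded_measurable_const[of B] assms(3), of n x]
    fun_cong[OF Q_pow_cmult[of n w B "\<lambda>_. 1"], of x] by simp

lemma Q_pow_eigen:
  assumes "\<And>x. Q w h x = \<rho> * h x"
  shows "(Q w ^^ n) h = (\<lambda>x. \<rho> ^ n * h x)"
proof (induction n)
  case (Suc n)
  then show ?case by (simp add: Q_cmult assms mult.assoc mult.left_commute)
qed simp

lemma Q_pow_one_nonneg: "vanishing_weight w \<Longrightarrow> 0 \<le> (Q w ^^ n) (\<lambda>_. 1) x"
  using Q_pow_bound[of w "\<lambda>_. 0" 1 n x] by (auto simp: bounded_measurable_const)

lemma Q_pow_one_le_one: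
  assumes "vanishing_weight w"
  shows "(Q w ^^ n) (\<lambda>_. 1) x \<le> 1"
proof (induction n arbitrary: x)
  case (Suc n)
  have "Q w ((Q w ^^ n) (\<lambda>_. 1)) x \<le> Q w (\<lambda>_. 1) x"
    by (intro Q_mono Q_pow_bounded_measurable bounded_measurable_const assms Suc)
  also have "\<dots> \<le> 1" using weight_le_one[OF assms] by (simp add: Q_const)
  finally show ?case by simp
qed simp

lemma Q_pow_supersolution:
  assumes "vanishing_weight w" "bounded_measurable g" "\<And>x. Q w g x \<le> l * g x" "0 \<le> l"
  shows "(Q w ^^ n) g x \<le> l ^ n * g x"
proof (induction n arbitrary: x)
  case (Suc n)
  have "Q w ((Q w ^^ n) g) x \<le> Q w (\<lambda>x. l ^ n * g x) x"
    by (intro Q_mono Q_pow_bounded_measurable bounded_measurable_cmult assms Suc)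
  also have "\<dots> = l ^ n * Q w g x" by (simp add: Q_cmult)
  also have "\<dots> \<le> l ^ n * (l * g x)" using assms by (intro mult_left_mono) auto
  finally show ?case by (simp add: mult_ac)
qed simp

lemma Q_pow_subsolution:
  assumes "vanishing_weight w" "bounded_measurable g" "\<And>x. l * g x \<le> Q w g x" "0 \<le> l"
  shows "l ^ n * g x \<le> (Q w ^^ n) g x"
proof (induction n arbitrary: x)
  case (Suc n)
  have "l ^ n * (l * g x) \<le> l ^ n * Q w g x" using assms by (intro mult_left_mono) auto
  also have "\<dots> = Q w (\<lambda>x. l ^ n * g x) x" by (simp add: Q_cmult)
  also have "\<dots> \<le> Q w ((Q w ^^ n) g) x"
    by (intro Q_mono Q_pow_bounded_measurable bounded_measurable_cmult assms Suc)
  finally show ?case by (simp add: mult_ac)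
qed simp

end

section \<open>Existence of a positive eigenfunction\<close>

context positive_markov_density
begin

text \<open>
  The infimum of this set is the spectral radius of \<open>Q w\<close>; by positivity the norms of the powers are the
  suprema of the functions \<open>(Q w)\<^sup>n 1\<close>.
\<close>

definition growth_rates :: "(real \<Rightarrow> real) \<Rightarrow> real set" where
  "growth_rates w = {l. 0 < l \<and> (\<exists>C. \<forall>n x. (Q w ^^ n) (\<lambda>_. 1) x \<le> C * l ^ n)}"

lemma one_in_growth_rates: "vanishing_weight w \<Longrightarrow> 1 \<in> growth_rates w"
  by (auto simp: growth_rates_def intro!: exI[of _ 1] Q_pow_one_le_one)

lemma growth_rates_bdd_below: "bdd_below (growth_rates w)"
  by (rule bdd_belowI[of _ 0]) (auto simp: growth_rates_def)

text \<open>
  The indicator of \<open>[-1, 1]\<close> is a subsolution, because the density is bounded below on a square.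
\<close>

lemma Inf_growth_rates_pos:
  assumes w: "vanishing_weight w"
  shows "0 < Inf (growth_rates w)"
proof -
  have cont: "continuous_on UNIV w" using w by (simp add: vanishing_weight_def)
  obtain s where s: "s > 0" "\<And>x y. \<bar>x\<bar> \<le> 1 \<Longrightarrow> \<bar>y\<bar> \<le> 1 \<Longrightarrow> s \<le> w x * k x y"
    using kernel_lower_bound[OF cont weight_pos[OF w], of 1 1] by auto
  let ?\<phi> = "indicator {-1..1} :: real \<Rightarrow> real"
  have bm: "bounded_measurable ?\<phi>" by (intro bounded_measurable_indicator) auto
  have mass1: "mass 1 ?\<phi> = 2"
    by (simp add: mass_def flip: indicator_inter_arith)
  have sub: "(2 * s) * ?\<phi> x \<le> Q w ?\<phi> x" for x
  proof (cases "\<bar>x\<bar> \<le> 1")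
    case True
    have "(s / w x) * mass 1 ?\<phi> \<le> P ?\<phi> x"
      using s(2)[OF True] weight_pos[OF w, of x]
      by (intro P_lower bm) (auto simp: divide_le_eq mult.commute)
    then have "w x * ((s / w x) * mass 1 ?\<phi>) \<le> Q w ?\<phi> x"
      unfolding Q_def using weight_nonneg[OF w] by (intro mult_left_mono) auto
    then show ?thesis using True weight_pos[OF w, of x] by (simp add: mass1 indicator_def abs_le_iff)
  next
    case False
    have "0 \<le> Q w ?\<phi> x" unfolding Q_def using weight_nonneg[OF w] by (auto intro!: mult_nonneg_nonneg P_nonneg bm)
    then show ?thesis using False by (auto simp: indicator_def abs_le_iff)
  qed
  have "2 * s \<le> l" if "l \<in> growth_rates w" for l
  proof (rule ccontr)
    assume "\<not> 2 * s \<le> l"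
    from that obtain C where C: "0 < l" "\<And>n x. (Q w ^^ n) (\<lambda>_. 1) x \<le> C * l ^ n"
      by (auto simp: growth_rates_def)
    have "(2 * s / l) ^ n \<le> C" for n
    proof -
      have "(2 * s) ^ n * ?\<phi> 0 \<le> (Q w ^^ n) ?\<phi> 0"
        using s(1) by (intro Q_pow_subsolution w bm sub) auto
      also have "\<dots> \<le> (Q w ^^ n) (\<lambda>_. 1) 0"
        by (intro Q_pow_mono w bm bounded_measurable_const) (auto simp: indicator_def)
      also have "\<dots> \<le> C * l ^ n" by (rule C)
      finally show ?thesis using C(1) by (simp add: power_divide divide_le_eq)
    qed
    moreover have "1 < 2 * s / l" using \<open>\<not> 2 * s \<le> l\<close> C(1) by simp
    ultimately show False
      using real_arch_pow[of "2 * s / l" C] by (meson not_le)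
  qed
  then have "2 * s \<le> Inf (growth_rates w)"
    using one_in_growth_rates[OF w] by (intro cInf_greatest) auto
  with s(1) show ?thesis by simp
qed

text \<open>
  The Neumann series \<open>g = \<Sum>\<^sub>n (Q w)\<^sup>n 1 / \<mu>\<^sup>n\<close> converges beyond the spectral radius.
\<close>

lemma resolvent_exists:
  assumes w: "vanishing_weight w" and l: "l \<in> growth_rates w" "l < \<mu>"
  shows "\<exists>g. bounded_measurable g \<and> (\<forall>x. 1 \<le> g x) \<and> (\<forall>x. Q w g x = \<mu> * (g x - 1))"
proof -
  from l obtain C where l0: "0 < l" and C: "\<And>n x. (Q w ^^ n) (\<lambda>_. 1) x \<le> C * l ^ n"
    by (auto simp: growth_rates_def)
  have \<mu>: "0 < \<mu>" using l0 l(2) by simp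
  define v where "v n = (Q w ^^ n) (\<lambda>_. 1)" for n
  define a where "a n x = v n x / \<mu> ^ n" for n x
  define f where "f N x = (\<Sum>n<N. a n x)" for N x
  define g where "g x = (\<Sum>n. a n x)" for x
  have v_bm: "bounded_measurable (v n)" for n
    unfolding v_def by (intro Q_pow_bounded_measurable w bounded_measurable_const)
  have v_meas[measurable]: "v n \<in> borel_measurable borel" for n by (rule bounded_measurable_measurable[OF v_bm])
  have a0: "0 \<le> a n x" for n x
    unfolding a_def v_def using \<mu> Q_pow_one_nonneg[OF w] by simp
  have a_le: "a n x \<le> C * (l / \<mu>) ^ n" for n x
    unfolding a_def v_def using C[of n x] \<mu> by (simp add: power_divide divide_right_mono)
  have q: "0 \<le> l / \<mu>" "l / \<mu> < 1" using l0 l(2) by auto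
  have geo: "summable (\<lambda>n. C * (l / \<mu>) ^ n)" using q by (intro summable_mult summable_geometric) auto
  have summ: "summable (\<lambda>n. a n x)" for x
    by (rule summable_comparison_test'[OF geo, of 0]) (use a0 a_le in auto)
  have f_le: "f N x \<le> (\<Sum>n. C * (l / \<mu>) ^ n)" for N x
  proof -
    have "f N x \<le> (\<Sum>n<N. C * (l / \<mu>) ^ n)" unfolding f_def by (intro sum_mono a_le)
    also have "\<dots> \<le> (\<Sum>n. C * (l / \<mu>) ^ n)"
      using order_trans[OF a0 a_le] by (intro sum_le_suminf geo) auto
    finally show ?thesis .
  qed
  have f0: "0 \<le> f N x" for N x unfolding f_def by (intro sum_nonneg a0)
  have f_bm: "bounded_measurable (f N)" for N
  proof (rule bounded_measurableI)
    show "f N \<in> borel_measurable borel" unfolding f_def[abs_def] a_def by measurable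
    show "\<bar>f N x\<bar> \<le> (\<Sum>n. C * (l / \<mu>) ^ n)" for x using f_le f0 by simp
  qed
  have lim: "(\<lambda>N. f N x) \<longlonglongrightarrow> g x" for x
    unfolding f_def g_def by (rule summable_LIMSEQ[OF summ])
  have g_meas: "g \<in> borel_measurable borel"
    unfolding g_def[abs_def] a_def by measurable
  have g_le: "g x \<le> (\<Sum>n. C * (l / \<mu>) ^ n)" for x
    by (rule LIMSEQ_le_const2[OF lim]) (use f_le in auto)
  have g_ge: "1 \<le> g x" for x
  proof -
    have "f 1 x \<le> g x" unfolding f_def g_def by (intro sum_le_suminf summ) (auto simp: a0)
    then show ?thesis by (simp add: f_def a_def v_def)
  qed
  have Qf: "Q w (f N) x = \<mu> * (f (Suc N) x - 1)" for N x
  proof (induction N arbitrary: x)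
    case 0
    show ?case using Q_const[of w 0] by (simp add: f_def[abs_def] a_def v_def)
  next
    case (Suc N)
    have "f (Suc N) = (\<lambda>y. f N y + (1 / \<mu> ^ N) * v N y)"
      by (auto simp: f_def a_def)
    then have "Q w (f (Suc N)) x = Q w (f N) x + (1 / \<mu> ^ N) * Q w (v N) x"
      by (simp only: Q_add[OF f_bm bounded_measurable_cmult[OF v_bm]] Q_cmult)
    also have "Q w (v N) x = v (Suc N) x" by (simp add: v_def)
    also have "(1 / \<mu> ^ N) * v (Suc N) x = \<mu> * a (Suc N) x"
      using \<mu> by (simp add: a_def)
    finally show ?case using Suc by (simp add: f_def algebra_simps)
  qed
  have "Q w g x = \<mu> * (g x - 1)" for x
  proof (rule LIMSEQ_unique)
    show "(\<lambda>N. Q w (f N) x) \<longlonglongrightarrow> Q w g x"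
      unfolding Q_def
      by (intro tendsto_mult_left P_limit[where B = "\<Sum>n. C * (l / \<mu>) ^ n"] lim g_meas
          bounded_measurable_measurable[OF f_bm]) (use f0 f_le in auto)
    show "(\<lambda>N. Q w (f N) x) \<longlonglongrightarrow> \<mu> * (g x - 1)"
      unfolding Qf using lim[of x, THEN LIMSEQ_Suc] by (intro tendsto_intros)
  qed
  moreover have "bounded_measurable g"
  proof (rule bounded_measurableI[OF g_meas])
    show "\<bar>g x\<bar> \<le> (\<Sum>n. C * (l / \<mu>) ^ n)" for x using g_ge[of x] g_le[of x] by simp
  qed
  ultimately show ?thesis using g_ge by blast
qed

text \<open>
  A bound \<open>g \<le> D\<close> on the resolvent turns \<open>Q g = \<mu> (g - 1)\<close> into \<open>Q g \<le> \<mu> (1 - 1/D) g\<close>. If the same \<open>D\<close>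
  worked for parameters arbitrarily close to the spectral radius, then \<open>\<mu> (1 - 1/D)\<close> would be a growth
  rate strictly below it.
\<close>

lemma resolvent_blow_up:
  assumes w: "vanishing_weight w" and \<delta>: "0 < \<delta>"
  defines "\<rho> \<equiv> Inf (growth_rates w)"
  shows "\<exists>\<mu> g x. \<rho> < \<mu> \<and> \<mu> < \<rho> + \<delta> \<and> bounded_measurable g \<and> (\<forall>x. 1 \<le> g x) \<and>
           (\<forall>x. Q w g x = \<mu> * (g x - 1)) \<and> C < g x"
proof (rule ccontr)
  assume contra: "\<not> ?thesis"
  have \<rho>: "0 < \<rho>" unfolding \<rho>_def by (rule Inf_growth_rates_pos[OF w])
  define D where "D = max C 2"
  have D: "1 < D" "C \<le> D" by (auto simp: D_def)
  \<comment> \<open>so close to \<open>\<rho>\<close> that \<open>(\<rho> + \<epsilon>) (1 - 1/D) < \<rho>\<close>\<close>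
  define \<epsilon> where "\<epsilon> = min (\<delta> / 2) (\<rho> / D)"
  have \<epsilon>: "0 < \<epsilon>" "\<epsilon> < \<delta>" "\<epsilon> \<le> \<rho> / D" using \<delta> \<rho> D by (auto simp: \<epsilon>_def min_less_iff_disj)
  define \<mu> where "\<mu> = \<rho> + \<epsilon>"
  have "\<exists>l\<in>growth_rates w. l < \<mu>"
    using cInf_less_iff[OF _ growth_rates_bdd_below, of w \<mu>] one_in_growth_rates[OF w] \<epsilon>
    by (auto simp: \<rho>_def \<mu>_def)
  then obtain g where g: "bounded_measurable g" "\<And>x. 1 \<le> g x" "\<And>x. Q w g x = \<mu> * (g x - 1)"
    using resolvent_exists[OF w] by blast
  have gD: "g x \<le> D" for x
  proof -
    have "\<not> C < g x"
    proof
      assume "C < g x"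
      moreover have "\<rho> < \<mu>" "\<mu> < \<rho> + \<delta>" using \<epsilon> by (auto simp: \<mu>_def)
      ultimately show False using contra g by blast
    qed
    with D show ?thesis by simp
  qed
  define l where "l = \<mu> * (1 - 1 / D)"
  have l0: "0 < l" using D \<rho> \<epsilon> by (auto simp: l_def \<mu>_def intro!: mult_pos_pos add_pos_pos)
  have "Q w g x \<le> l * g x" for x
  proof -
    have "g x - 1 \<le> (1 - 1 / D) * g x" using gD[of x] D by (simp add: field_simps)
    then have "\<mu> * (g x - 1) \<le> \<mu> * ((1 - 1 / D) * g x)" using \<rho> \<epsilon> by (intro mult_left_mono) (auto simp: \<mu>_def)
    then show ?thesis by (simp add: g(3) l_def mult.assoc)
  qed
  then have super: "(Q w ^^ n) g x \<le> l ^ n * g x" for n x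
    using l0 by (intro Q_pow_supersolution w g) auto
  have one:  "(Q w ^^ n) (\<lambda>_. 1) x \<le> (Q w ^^ n) g x" for n x
    by (intro Q_pow_mono w g bounded_measurable_const)
  have lD: "l ^ n * g x \<le> D * l ^ n" for n x
    using gD[of x] l0 by (simp add: mult.commute)
  have "(Q w ^^ n) (\<lambda>_. 1) x \<le> D * l ^ n" for n x
    using super[of n x] one[of n x] lD[of n x] by linarith
  then have "l \<in> growth_rates w" using l0 by (auto simp: growth_rates_def)
  then have "\<rho> \<le> l" unfolding \<rho>_def by (rule cInf_lower[OF _ growth_rates_bdd_below])
  also have "l \<le> (\<rho> + \<rho> / D) * (1 - 1 / D)"
    unfolding l_def \<mu>_def using \<epsilon>(3) D by (intro mult_right_mono) auto
  also have "\<dots> = \<rho> - \<rho> / D\<^sup>2" using D by (simp add: field_simps power2_eq_square)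
  also have "\<dots> < \<rho>" using \<rho> D by simp
  finally show False by simp
qed

text \<open>
  Normalising a large resolvent makes the inhomogeneity \<open>c\<close> small.
\<close>

lemma approximate_eigenfunction:
  assumes w: "vanishing_weight w" and \<epsilon>: "0 < \<epsilon>"
  defines "\<rho> \<equiv> Inf (growth_rates w)"
  shows "\<exists>\<mu> f c. \<rho> < \<mu> \<and> \<mu> < \<rho> + \<epsilon> \<and> bounded_measurable f \<and> (\<forall>x. 0 \<le> f x \<and> f x \<le> 1) \<and>
           (\<exists>x. 1/2 \<le> f x) \<and> 0 \<le> c \<and> c \<le> \<epsilon> \<and> (\<forall>x. \<mu> * f x = c + Q w f x)"
proof -
  have \<rho>: "0 < \<rho>" unfolding \<rho>_def by (rule Inf_growth_rates_pos[OF w])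
  obtain \<mu> g x where \<mu>: "\<rho> < \<mu>" "\<mu> < \<rho> + \<epsilon>" and g: "bounded_measurable g" "\<And>x. 1 \<le> g x"
    "\<And>x. Q w g x = \<mu> * (g x - 1)" "(\<rho> + \<epsilon>) / \<epsilon> < g x"
    using resolvent_blow_up[OF w \<epsilon>, folded \<rho>_def, of "(\<rho> + \<epsilon>) / \<epsilon>"] by blast
  define S where "S = Sup (range g)"
  have bdd: "bdd_above (range g)"
  proof -
    obtain B where "\<And>x. \<bar>g x\<bar> \<le> B" using bounded_measurable_bound[OF g(1)] by blast
    then have "\<And>x. g x \<le> B" by (simp add: abs_le_iff)
    then show ?thesis by (intro bdd_aboveI2)
  qed
  have gS: "g y \<le> S" for y unfolding S_def by (rule cSup_upper[OF _ bdd]) auto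
  have S1: "1 \<le> S" using g(2)[of x] gS[of x] by linarith
  have SC: "(\<rho> + \<epsilon>) / \<epsilon> < S" using g(4) gS[of x] by linarith
  have "\<exists>y. S / 2 < g y"
    using less_cSup_iff[OF _ bdd, of "S / 2"] S1 by (simp flip: S_def)
  then obtain y where y: "S / 2 < g y" by blast
  define f where "f x = (1 / S) * g x" for x
  have "\<mu> * f x = \<mu> / S + Q w f x" for x
    unfolding f_def[abs_def] Q_cmult g(3) using S1 by (simp add: field_simps)
  moreover have "bounded_measurable f" unfolding f_def[abs_def] by (intro bounded_measurable_cmult g)
  moreover have "0 \<le> f x \<and> f x \<le> 1" for x using gS[of x] S1 g(2)[of x] by (simp add: f_def)
  moreover have "1/2 \<le> f y" using y S1 by (simp add: f_def field_simps)
  moreover have "0 \<le> \<mu> / S" using \<rho> \<mu> S1 by simp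
  moreover have "\<mu> / S \<le> \<epsilon>"
  proof -
    have "\<mu> \<le> \<epsilon> * S" using SC \<epsilon> \<mu> by (simp add: divide_less_eq mult.commute)
    then show ?thesis using S1 by (simp add: divide_le_eq)
  qed
  ultimately show ?thesis using \<mu>
    by - (rule exI[of _ \<mu>], rule exI[of _ f], rule exI[of _ "\<mu> / S"], blast)
qed

text \<open>
  A (nearly) invariant function cannot escape to infinity: outside \<open>[-N, N]\<close> the killing keeps it below
  \<open>r / 8\<close>, so a value of at least \<open>1/2\<close> is taken inside, where it can only be produced by mass inside. The case
  \<open>c = 0\<close> is used for eigenfunctions, the case \<open>c > 0\<close> for their approximations.
\<close>

lemma mass_lower_bound:
  assumes f: "bounded_measurable f" "\<And>y. 0 \<le> f y" "1/2 \<le> f x"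
    and eq: "\<And>y. \<mu> * f y = c + Q w f y" and f1: "\<And>y. f y \<le> 1"
    and w: "\<And>y. 0 \<le> w y" "\<And>y. w y \<le> 1" and r: "0 < r" "r \<le> 1" "r \<le> \<mu>"
    and c: "c \<le> r\<^sup>2 / 16" and tail: "\<And>y. N < \<bar>y\<bar> \<Longrightarrow> w y \<le> r\<^sup>2 / 16"
    and K: "0 < K" "\<And>x y. \<bar>x\<bar> \<le> N \<Longrightarrow> \<bar>y\<bar> \<le> N \<Longrightarrow> k x y \<le> K"
  shows "r / (4 * K) \<le> mass N f"
proof -
  have f_abs: "\<bar>f y\<bar> \<le> 1" for y using f(2)[of y] f1[of y] by simp
  have Pf: "0 \<le> P f y" "P f y \<le> 1" for y
    using P_nonneg[OF f(1,2), of y] P_abs_le_const[OF f(1) f_abs, of y] by auto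
  have off: "f y \<le> r / 8" if "N < \<bar>y\<bar>" for y
  proof -
    have "r * f y \<le> \<mu> * f y" using r f(2) by (intro mult_right_mono) auto
    also have "\<dots> \<le> r\<^sup>2 / 16 + w y * 1" unfolding eq Q_def using c Pf w by (intro add_mono mult_left_mono) auto
    also have "\<dots> \<le> r * (r / 8)" using tail[OF that] by (simp add: power2_eq_square)
    finally show ?thesis using r by simp
  qed
  have x: "\<bar>x\<bar> \<le> N" using off[of x] f(3) r by (cases "\<bar>x\<bar> \<le> N") auto
  have r2: "r\<^sup>2 \<le> r" using r by (simp add: power2_eq_square mult_left_le)
  have "r * (1/2) \<le> \<mu> * f x" using r f(3) by (intro mult_mono) auto
  also have "\<dots> \<le> r / 16 + P f x" unfolding eq Q_def using c r2 w Pf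
    by (intro add_mono) (auto intro: mult_left_le_one_le)
  also have "P f x \<le> K * mass N f + r / 8"
    using r x by (intro P_upper f K off) auto
  finally have "r / 4 \<le> K * mass N f" using r by simp
  then show ?thesis using K by (simp add: field_simps)
qed

text \<open>
  Extract a subsequence that converges at rational points; equicontinuity carries the convergence to all
  points.
\<close>

lemma P_convergent_subsequence:
  assumes f: "\<And>n. f n \<in> borel_measurable borel" "\<And>n y. \<bar>f n y\<bar> \<le> 1"
  shows "\<exists>r. strict_mono (r :: nat \<Rightarrow> nat) \<and> (\<forall>x. convergent (\<lambda>n. P (f (r n)) x))"
proof -
  have bm: "bounded_measurable (f n)" for n by (rule bounded_measurableI[OF f])
  have P1: "norm (P (f n) x) \<le> 1" for n x using P_abs_le_const[OF bm f(2)] by simp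
  obtain r where r: "strict_mono (r :: nat \<Rightarrow> nat)"
    "\<And>x. x \<in> \<rat> \<Longrightarrow> \<exists>l. (\<lambda>n. P (f (r n)) x) \<longlonglongrightarrow> l"
    by (rule function_convergent_subsequence[where f = "\<lambda>n. P (f n)", OF countable_rat P1]) auto
  have "convergent (\<lambda>n. P (f (r n)) x)" for x
  proof -
    have "Cauchy (\<lambda>n. P (f (r n)) x)"
      unfolding Cauchy_def
    proof (intro allI impI)
      fix e :: real assume e: "0 < e"
      then obtain d where d: "d > 0" "\<And>x' g. \<bar>x' - x\<bar> < d \<Longrightarrow> g \<in> borel_measurable borel \<Longrightarrow>
          (\<forall>y. \<bar>g y\<bar> \<le> 1) \<Longrightarrow> \<bar>P g x' - P g x\<bar> < e / 3"
        using P_equicontinuous[of "e / 3" x] by auto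
      obtain q where q: "q \<in> \<rat>" "x < q" "q < x + d"
        using Rats_dense_in_real[of x "x + d"] d(1) by auto
      have "Cauchy (\<lambda>n. P (f (r n)) q)" using r(2)[OF q(1)] LIMSEQ_imp_Cauchy by blast
      then obtain M where M: "\<And>m n. m \<ge> M \<Longrightarrow> n \<ge> M \<Longrightarrow> dist (P (f (r m)) q) (P (f (r n)) q) < e / 3"
        using e unfolding Cauchy_def by (meson divide_pos_pos zero_less_numeral)
      have near: "\<bar>P (f (r m)) q - P (f (r m)) x\<bar> < e / 3" for m using d(2)[of q] q f by auto
      have "dist (P (f (r m)) x) (P (f (r n)) x) < e" if "m \<ge> M" "n \<ge> M" for m n
        using near[of m] near[of n] M[OF that] unfolding dist_real_def by linarith
      then show "\<exists>M. \<forall>m\<ge>M. \<forall>n\<ge>M. dist (P (f (r m)) x) (P (f (r n)) x) < e" by blast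
    qed
    then show ?thesis by (rule Cauchy_convergent)
  qed
  with r(1) show ?thesis by blast
qed

text \<open>
  The two conditions \<open>h \<le> 1\<close> and \<open>1/2 \<le> h x\<close> for some \<open>x\<close> fix the size of \<open>h\<close> up to a factor \<open>2\<close>, which
  is enough for all estimates and avoids showing that a supremum is attained.
\<close>

definition eigenpair :: "(real \<Rightarrow> real) \<Rightarrow> real \<Rightarrow> (real \<Rightarrow> real) \<Rightarrow> bool" where
  "eigenpair w \<rho> h \<longleftrightarrow> 0 < \<rho> \<and> bounded_measurable h \<and> (\<forall>x. 0 < h x \<and> h x \<le> 1) \<and>
     (\<exists>x. 1/2 \<le> h x) \<and> (\<forall>x. Q w h x = \<rho> * h x)"

text \<open>
  Along a subsequence the approximate eigenfunctions converge pointwise, and dominated convergence lets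
  the eigenvalue equation pass to the limit. The limit is not zero by \<open>mass_lower_bound\<close>.
\<close>

theorem eigenpair_exists:
  assumes w: "vanishing_weight w"
  shows "\<exists>\<rho> h. eigenpair w \<rho> h"
proof -
  define \<rho> where "\<rho> = Inf (growth_rates w)"
  have \<rho>: "0 < \<rho>" unfolding \<rho>_def by (rule Inf_growth_rates_pos[OF w])
  have \<rho>1: "\<rho> \<le> 1" unfolding \<rho>_def
    by (rule cInf_lower[OF one_in_growth_rates[OF w] growth_rates_bdd_below])
  have "\<forall>n. \<exists>\<mu> f c. \<rho> < \<mu> \<and> \<mu> < \<rho> + inverse (Suc n) \<and> bounded_measurable f \<and> (\<forall>x. 0 \<le> f x \<and> f x \<le> 1) \<and>
           (\<exists>x. 1/2 \<le> f x) \<and> 0 \<le> c \<and> c \<le> inverse (Suc n) \<and> (\<forall>x. \<mu> * f x = c + Q w f x)"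
    using approximate_eigenfunction[OF w] unfolding \<rho>_def by simp
  from choice[OF this] obtain \<mu> where "\<forall>n. \<exists>f c. \<rho> < \<mu> n \<and> \<mu> n < \<rho> + inverse (Suc n) \<and>
      bounded_measurable f \<and> (\<forall>x. 0 \<le> f x \<and> f x \<le> 1) \<and>
      (\<exists>x. 1/2 \<le> f x) \<and> 0 \<le> c \<and> c \<le> inverse (Suc n) \<and> (\<forall>x. \<mu> n * f x = c + Q w f x)" ..
  from choice[OF this] obtain f where "\<forall>n. \<exists>c. \<rho> < \<mu> n \<and> \<mu> n < \<rho> + inverse (Suc n) \<and>
      bounded_measurable (f n) \<and> (\<forall>x. 0 \<le> f n x \<and> f n x \<le> 1) \<and>
      (\<exists>x. 1/2 \<le> f n x) \<and> 0 \<le> c \<and> c \<le> inverse (Suc n) \<and> (\<forall>x. \<mu> n * f n x = c + Q w (f n) x)" ..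
  from choice[OF this] obtain c where all: "\<forall>n. \<rho> < \<mu> n \<and> \<mu> n < \<rho> + inverse (Suc n) \<and>
      bounded_measurable (f n) \<and> (\<forall>x. 0 \<le> f n x \<and> f n x \<le> 1) \<and>
      (\<exists>x. 1/2 \<le> f n x) \<and> 0 \<le> c n \<and> c n \<le> inverse (Suc n) \<and> (\<forall>x. \<mu> n * f n x = c n + Q w (f n) x)" ..
  have \<mu>: "\<And>n. \<rho> < \<mu> n" "\<And>n. \<mu> n < \<rho> + inverse (Suc n)"
    and f: "\<And>n. bounded_measurable (f n)" "\<And>n x. 0 \<le> f n x" "\<And>n x. f n x \<le> 1" "\<And>n. \<exists>x. 1/2 \<le> f n x"
    and c: "\<And>n. 0 \<le> c n" "\<And>n. c n \<le> inverse (Suc n)"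
    and eq: "\<And>n x. \<mu> n * f n x = c n + Q w (f n) x"
    using all by simp_all
  have \<mu>_lim: "\<mu> \<longlonglongrightarrow> \<rho>"
    by (rule tendsto_sandwich[OF _ _ tendsto_const LIMSEQ_inverse_real_of_nat_add[of \<rho>]])
      (use \<mu> in \<open>auto intro!: always_eventually less_imp_le\<close>)
  have c_lim: "c \<longlonglongrightarrow> 0"
    by (rule tendsto_sandwich[OF _ _ tendsto_const LIMSEQ_inverse_real_of_nat])
      (use c in \<open>auto intro!: always_eventually\<close>)
  have f_meas: "f n \<in> borel_measurable borel" for n by (rule bounded_measurable_measurable[OF f(1)])
  have f_abs: "\<bar>f n y\<bar> \<le> 1" for n y using f(2,3)[of n y] by simp
  obtain r where r: "strict_mono (r :: nat \<Rightarrow> nat)" "\<And>x. convergent (\<lambda>n. P (f (r n)) x)"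
    using P_convergent_subsequence[of f, OF f_meas f_abs] by blast
  then obtain F where F: "\<And>x. (\<lambda>n. P (f (r n)) x) \<longlonglongrightarrow> F x" unfolding convergent_def
    using choice[of "\<lambda>x l. (\<lambda>n. P (f (r n)) x) \<longlonglongrightarrow> l"] by blast
  define h where "h x = w x * F x / \<rho>" for x
  have lr: "(\<lambda>n. \<mu> (r n)) \<longlonglongrightarrow> \<rho>" "(\<lambda>n. c (r n)) \<longlonglongrightarrow> 0"
    using LIMSEQ_subseq_LIMSEQ[OF \<mu>_lim r(1)] LIMSEQ_subseq_LIMSEQ[OF c_lim r(1)] by (auto simp: comp_def)
  have f_lim: "(\<lambda>n. f (r n) x) \<longlonglongrightarrow> h x" for x
  proof -
    have "f n x = (c n + w x * P (f n) x) / \<mu> n" for n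
      using eq[of n x] \<mu>(1)[of n] \<rho> by (simp add: Q_def field_simps)
    moreover have "(\<lambda>n. (c (r n) + w x * P (f (r n)) x) / \<mu> (r n)) \<longlonglongrightarrow> (0 + w x * F x) / \<rho>"
      using \<rho> by (intro tendsto_intros lr F) auto
    ultimately show ?thesis by (simp add: h_def)
  qed
  have h_meas: "h \<in> borel_measurable borel"
    by (rule borel_measurable_LIMSEQ_real[OF f_lim f_meas])
  have h01: "0 \<le> h x" "h x \<le> 1" for x
    using LIMSEQ_le_const[OF f_lim] LIMSEQ_le_const2[OF f_lim] f(2,3) by blast+
  have h_bm: "bounded_measurable h" using h01 by (intro bounded_measurableI[OF h_meas, of 1]) auto
  have "F x = P h x" for x
    by (rule LIMSEQ_unique[OF F P_limit[OF f_meas h_meas f_abs f_lim]])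
  then have Qh: "Q w h x = \<rho> * h x" for x using \<rho> by (simp add: Q_def h_def)
  obtain N where N: "N > 0" "\<And>y. N < \<bar>y\<bar> \<Longrightarrow> w y < \<rho>\<^sup>2 / 16"
    using vanishing_weight_tail[OF w, of "\<rho>\<^sup>2 / 16"] \<rho> by auto
  obtain K where K: "K > 0" "\<And>x y. \<bar>x\<bar> \<le> N \<Longrightarrow> \<bar>y\<bar> \<le> N \<Longrightarrow> k x y \<le> K" using kernel_upper_bound by blast
  have "\<forall>\<^sub>F n in sequentially. c (r n) < \<rho>\<^sup>2 / 16" using \<rho> by (intro order_tendstoD(2)[OF lr(2)]) auto
  then have "\<forall>\<^sub>F n in sequentially. \<rho> / (4 * K) \<le> mass N (f (r n))"
  proof eventually_elim
    case (elim n)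
    obtain x where "1/2 \<le> f (r n) x" using f(4) by blast
    then show ?case
      by (rule mass_lower_bound[OF f(1,2) _ eq f(3) weight_nonneg[OF w] weight_le_one[OF w] \<rho> \<rho>1])
        (use \<mu>(1)[of "r n"] elim N K in \<open>auto intro: less_imp_le\<close>)
  qed
  then have "\<rho> / (4 * K) \<le> mass N h"
    using tendsto_le[OF _ mass_limit[OF f_meas h_meas f_abs f_lim] tendsto_const] by auto
  then have "0 < mass N h" using \<rho> K by (auto intro: less_le_trans[rotated])
  then have "0 < P h x" for x by (intro P_pos[OF h_bm h01(1), of "{-N..N}"]) (simp add: mass_def)
  then have hpos: "0 < h x" for x
  proof -
    have "0 < \<rho> * h x"
      using \<open>0 < P h x\<close> weight_pos[OF w, of x] by (simp add: Q_def flip: Qh)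
    then show ?thesis using \<rho> by (simp add: zero_less_mult_iff)
  qed
  define S where "S = Sup (range h)"
  have bdd: "bdd_above (range h)" using h01 by (auto intro!: bdd_aboveI2)
  have hS: "h y \<le> S" for y unfolding S_def by (rule cSup_upper[OF _ bdd]) auto
  have S: "0 < S" using hpos[of 0] hS[of 0] by linarith
  have "\<exists>y. S / 2 < h y"
    using less_cSup_iff[OF _ bdd, of "S / 2"] S by (simp flip: S_def)
  then obtain y where y: "S / 2 < h y" by blast
  have "eigenpair w \<rho> (\<lambda>x. (1/S) * h x)"
    unfolding eigenpair_def
  proof (intro conjI allI \<rho>)
    show "\<exists>x. 1/2 \<le> (1/S) * h x" using y S by (intro exI[of _ y]) (simp add: field_simps)
    show "Q w (\<lambda>x. (1/S) * h x) x = \<rho> * ((1/S) * h x)" for x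
      unfolding Q_cmult Qh by simp
    show "bounded_measurable (\<lambda>x. (1/S) * h x)" by (rule bounded_measurable_cmult[OF h_bm])
  qed (use S hpos hS in auto)
  then show ?thesis by blast
qed

end

section \<open>A spectral gap with uniform constants\<close>

context positive_markov_density
begin

lemma eigenpair_facts:
  assumes "eigenpair w \<rho> h"
  shows "0 < \<rho>" "bounded_measurable h" "0 < h x" "h x \<le> 1" "\<exists>x. 1/2 \<le> h x" "Q w h x = \<rho> * h x"
    "0 \<le> h x"
  using assms by (auto simp: eigenpair_def less_imp_le)

lemma eigenpair_P_bounds:
  assumes "eigenpair w \<rho> h"
  shows "0 \<le> P h x" "P h x \<le> 1"
proof -
  note e = eigenpair_facts[OF assms]
  show "0 \<le> P h x" by (intro P_nonneg e)
  have "\<bar>h y\<bar> \<le> 1" for y using e(3,4)[of y] by simp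
  then have "\<bar>P h x\<bar> \<le> 1" by (intro P_abs_le_const e)
  then show "P h x \<le> 1" by simp
qed

lemma eigenvalue_le_two:
  assumes w: "vanishing_weight w" and e: "eigenpair w \<rho> h"
  shows "\<rho> \<le> 2"
proof -
  note e' = eigenpair_facts[OF e]
  obtain x where x: "1/2 \<le> h x" using e'(5) by blast
  have "\<rho> * (1/2) \<le> \<rho> * h x" using x e'(1) by (intro mult_left_mono) auto
  also have "\<dots> \<le> 1 * 1"
    unfolding e'(6)[symmetric] Q_def
    using weight_le_one[OF w] eigenpair_P_bounds[OF e] by (intro mult_mono) auto
  finally show ?thesis by simp
qed

lemma eigenfunction_le_weight:
  assumes w: "vanishing_weight w" and e: "eigenpair w \<rho> h"
  shows "\<rho> * h x \<le> w x"
  unfolding eigenpair_facts(6)[OF e, symmetric] Q_def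
  using eigenpair_P_bounds[OF e] weight_nonneg[OF w] by (intro mult_left_le) auto

text \<open>
  Compare \<open>h\<close> with its minimum over the interval times the indicator of the interval, at the point where
  the minimum is attained.
\<close>

lemma eigenvalue_lower_bound:
  assumes w: "vanishing_weight w" and \<rho>: "0 < \<rho>"
    and h: "bounded_measurable h" "\<And>x. 0 < h x" "\<And>x. Q w h x = \<rho> * h x" and b: "0 \<le> b"
    and l: "\<And>x. \<bar>x\<bar> \<le> b \<Longrightarrow> l \<le> Q w (indicator {-b..b}) x"
  shows "l \<le> \<rho>"
proof -
  have h0: "0 \<le> h x" for x using h(2)[of x] by simp
  have w_cont: "continuous_on {-b..b} w"
    using w by (auto simp: vanishing_weight_def intro: continuous_on_subset)
  have "h x = w x * P h x / \<rho>" for x using h(3)[of x] \<rho> by (simp add: Q_def)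
  then have "h = (\<lambda>x. w x * P h x / \<rho>)" by blast
  moreover have "continuous_on {-b..b} (\<lambda>x. w x * P h x / \<rho>)"
    using h \<rho> by (intro continuous_intros w_cont P_continuous) auto
  ultimately have "continuous_on {-b..b} h" by (rule ssubst[where P = "continuous_on {-b..b}"])
  then obtain x where x: "x \<in> {-b..b}" "\<And>y. y \<in> {-b..b} \<Longrightarrow> h x \<le> h y"
    using continuous_attains_inf[of "{-b..b}" h] b by auto
  have "h x * l \<le> h x * Q w (indicator {-b..b}) x"
    using x h0 by (intro mult_left_mono l) auto
  also have "\<dots> = Q w (\<lambda>y. h x * indicator {-b..b} y) x" by (simp add: Q_cmult)
  also have "\<dots> \<le> Q w h x"
    using x h0 by (intro Q_mono w h bounded_measurable_intros) (auto simp: indicator_def)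
  also have "\<dots> = h x * \<rho>" by (simp add: h)
  finally show ?thesis using h(2)[of x] by simp
qed

lemma minorization:
  assumes w: "vanishing_weight w" and f: "bounded_measurable f" "\<And>y. 0 \<le> f y"
    and s: "\<And>y. \<bar>y\<bar> \<le> N \<Longrightarrow> s \<le> w x * k x y"
  shows "s * mass N f \<le> Q w f x"
proof -
  have "(s / w x) * mass N f \<le> P f x"
    using s weight_pos[OF w, of x] by (intro P_lower f) (auto simp: divide_le_eq mult.commute)
  then have "w x * ((s / w x) * mass N f) \<le> Q w f x"
    unfolding Q_def using weight_nonneg[OF w] by (intro mult_left_mono) auto
  then show ?thesis using weight_pos[OF w, of x] by simp
qed

text \<open>
  One step of \<open>Q w\<close> brings a function bounded by \<open>h + \<beta>\<close> within \<open>\<kappa> \<rho> (h + \<beta>)\<close> of a multiple of \<open>h\<close>. Three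
  zones are distinguished. For \<open>\<bar>x\<bar> \<le> b\<close> the minorization by \<open>s\<close> times Lebesgue measure on \<open>[-N, N]\<close>
  gains \<open>s J h\<close>, and half of this gain outweighs \<open>\<beta>\<close>, which is chosen in proportion to \<open>s J\<close>. For
  \<open>b < \<bar>x\<bar> \<le> b'\<close> the minorization still holds, and the term with \<open>\<beta>\<close> contracts because \<open>w\<close> is small. For
  \<open>\<bar>x\<bar> > b'\<close> subtracting the multiple of \<open>h\<close> costs at most \<open>4 N s h\<close>, but there \<open>h \<le> \<eta> / r\<close> is so small
  that the contraction of \<open>\<beta>\<close> pays for it. The factor \<open>s\<close> cancels in the last comparison, so \<open>\<eta>\<close>, and
  with it \<open>b'\<close>, can be chosen before \<open>s\<close>.
\<close>

lemma contraction_step: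
  assumes w: "vanishing_weight w" and e: "eigenpair w \<rho> h"
    and r: "0 < r" "r \<le> \<rho>" and N: "0 < N" and J: "0 < J" "J \<le> mass N h"
    and s: "0 < s" "\<And>x y. \<bar>x\<bar> \<le> b' \<Longrightarrow> \<bar>y\<bar> \<le> N \<Longrightarrow> s \<le> w x * k x y"
    and c: "0 < c" "\<And>x. \<bar>x\<bar> \<le> b \<Longrightarrow> c \<le> h x"
    and b: "b \<le> b'" "\<And>x. b < \<bar>x\<bar> \<Longrightarrow> w x \<le> r / 4"
    and b': "\<And>x. b' < \<bar>x\<bar> \<Longrightarrow> w x \<le> \<eta>"
    and \<eta>: "(J / 2 + 4 * N) * \<eta> \<le> r * (r * J * c / 8)"
    and \<beta>: "\<beta> = s * J * c / 2" "\<beta> \<le> 1"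
    and \<kappa>: "1/2 \<le> \<kappa>" "1 - s * J / 4 \<le> \<kappa>"
    and f: "bounded_measurable f" "\<And>y. \<bar>f y\<bar> \<le> h y + \<beta>"
  shows "\<bar>Q w f x - s * mass N f * h x\<bar> \<le> \<kappa> * \<rho> * (h x + \<beta>)"
proof -
  note e' = eigenpair_facts[OF e]
  define u where "u y = h y + \<beta>" for y
  define m where "m = mass N f"
  define A where "A = mass N u"
  have \<beta>0: "0 < \<beta>" using s(1) J(1) c(1) by (simp add: \<beta>(1))
  have \<rho>2: "\<rho> \<le> 2" by (rule eigenvalue_le_two[OF w e])
  have u_bm: "bounded_measurable u" unfolding u_def[abs_def] by (intro bounded_measurable_intros e')
  have fu: "0 \<le> u y + f y" "0 \<le> u y - f y" for y using f(2)[of y] by (auto simp: u_def)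
  have mA: "\<bar>m\<bar> \<le> A" unfolding m_def A_def using f by (intro mass_abs_le u_bm) (auto simp: u_def)
  have "mass N h \<le> A" unfolding A_def using \<beta>0 by (intro mass_mono u_bm e') (auto simp: u_def)
  then have JA: "J \<le> A" using J by simp
  have "A \<le> mass N (\<lambda>_. 2)" unfolding A_def
  proof (intro mass_mono u_bm bounded_measurable_const)
    show "u y \<le> 2" for y using e'(4)[of y] \<beta>(2) by (simp add: u_def)
  qed
  then have A4: "A \<le> 4 * N" using N by (simp add: mass_const)
  have Qu: "Q w u x = \<rho> * h x + \<beta> * w x"
    unfolding u_def[abs_def] by (subst Q_add) (auto simp: Q_const e' intro: e' bounded_measurable_const)
  have t0: "0 < s * J" using s J by simp
  have tA: "s * J * h x \<le> s * A * h x" using JA s e'(7)[of x] by (intro mult_right_mono mult_left_mono) auto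
  have "(1 - \<kappa>) * \<rho> \<le> (s * J / 4) * \<rho>" using \<kappa> e'(1) by (intro mult_right_mono) auto
  also have "\<dots> \<le> (s * J / 4) * 2" using t0 \<rho>2 by (intro mult_left_mono) auto
  finally have gain: "\<rho> - s * J / 2 \<le> \<kappa> * \<rho>" by (simp add: algebra_simps)
  have gain_h: "(\<rho> - s * J / 2) * h x \<le> (\<kappa> * \<rho>) * h x" using gain e'(7)[of x] by (rule mult_right_mono)
  have \<rho>\<beta>: "0 \<le> \<rho> * \<beta>" using e'(1) \<beta>0 by simp
  have half: "\<rho> / 2 * \<beta> \<le> \<kappa> * \<rho> * \<beta>" using \<kappa>(1) e'(1) \<beta>0 by (intro mult_right_mono) auto
  have quarter: "\<beta> * w x \<le> \<rho> / 4 * \<beta>" if "b < \<bar>x\<bar>"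
    using b(2)[OF that] r \<beta>0 by (simp add: mult.commute)
  show ?thesis
  proof (cases "\<bar>x\<bar> \<le> b'")
    case True
    \<comment> \<open>\<open>u + f\<close> and \<open>u - f\<close> are nonnegative, so the minorization applies to both\<close>
    have "\<bar>Q w f x - s * m * h x\<bar> \<le> Q w u x - s * A * h x"
    proof -
      have low: "s * mass N g * h x \<le> Q w g x" if "bounded_measurable g" "\<And>y. 0 \<le> g y" for g
      proof -
        have "0 \<le> mass N g"
          using mass_mono[OF bounded_measurable_const[of 0] that(1) that(2), of N] N by (simp add: mass_const)
        then have "s * mass N g * h x \<le> s * mass N g * 1"
          using s e'(4)[of x] by (intro mult_left_mono) auto
        also have "\<dots> \<le> Q w g x" using minorization[OF w that s(2)[OF True]] by simp
        finally show ?thesis .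
      qed
      have 1: "s * (A + m) * h x \<le> Q w u x + Q w f x"
        using low[OF bounded_measurable_add[OF u_bm f(1)] fu(1)]
        by (simp add: mass_add[OF u_bm f(1)] Q_add[OF u_bm f(1)] A_def m_def)
      have 2: "s * (A - m) * h x \<le> Q w u x - Q w f x"
        using low[OF bounded_measurable_diff[OF u_bm f(1)] fu(2)]
          mass_add[OF u_bm bounded_measurable_cmult[OF f(1), of "-1"], of N] mass_cmult[of N "-1" f]
        by (simp add: Q_diff[OF u_bm f(1)] A_def m_def)
      from 1 2 show ?thesis by (simp add: abs_le_iff algebra_simps)
    qed
    also have "\<dots> \<le> \<rho> * h x + \<beta> * w x - s * J * h x" using tA by (simp add: Qu)
    also have "\<dots> \<le> \<kappa> * \<rho> * (h x + \<beta>)"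
    proof (cases "\<bar>x\<bar> \<le> b")
      case True
      have "\<beta> * w x \<le> \<beta>" using \<beta>0 weight_le_one[OF w, of x] by simp
      also have "\<dots> \<le> s * J / 2 * h x" using mult_left_mono[OF c(2)[OF True], of "s * J"] t0 by (simp add: \<beta>(1))
      finally have "\<rho> * h x + \<beta> * w x - s * J * h x \<le> (\<rho> - s * J / 2) * h x"
        by (simp add: algebra_simps)
      also have "\<dots> \<le> \<kappa> * \<rho> * (h x + \<beta>)" using gain_h half \<rho>\<beta> by (simp add: distrib_left)
      finally show ?thesis .
    next
      case False
      have "0 \<le> s * J * h x" using t0 e'(7)[of x] by simp
      moreover have "\<beta> * w x \<le> \<rho> / 4 * \<beta>" using quarter False by simp
      ultimately show ?thesis using gain_h half \<rho>\<beta> by (simp add: algebra_simps)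
    qed
    finally show ?thesis by (simp add: m_def)
  next
    case False
    then have "b < \<bar>x\<bar>" using b(1) by simp
    have "\<bar>Q w f x\<bar> \<le> Q w u x" using f by (intro Q_abs_le w u_bm) (auto simp: u_def)
    moreover have "s * \<bar>m\<bar> * h x \<le> s * (4 * N) * h x"
      using mA A4 s e'(7)[of x] by (intro mult_right_mono mult_left_mono) auto
    then have "\<bar>s * m * h x\<bar> \<le> s * (4 * N) * h x"
      using s e'(7)[of x] by (simp add: abs_mult)
    ultimately have "\<bar>Q w f x - s * m * h x\<bar> \<le> \<rho> * h x + \<beta> * w x + s * (4 * N) * h x"
      using abs_triangle_ineq4[of "Q w f x" "s * m * h x"] by (simp add: Qu)
    moreover have loss: "s * (J / 2 + 4 * N) * h x \<le> \<rho> / 4 * \<beta>"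
    proof -
      have "r * h x \<le> \<rho> * h x" using r e'(7)[of x] by (intro mult_right_mono) auto
      also have "\<dots> \<le> w x" by (rule eigenfunction_le_weight[OF w e])
      also have "\<dots> \<le> \<eta>" using b' False by auto
      finally have "(J / 2 + 4 * N) * (r * h x) \<le> (J / 2 + 4 * N) * \<eta>"
        using J N by (intro mult_left_mono) auto
      also note \<eta>
      finally have "(J / 2 + 4 * N) * h x \<le> r * J * c / 8" using r by (simp add: mult_ac)
      then have "s * ((J / 2 + 4 * N) * h x) \<le> s * (r * J * c / 8)" using s by (intro mult_left_mono) auto
      also have "\<dots> = r / 4 * \<beta>" by (simp add: \<beta>(1))
      also have "\<dots> \<le> \<rho> / 4 * \<beta>" using r \<beta>0 by (intro mult_right_mono) auto
      finally show ?thesis by (simp add: mult.assoc)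
    qed
    ultimately show ?thesis
      using gain_h half quarter[OF \<open>b < \<bar>x\<bar>\<close>] by (simp add: m_def algebra_simps)
  qed
qed

text \<open>
  Splitting off the multiple of \<open>h\<close> in every step leaves a remainder that decays like \<open>(\<kappa> \<rho>)\<^sup>n\<close>, and the
  split-off multiples, rescaled by \<open>\<rho>\<^sup>n\<close>, form a convergent series with sum \<open>\<Lambda>\<close>.
\<close>

lemma contraction_iterate:
  assumes w: "vanishing_weight w" and e: "eigenpair w \<rho> h"
    and r: "0 < r" "r \<le> \<rho>" and N: "0 < N" and s: "0 < s" and \<beta>: "0 < \<beta>" "\<beta> \<le> 1" and \<kappa>: "0 < \<kappa>" "\<kappa> < 1"
    and contr: "\<And>f x. bounded_measurable f \<Longrightarrow> (\<And>y. \<bar>f y\<bar> \<le> h y + \<beta>) \<Longrightarrow>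
      \<bar>Q w f x - s * mass N f * h x\<bar> \<le> \<kappa> * \<rho> * (h x + \<beta>)"
    and f: "bounded_measurable f" "\<And>y. \<bar>f y\<bar> \<le> 1"
  shows "\<exists>\<Lambda>. \<forall>n x. \<bar>(Q w ^^ n) f x - \<rho> ^ n * \<Lambda> * h x\<bar>
     \<le> (4 * N * s / (\<beta> * r * (1 - \<kappa>)) + 2 / \<beta>) * (\<kappa> * \<rho>) ^ n"
proof -
  note e' = eigenpair_facts[OF e]
  define g where "g = rec_nat f (\<lambda>_ g x. Q w g x - s * mass N g * h x)"
  have g0: "g 0 = f" and gSuc: "g (Suc n) = (\<lambda>x. Q w (g n) x - s * mass N (g n) * h x)" for n
    by (auto simp: g_def)
  have g_bm: "bounded_measurable (g n)" for n
    by (induction n)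
      (auto simp: g0 gSuc intro!: f bounded_measurable_diff bounded_measurable_cmult Q_bounded_measurable w e')
  have \<kappa>\<rho>: "0 < \<kappa> * \<rho>" using \<kappa> e'(1) by simp
  have g_le: "\<bar>g n y\<bar> \<le> (\<kappa> * \<rho>) ^ n / \<beta> * (h y + \<beta>)" for n y
  proof (induction n arbitrary: y)
    case 0
    have "\<bar>f y\<bar> \<le> 1" by (rule f)
    also have "\<dots> \<le> 1 / \<beta> * (h y + \<beta>)" using \<beta> e'(7)[of y] by (simp add: field_simps)
    finally show ?case by (simp add: g0)
  next
    case (Suc n)
    define d where "d = (\<kappa> * \<rho>) ^ n / \<beta>"
    have d: "0 < d" unfolding d_def using \<kappa>\<rho> \<beta> by simp
    have "\<bar>Q w (\<lambda>y. (1/d) * g n y) y - s * mass N (\<lambda>y. (1/d) * g n y) * h y\<bar> \<le> \<kappa> * \<rho> * (h y + \<beta>)"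
    proof (rule contr)
      show "\<bar>(1/d) * g n y\<bar> \<le> h y + \<beta>" for y
      proof -
        have "\<bar>g n y\<bar> \<le> d * (h y + \<beta>)" using Suc[of y] by (simp add: d_def)
        then show ?thesis using d by (simp add: abs_mult divide_le_eq mult.commute)
      qed
    qed (rule bounded_measurable_cmult[OF g_bm])
    moreover have "Q w (\<lambda>y. (1/d) * g n y) y - s * mass N (\<lambda>y. (1/d) * g n y) * h y = (1/d) * g (Suc n) y"
      unfolding Q_cmult mass_cmult gSuc by (simp add: diff_divide_distrib)
    ultimately have "\<bar>(1/d) * g (Suc n) y\<bar> \<le> \<kappa> * \<rho> * (h y + \<beta>)" by simp
    then have "\<bar>g (Suc n) y\<bar> \<le> d * (\<kappa> * \<rho> * (h y + \<beta>))"
      using d by (simp add: abs_mult field_simps)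
    then show ?case by (simp add: d_def mult_ac)
  qed
  define a where "a i = s * mass N (g i) / \<rho> ^ Suc i" for i
  define D where "D = 4 * N * s / (\<beta> * r)"
  have a_le: "\<bar>a i\<bar> \<le> D * \<kappa> ^ i" for i
  proof -
    have "\<bar>mass N (g i)\<bar> \<le> mass N (\<lambda>y. (\<kappa> * \<rho>) ^ i / \<beta> * 2)"
    proof (intro mass_abs_le g_bm bounded_measurable_const)
      fix y
      have "(\<kappa> * \<rho>) ^ i / \<beta> * (h y + \<beta>) \<le> (\<kappa> * \<rho>) ^ i / \<beta> * 2"
        using \<kappa>\<rho> \<beta> e'(4)[of y] by (intro mult_left_mono) auto
      then show "\<bar>g i y\<bar> \<le> (\<kappa> * \<rho>) ^ i / \<beta> * 2" using g_le[of i y] by linarith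
    qed
    also have "\<dots> = 4 * N / \<beta> * (\<kappa> * \<rho>) ^ i" using N by (simp add: mass_const)
    finally have "s * \<bar>mass N (g i)\<bar> \<le> s * (4 * N / \<beta> * (\<kappa> * \<rho>) ^ i)" using s by (intro mult_left_mono) auto
    then have "s * \<bar>mass N (g i)\<bar> / \<rho> ^ Suc i \<le> s * (4 * N / \<beta> * (\<kappa> * \<rho>) ^ i) / \<rho> ^ Suc i"
      using e'(1) by (intro divide_right_mono) auto
    moreover have "\<bar>a i\<bar> = s * \<bar>mass N (g i)\<bar> / \<rho> ^ Suc i"
      using s e'(1) by (simp add: a_def abs_mult)
    ultimately have "\<bar>a i\<bar> \<le> s * (4 * N / \<beta> * (\<kappa> * \<rho>) ^ i) / \<rho> ^ Suc i" by simp
    also have "\<dots> = (4 * N * s / \<beta>) * \<kappa> ^ i / \<rho>"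
      using e'(1) by (simp add: power_mult_distrib)
    also have "\<dots> \<le> (4 * N * s / \<beta>) * \<kappa> ^ i / r"
      using r N s \<beta> \<kappa> by (intro divide_left_mono mult_pos_pos mult_nonneg_nonneg divide_nonneg_pos) auto
    finally show ?thesis using r \<beta> by (simp add: D_def)
  qed
  have geo: "summable (\<lambda>i. D * \<kappa> ^ i)" using \<kappa> by (intro summable_mult summable_geometric) auto
  have a_summ: "summable a" by (rule summable_comparison_test'[OF geo, of 0]) (use a_le in auto)
  have repr: "(Q w ^^ n) f = (\<lambda>x. \<rho> ^ n * (\<Sum>i<n. a i) * h x + g n x)" for n
  proof (induction n)
    case 0
    show ?case by (simp add: g0)
  next
    case (Suc n)
    have "(Q w ^^ Suc n) f = Q w (\<lambda>x. (\<rho> ^ n * (\<Sum>i<n. a i)) * h x + g n x)" by (simp add: Suc)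
    also have "\<dots> = (\<lambda>x. \<rho> ^ n * (\<Sum>i<n. a i) * (\<rho> * h x) + Q w (g n) x)"
      by (subst Q_add) (auto intro: bounded_measurable_cmult e' g_bm simp: Q_cmult e'(6))
    also have "\<dots> = (\<lambda>x. \<rho> ^ Suc n * (\<Sum>i<Suc n. a i) * h x + g (Suc n) x)"
      using e'(1) by (auto simp: gSuc a_def algebra_simps)
    finally show ?case .
  qed
  show ?thesis
  proof (intro exI[of _ "\<Sum>i. a i"] allI)
    fix n x
    have tail: "\<bar>(\<Sum>i<n. a i) - (\<Sum>i. a i)\<bar> \<le> D * \<kappa> ^ n / (1 - \<kappa>)"
    proof -
      have "(\<Sum>i. a i) - (\<Sum>i<n. a i) = (\<Sum>i. a (i + n))"
        using suminf_split_initial_segment[OF a_summ, of n] by simp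
      moreover have "\<bar>\<Sum>i. a (i + n)\<bar> \<le> (\<Sum>i. D * \<kappa> ^ n * \<kappa> ^ i)"
      proof -
        have s1: "summable (\<lambda>i. D * \<kappa> ^ n * \<kappa> ^ i)" using \<kappa> by (intro summable_mult summable_geometric) auto
        have "norm (a (i + n)) \<le> D * \<kappa> ^ n * \<kappa> ^ i" for i
          using a_le[of "i + n"] by (simp add: power_add mult_ac)
        from norm_suminf_le[OF this s1] show ?thesis by simp
      qed
      moreover have "(\<Sum>i. D * \<kappa> ^ n * \<kappa> ^ i) = D * \<kappa> ^ n / (1 - \<kappa>)"
        using \<kappa> by (subst suminf_mult) (auto simp: suminf_geometric summable_geometric)
      ultimately show ?thesis by (simp add: abs_minus_commute)
    qed
    have "(Q w ^^ n) f x - \<rho> ^ n * (\<Sum>i. a i) * h x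
        = \<rho> ^ n * h x * ((\<Sum>i<n. a i) - (\<Sum>i. a i)) + g n x"
      by (simp add: repr algebra_simps)
    also have "\<bar>\<dots>\<bar> \<le> \<rho> ^ n * h x * \<bar>(\<Sum>i<n. a i) - (\<Sum>i. a i)\<bar> + \<bar>g n x\<bar>"
      using e'(1,7) by (intro order_trans[OF abs_triangle_ineq]) (simp add: abs_mult)
    also have "\<dots> \<le> \<rho> ^ n * 1 * (D * \<kappa> ^ n / (1 - \<kappa>)) + (\<kappa> * \<rho>) ^ n / \<beta> * 2"
    proof (rule add_mono)
      show "\<rho> ^ n * h x * \<bar>(\<Sum>i<n. a i) - (\<Sum>i. a i)\<bar> \<le> \<rho> ^ n * 1 * (D * \<kappa> ^ n / (1 - \<kappa>))"
        using e'(1) e'(4,7)[of x] by (intro mult_mono tail) auto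
      have "(\<kappa> * \<rho>) ^ n / \<beta> * (h x + \<beta>) \<le> (\<kappa> * \<rho>) ^ n / \<beta> * 2"
        using \<kappa>\<rho> \<beta> e'(4)[of x] by (intro mult_left_mono) auto
      then show "\<bar>g n x\<bar> \<le> (\<kappa> * \<rho>) ^ n / \<beta> * 2" using g_le[of n x] by linarith
    qed
    also have "\<dots> = (4 * N * s / (\<beta> * r * (1 - \<kappa>)) + 2 / \<beta>) * (\<kappa> * \<rho>) ^ n"
      by (simp add: D_def power_mult_distrib algebra_simps)
    finally show "\<bar>(Q w ^^ n) f x - \<rho> ^ n * (\<Sum>i. a i) * h x\<bar>
      \<le> (4 * N * s / (\<beta> * r * (1 - \<kappa>)) + 2 / \<beta>) * (\<kappa> * \<rho>) ^ n" .
  qed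
qed

text \<open>
  The eigenfunction \<open>H\<close> is normalised by \<open>(Q w)\<^sup>n 1 \<approx> \<rho>\<^sup>n H\<close>, which makes it unique.
\<close>

definition spectral_gap ::
    "(real \<Rightarrow> real) \<Rightarrow> real \<Rightarrow> (real \<Rightarrow> real) \<Rightarrow> real \<Rightarrow> real \<Rightarrow> real \<Rightarrow> bool" where
  "spectral_gap w \<rho> H M \<theta> c \<longleftrightarrow>
     c \<le> \<rho> \<and> \<rho> \<le> 2 \<and> bounded_measurable H \<and> (\<forall>x. 0 < H x \<and> H x \<le> M) \<and>
     (\<forall>x. Q w H x = \<rho> * H x) \<and> (\<forall>n. c * \<rho> ^ n \<le> (Q w ^^ n) (\<lambda>_. 1) 0) \<and>
     (\<forall>n x. \<bar>(Q w ^^ n) (\<lambda>_. 1) x - \<rho> ^ n * H x\<bar> \<le> M * (\<theta> * \<rho>) ^ n) \<and>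
     (\<forall>f. bounded_measurable f \<longrightarrow> (\<forall>x. \<bar>f x\<bar> \<le> 1) \<longrightarrow>
        (\<exists>\<Lambda>. \<forall>n x. \<bar>(Q w ^^ n) f x - \<rho> ^ n * \<Lambda> * H x\<bar> \<le> M * (\<theta> * \<rho>) ^ n))"

text \<open>
  The constants are chosen in an order in which each depends only on \<open>k\<close>, \<open>w0\<close>, \<open>w1\<close> and its
  predecessors: a lower bound \<open>r\<close> for the eigenvalue, the interval \<open>[-N, N]\<close> that carries mass at least
  \<open>J\<close>, the zones \<open>b\<close> and \<open>b'\<close>, and finally the strength \<open>s\<close> of the minorization.
\<close>

theorem uniform_spectral_gap:
  assumes w0: "continuous_on UNIV w0" "\<And>x. 0 < w0 x" and w1: "(w1 \<longlongrightarrow> 0) at_infinity"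
  shows "\<exists>M \<theta> c. 0 < M \<and> 0 < \<theta> \<and> \<theta> < 1 \<and> 0 < c \<and>
    (\<forall>w. vanishing_weight w \<longrightarrow> (\<forall>x. w0 x \<le> w x \<and> w x \<le> w1 x) \<longrightarrow>
      (\<exists>\<rho> H. spectral_gap w \<rho> H M \<theta> c))"
proof -
  note tail = vanishing_at_infinity_tail[OF w1]
  obtain s0 where s0: "s0 > 0" "\<And>x y. \<bar>x\<bar> \<le> 1 \<Longrightarrow> \<bar>y\<bar> \<le> 1 \<Longrightarrow> s0 \<le> w0 x * k x y"
    using kernel_lower_bound[OF w0, of 1 1] by auto
  define r where "r = min 1 (2 * s0)"
  have r: "0 < r" "r \<le> 1" "r \<le> 2 * s0" using s0(1) by (auto simp: r_def)
  obtain N where N: "N > 0" "\<And>y. N < \<bar>y\<bar> \<Longrightarrow> w1 y < r\<^sup>2 / 16" using tail[of "r\<^sup>2 / 16"] r by auto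
  obtain K where K: "K > 0" "\<And>x y. \<bar>x\<bar> \<le> N \<Longrightarrow> \<bar>y\<bar> \<le> N \<Longrightarrow> k x y \<le> K" using kernel_upper_bound by blast
  define J where "J = r / (4 * K)"
  have J: "0 < J" using r K by (simp add: J_def)
  obtain b where b: "b > 0" "\<And>y. b < \<bar>y\<bar> \<Longrightarrow> w1 y < r / 4" using tail[of "r / 4"] r by auto
  obtain s1 where s1: "s1 > 0" "\<And>x y. \<bar>x\<bar> \<le> b \<Longrightarrow> \<bar>y\<bar> \<le> N \<Longrightarrow> s1 \<le> w0 x * k x y"
    using kernel_lower_bound[OF w0, of b N] b N by auto
  define c where "c = s1 * J / 2"
  have c: "0 < c" using s1 J by (simp add: c_def)
  define \<eta> where "\<eta> = r * (r * J * c / 8) / (J / 2 + 4 * N)"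
  have JN: "0 < J / 2 + 4 * N" using J N by simp
  have \<eta>0: "0 < \<eta>" unfolding \<eta>_def using r J c JN by (intro divide_pos_pos mult_pos_pos) auto
  have "d * (u / d) \<le> u" if "0 < d" for d u :: real using that by simp
  from this[OF JN] have \<eta>: "0 < \<eta>" "(J / 2 + 4 * N) * \<eta> \<le> r * (r * J * c / 8)"
    unfolding \<eta>_def using \<eta>0[unfolded \<eta>_def] by blast+
  obtain b2 where b2: "b2 > 0" "\<And>y. b2 < \<bar>y\<bar> \<Longrightarrow> w1 y < \<eta>" using tail[OF \<eta>(1)] by auto
  define b' where "b' = max b b2"
  obtain s2 where s2: "s2 > 0" "\<And>x y. \<bar>x\<bar> \<le> b' \<Longrightarrow> \<bar>y\<bar> \<le> N \<Longrightarrow> s2 \<le> w0 x * k x y"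
  proof -
    have "0 \<le> b'" "0 \<le> N" using b N by (auto simp: b'_def)
    from kernel_lower_bound[OF w0 this] show thesis using that by blast
  qed
  \<comment> \<open>the second bound ensures \<open>\<beta> \<le> 1\<close>\<close>
  define s where "s = min s2 (2 / (J * c))"
  have s: "0 < s" "s \<le> s2" "s \<le> 2 / (J * c)" using s2 J c by (auto simp: s_def)
  define \<beta> where "\<beta> = s * J * c / 2"
  have \<beta>: "0 < \<beta>" "\<beta> \<le> 1" using s J c by (auto simp: \<beta>_def field_simps)
  define \<kappa> where "\<kappa> = max (1/2) (1 - s * J / 4)"
  have \<kappa>: "0 < \<kappa>" "\<kappa> < 1" "1/2 \<le> \<kappa>" "1 - s * J / 4 \<le> \<kappa>"
    using s J by (auto simp: \<kappa>_def)
  define M where "M = 4 * N * s / (\<beta> * r * (1 - \<kappa>)) + 2 / \<beta>"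
  have M: "0 < M" unfolding M_def using N s \<beta> r \<kappa> by (intro add_pos_pos divide_pos_pos mult_pos_pos) auto
  have main: "\<exists>\<rho> H. spectral_gap w \<rho> H (M + 1) \<kappa> (min r c)"
    if w: "vanishing_weight w" and w01: "\<And>x. w0 x \<le> w x" "\<And>x. w x \<le> w1 x" for w
  proof -
    have wk: "w0 x * k x y \<le> w x * k x y" for x y using w01(1) k_pos[of x y] by (intro mult_right_mono) auto
    obtain \<rho> h where e: "eigenpair w \<rho> h" using eigenpair_exists[OF w] by blast
    note e' = eigenpair_facts[OF e]
    have \<rho>2: "\<rho> \<le> 2" by (rule eigenvalue_le_two[OF w e])
    have "2 * s0 \<le> \<rho>"
    proof (rule eigenvalue_lower_bound[OF w e'(1,2,3,6), of 1])
      fix x :: real assume x: "\<bar>x\<bar> \<le> 1"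
      have "s0 * mass 1 (indicator {-1..1}) \<le> Q w (indicator {-1..1}) x"
        by (rule minorization[OF w]) (use s0(2)[OF x] wk in \<open>auto intro: bounded_measurable_indicator order_trans\<close>)
      moreover have "mass 1 (indicator {-1..1}) = 2" by (simp add: mass_def flip: indicator_inter_arith)
      ultimately show "2 * s0 \<le> Q w (indicator {-1..1}) x" by simp
    qed simp
    then have r\<rho>: "r \<le> \<rho>" using r by simp
    obtain x0 where x0: "1/2 \<le> h x0" using e'(5) by blast
    have mJ: "J \<le> mass N h"
      unfolding J_def
    proof (rule mass_lower_bound[OF e'(2,7) x0 _ e'(4) weight_nonneg[OF w] weight_le_one[OF w] r(1,2) r\<rho>, of 0])
      show "w y \<le> r\<^sup>2 / 16" if "N < \<bar>y\<bar>" for y using N(2)[OF that] w01(2)[of y] by simp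
    qed (use e'(6) K in auto)
    have hc: "c \<le> h x" if "\<bar>x\<bar> \<le> b" for x
    proof -
      have "s1 * J \<le> s1 * mass N h" using mJ s1 by (intro mult_left_mono) auto
      also have "\<dots> \<le> Q w h x"
        by (rule minorization[OF w e'(2,7)]) (use s1(2)[OF that] wk in \<open>auto intro: order_trans\<close>)
      also have "\<dots> = \<rho> * h x" by (rule e')
      also have "\<dots> \<le> 2 * h x" using \<rho>2 e'(7)[of x] by (intro mult_right_mono) auto
      finally show ?thesis by (simp add: c_def)
    qed
    have contr: "\<bar>Q w f x - s * mass N f * h x\<bar> \<le> \<kappa> * \<rho> * (h x + \<beta>)"
      if f: "bounded_measurable f" "\<And>y. \<bar>f y\<bar> \<le> h y + \<beta>" for f x
    proof (rule contraction_step[where J = J and b = b and b' = b' and r = r and c = c and \<eta> = \<eta>, OF w e r(1) r\<rho> N(1) J mJ s(1)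
          _ c hc _ _ _ \<eta>(2) \<beta>_def \<beta>(2) \<kappa>(3,4) f])
      show "s \<le> w x * k x y" if "\<bar>x\<bar> \<le> b'" "\<bar>y\<bar> \<le> N" for x y
        using s2(2)[OF that] wk[of x y] s(2) by linarith
      show "w x \<le> r / 4" if "b < \<bar>x\<bar>" for x using b(2)[OF that] w01(2)[of x] by simp
      show "w x \<le> \<eta>" if "b' < \<bar>x\<bar>" for x using b2(2)[of x] that w01(2)[of x] by (simp add: b'_def)
    qed (auto simp: b'_def)
    have conv: "\<exists>\<Lambda>. \<forall>n x. \<bar>(Q w ^^ n) f x - \<rho> ^ n * \<Lambda> * h x\<bar> \<le> M * (\<kappa> * \<rho>) ^ n"
      if "bounded_measurable f" "\<And>y. \<bar>f y\<bar> \<le> 1" for f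
      unfolding M_def by (rule contraction_iterate[OF w e r(1) r\<rho> N(1) s(1) \<beta> \<kappa>(1,2) contr that])
    obtain \<Lambda>1 where \<Lambda>1: "\<And>n x. \<bar>(Q w ^^ n) (\<lambda>_. 1) x - \<rho> ^ n * \<Lambda>1 * h x\<bar> \<le> M * (\<kappa> * \<rho>) ^ n"
      using conv[OF bounded_measurable_const[of 1]] by auto
    have one_ge: "\<rho> ^ n * h x \<le> (Q w ^^ n) (\<lambda>_. 1) x" for n x
      using Q_pow_mono[OF w e'(2) bounded_measurable_const e'(4), of n x] Q_pow_eigen[of w h \<rho> n, OF e'(6)] by simp
    have \<kappa>\<rho>: "0 < \<kappa> * \<rho>" using \<kappa> e'(1) by simp
    \<comment> \<open>as \<open>h \<le> 1\<close>, the powers of \<open>Q w\<close> on \<open>1\<close> dominate \<open>\<rho>\<^sup>n h\<close>\<close>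
    have "1 \<le> \<Lambda>1"
    proof -
      have "h 0 \<le> \<Lambda>1 * h 0 + M * \<kappa> ^ n" for n
      proof -
        have "\<rho> ^ n * h 0 \<le> \<rho> ^ n * \<Lambda>1 * h 0 + M * (\<kappa> * \<rho>) ^ n" using one_ge[of n 0] \<Lambda>1[of n 0] by linarith
        also have "\<dots> = \<rho> ^ n * (\<Lambda>1 * h 0 + M * \<kappa> ^ n)" by (simp add: power_mult_distrib algebra_simps)
        finally show ?thesis using e'(1) by simp
      qed
      moreover have "(\<lambda>n. \<Lambda>1 * h 0 + M * \<kappa> ^ n) \<longlonglongrightarrow> \<Lambda>1 * h 0 + M * 0"
        using \<kappa> by (intro tendsto_intros LIMSEQ_power_zero) auto
      ultimately have "h 0 \<le> \<Lambda>1 * h 0" using LIMSEQ_le_const[of "\<lambda>n. \<Lambda>1 * h 0 + M * \<kappa> ^ n" "\<Lambda>1 * h 0" "h 0"] by auto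
      then show ?thesis using e'(3)[of 0] by simp
    qed
    define H where "H x = \<Lambda>1 * h x" for x
    have weaken: "M * (\<kappa> * \<rho>) ^ n \<le> (M + 1) * (\<kappa> * \<rho>) ^ n" for n using \<kappa>\<rho> by (intro mult_right_mono) auto
    show ?thesis
      unfolding spectral_gap_def
    proof (rule exI[of _ \<rho>], rule exI[of _ H], intro conjI allI impI)
      show "min r c \<le> \<rho>" using r\<rho> by simp
      show "\<rho> \<le> 2" by (rule \<rho>2)
      show "bounded_measurable H" unfolding H_def[abs_def] by (intro bounded_measurable_cmult e')
      show "0 < H x" for x using e'(3)[of x] \<open>1 \<le> \<Lambda>1\<close> by (simp add: H_def)
      show "H x \<le> M + 1" for x using \<Lambda>1[of 0 x] by (simp add: H_def)
      show "Q w H x = \<rho> * H x" for x unfolding H_def[abs_def] Q_cmult e'(6) by simp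
      show "min r c * \<rho> ^ n \<le> (Q w ^^ n) (\<lambda>_. 1) 0" for n
      proof -
        have "min r c * \<rho> ^ n \<le> h 0 * \<rho> ^ n" using hc[of 0] b e'(1) by (intro mult_right_mono) auto
        then show ?thesis using one_ge[of n 0] by (simp add: mult.commute)
      qed
      show "\<bar>(Q w ^^ n) (\<lambda>_. 1) x - \<rho> ^ n * H x\<bar> \<le> (M + 1) * (\<kappa> * \<rho>) ^ n" for n x
        using \<Lambda>1[of n x] weaken[of n] by (simp add: H_def mult.assoc)
      show "\<exists>\<Lambda>. \<forall>n x. \<bar>(Q w ^^ n) f x - \<rho> ^ n * \<Lambda> * H x\<bar> \<le> (M + 1) * (\<kappa> * \<rho>) ^ n"
        if f: "bounded_measurable f" "\<forall>x. \<bar>f x\<bar> \<le> 1" for f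
      proof -
        obtain \<Lambda> where \<Lambda>: "\<And>n x. \<bar>(Q w ^^ n) f x - \<rho> ^ n * \<Lambda> * h x\<bar> \<le> M * (\<kappa> * \<rho>) ^ n"
          using conv[OF f(1)] f(2) by auto
        show ?thesis
        proof (intro exI[of _ "\<Lambda> / \<Lambda>1"] allI)
          fix n x
          show "\<bar>(Q w ^^ n) f x - \<rho> ^ n * (\<Lambda> / \<Lambda>1) * H x\<bar> \<le> (M + 1) * (\<kappa> * \<rho>) ^ n"
            using \<Lambda>[of n x] weaken[of n] \<open>1 \<le> \<Lambda>1\<close> by (simp add: H_def)
        qed
      qed
    qed
  qed
  show ?thesis
    by (rule exI[of _ "M + 1"], rule exI[of _ \<kappa>], rule exI[of _ "min r c"])
      (use M \<kappa> r c main in auto)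
qed

lemma spectral_gapD:
  assumes "spectral_gap w \<rho> H M \<theta> c"
  shows "c \<le> \<rho>" "\<rho> \<le> 2" "bounded_measurable H" "0 < H x" "H x \<le> M" "Q w H x = \<rho> * H x"
    "c * \<rho> ^ n \<le> (Q w ^^ n) (\<lambda>_. 1) 0"
    "\<bar>(Q w ^^ n) (\<lambda>_. 1) x - \<rho> ^ n * H x\<bar> \<le> M * (\<theta> * \<rho>) ^ n"
    "bounded_measurable f \<Longrightarrow> (\<And>x. \<bar>f x\<bar> \<le> 1) \<Longrightarrow>
       \<exists>\<Lambda>. \<forall>n x. \<bar>(Q w ^^ n) f x - \<rho> ^ n * \<Lambda> * H x\<bar> \<le> M * (\<theta> * \<rho>) ^ n"
  using assms unfolding spectral_gap_def by simp_all

lemma spectral_gap_ratio: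
  assumes gap: "spectral_gap w \<rho> H M \<theta> c" and M: "0 < M" and \<theta>: "0 < \<theta>" "\<theta> < 1" and c: "0 < c"
  defines "u \<equiv> \<lambda>n. (Q w ^^ n) (\<lambda>_. 1) 0"
  shows "\<bar>u (Suc n) / u n - \<rho>\<bar> \<le> 4 * M / c * \<theta> ^ n"
proof -
  note g = spectral_gapD[OF gap]
  have \<rho>0: "0 < \<rho>" using g(1) c by simp
  have approx: "\<bar>u n - \<rho> ^ n * H 0\<bar> \<le> M * (\<theta> * \<rho>) ^ n" for n unfolding u_def by (rule g(8))
  have "0 < c * \<rho> ^ n" using c \<rho>0 by simp
  also have lower: "c * \<rho> ^ n \<le> u n" unfolding u_def by (rule g(7))
  finally have pos: "0 < u n" .
  have "\<bar>u (Suc n) - \<rho> * u n\<bar>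
    = \<bar>(u (Suc n) - \<rho> ^ Suc n * H 0) - \<rho> * (u n - \<rho> ^ n * H 0)\<bar>" by (simp add: algebra_simps)
  also have "\<dots> \<le> \<bar>u (Suc n) - \<rho> ^ Suc n * H 0\<bar> + \<rho> * \<bar>u n - \<rho> ^ n * H 0\<bar>"
    using \<rho>0 by (intro order_trans[OF abs_triangle_ineq4]) (simp add: abs_mult)
  also have "\<dots> \<le> M * (\<theta> * \<rho>) ^ Suc n + \<rho> * (M * (\<theta> * \<rho>) ^ n)"
    using \<rho>0 by (intro add_mono mult_left_mono approx) auto
  also have "\<dots> = (\<theta> + 1) * (\<rho> * (M * (\<theta> * \<rho>) ^ n))" by (simp add: algebra_simps)
  also have "\<dots> \<le> 2 * (2 * (M * (\<theta> * \<rho>) ^ n))"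
    using \<theta> g(2) \<rho>0 M by (intro mult_mono mult_nonneg_nonneg) auto
  also have "\<dots> = (4 * M / c * \<theta> ^ n) * (c * \<rho> ^ n)" using c by (simp add: power_mult_distrib)
  also have "\<dots> \<le> (4 * M / c * \<theta> ^ n) * u n"
    using lower \<theta> c M by (intro mult_left_mono) auto
  finally have "\<bar>u (Suc n) - \<rho> * u n\<bar> / u n \<le> 4 * M / c * \<theta> ^ n"
    using pos by (simp add: divide_le_eq)
  moreover have "u (Suc n) / u n - \<rho> = (u (Suc n) - \<rho> * u n) / u n"
    using pos by (simp add: field_simps)
  ultimately show ?thesis using pos by simp
qed

end

section \<open>The exponentially tilted family\<close>

lemma LIMSEQ_geometric_error:
  fixes a :: "nat \<Rightarrow> real"
  assumes "0 < \<theta>" "\<theta> < 1" "\<And>n. \<bar>a n - L\<bar> \<le> C * \<theta> ^ n"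
  shows "a \<longlonglongrightarrow> L"
proof -
  have "(\<lambda>n. C * \<theta> ^ n) \<longlonglongrightarrow> 0"
    using tendsto_mult_left[OF LIMSEQ_power_zero[of \<theta>], of C] assms by simp
  then have "(\<lambda>n. a n - L) \<longlonglongrightarrow> 0"
    by (rule Lim_null_comparison[rotated]) (simp add: assms(3))
  then show ?thesis by (simp add: LIM_zero_iff)
qed

lemma geometric_relative_error:
  fixes y e l \<rho> :: real
  assumes "0 < e" "0 < \<rho>" "\<bar>y - \<rho> ^ n * l * e\<bar> \<le> M * (\<theta> * \<rho>) ^ n"
  shows "\<bar>y / (\<rho> ^ n * e) - l\<bar> \<le> M / e * \<theta> ^ n"
proof -
  have d: "0 < \<rho> ^ n * e" using assms by simp
  have "y / (\<rho> ^ n * e) - l = (y - \<rho> ^ n * l * e) / (\<rho> ^ n * e)"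
    using assms by (simp add: diff_divide_distrib)
  then have "\<bar>y / (\<rho> ^ n * e) - l\<bar> = \<bar>y - \<rho> ^ n * l * e\<bar> / (\<rho> ^ n * e)"
    using d by (simp add: abs_divide)
  also have "\<dots> \<le> M * (\<theta> * \<rho>) ^ n / (\<rho> ^ n * e)" using assms(3) d by (intro divide_right_mono) auto
  also have "\<dots> = M / e * \<theta> ^ n" using assms by (simp add: power_mult_distrib)
  finally show ?thesis .
qed

locale tilted_markov_density = positive_markov_density +
  fixes \<xi> :: "real \<Rightarrow> real"
  assumes \<xi>_continuous: "continuous_on UNIV \<xi>"
    and \<xi>_nonneg: "\<And>x. 0 \<le> \<xi> x"
    and \<xi>_coercive: "filterlim \<xi> at_top at_infinity"
    and \<xi>_pos_AE: "AE x in lborel. 0 < \<xi> x"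
begin

definition wt :: "real \<Rightarrow> real \<Rightarrow> real" where
  "wt \<gamma> x = exp (- \<gamma> * \<xi> x)"

text \<open>
  For the chain with transition density \<open>k\<close> this is the expectation of \<open>exp (- \<gamma> (\<xi>(X\<^sub>0) + \<dots> + \<xi>(X\<^sub>n\<^sub>-\<^sub>1)))\<close>
  under \<open>P\<^sub>x\<close>. The growth rate \<open>rho\<close>, the eigenfunction \<open>eig\<close> and the eigenfunctional \<open>dual\<close> are defined
  as limits, which makes them canonical functions of \<open>\<gamma>\<close>.
\<close>

definition laplace :: "real \<Rightarrow> nat \<Rightarrow> real \<Rightarrow> real" where
  "laplace \<gamma> n = (Q (wt \<gamma>) ^^ n) (\<lambda>_. 1)"

definition rho :: "real \<Rightarrow> real" where
  "rho \<gamma> = lim (\<lambda>n. laplace \<gamma> (Suc n) 0 / laplace \<gamma> n 0)"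

definition eig :: "real \<Rightarrow> real \<Rightarrow> real" where
  "eig \<gamma> x = lim (\<lambda>n. laplace \<gamma> n x / rho \<gamma> ^ n)"

definition dual :: "real \<Rightarrow> (real \<Rightarrow> real) \<Rightarrow> real" where
  "dual \<gamma> f = lim (\<lambda>n. (Q (wt \<gamma>) ^^ n) f 0 / (rho \<gamma> ^ n * eig \<gamma> 0))"

lemma wt_continuous: "continuous_on S (wt \<gamma>)"
  unfolding wt_def[abs_def]
  by (intro continuous_intros continuous_on_subset[OF \<xi>_continuous]) auto

lemma wt_pos: "0 < wt \<gamma> x" and wt_nonneg: "0 \<le> wt \<gamma> x" by (auto simp: wt_def)

lemma wt_le_one: "0 \<le> \<gamma> \<Longrightarrow> wt \<gamma> x \<le> 1"
  using \<xi>_nonneg by (simp add: wt_def)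

lemma wt_antimono: "\<gamma> \<le> \<gamma>' \<Longrightarrow> wt \<gamma>' x \<le> wt \<gamma> x"
  using \<xi>_nonneg by (simp add: wt_def mult_right_mono)

lemma wt_vanishes: "0 < \<gamma> \<Longrightarrow> (wt \<gamma> \<longlongrightarrow> 0) at_infinity"
  unfolding wt_def[abs_def]
proof (rule filterlim_compose[OF exp_at_bot])
  assume "0 < \<gamma>"
  then have "filterlim (\<lambda>x. \<gamma> * \<xi> x) at_top at_infinity"
    using \<xi>_coercive by (intro filterlim_tendsto_pos_mult_at_top[OF tendsto_const])
  then show "filterlim (\<lambda>x. - \<gamma> * \<xi> x) at_bot at_infinity"
    by (simp add: filterlim_uminus_at_top)
qed

lemma wt_vanishing_weight: "0 < \<gamma> \<Longrightarrow> vanishing_weight (wt \<gamma>)"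
  by (simp add: vanishing_weight_def wt_continuous wt_pos wt_le_one wt_vanishes)

lemma laplace_0: "laplace \<gamma> 0 x = 1" and laplace_Suc: "laplace \<gamma> (Suc n) = Q (wt \<gamma>) (laplace \<gamma> n)"
  by (simp_all add: laplace_def)

lemma laplace_bounded_measurable: "0 < \<gamma> \<Longrightarrow> bounded_measurable (laplace \<gamma> n)"
  unfolding laplace_def by (intro Q_pow_bounded_measurable wt_vanishing_weight bounded_measurable_const)

lemma laplace_nonneg: "0 < \<gamma> \<Longrightarrow> 0 \<le> laplace \<gamma> n x"
  unfolding laplace_def by (intro Q_pow_one_nonneg wt_vanishing_weight)

lemma laplace_le_one: "0 < \<gamma> \<Longrightarrow> laplace \<gamma> n x \<le> 1"
  unfolding laplace_def by (intro Q_pow_one_le_one wt_vanishing_weight)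

text \<open>
  On \<open>[a, b]\<close> the weights lie between \<open>wt b\<close> and \<open>wt a\<close>, so one set of constants serves them all.
\<close>

theorem spectral_gap_on_interval:
  assumes "0 < a"
  shows "\<exists>M \<theta> c. 0 < M \<and> 0 < \<theta> \<and> \<theta> < 1 \<and> 0 < c \<and>
    (\<forall>\<gamma>\<in>{a..b}. spectral_gap (wt \<gamma>) (rho \<gamma>) (eig \<gamma>) M \<theta> c)"
proof -
  from uniform_spectral_gap[OF wt_continuous[of _ b] wt_pos wt_vanishes[OF assms]]
  obtain M \<theta> c where M: "0 < M" and \<theta>: "0 < \<theta>" "\<theta> < 1" and c: "0 < c" and gap:
    "\<And>w. vanishing_weight w \<Longrightarrow> (\<forall>x. wt b x \<le> w x \<and> w x \<le> wt a x) \<Longrightarrow>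
      (\<exists>\<rho> H. spectral_gap w \<rho> H M \<theta> c)"
    by blast
  have "spectral_gap (wt \<gamma>) (rho \<gamma>) (eig \<gamma>) M \<theta> c" if \<gamma>: "a \<le> \<gamma>" "\<gamma> \<le> b" for \<gamma>
  proof -
    have "0 < \<gamma>" using \<gamma> assms by simp
    have "\<forall>x. wt b x \<le> wt \<gamma> x \<and> wt \<gamma> x \<le> wt a x" using \<gamma> by (auto intro: wt_antimono)
    from gap[OF wt_vanishing_weight[OF \<open>0 < \<gamma>\<close>] this] obtain \<rho> H where
      g: "spectral_gap (wt \<gamma>) \<rho> H M \<theta> c" by blast
    have \<rho>0: "0 < \<rho>" using spectral_gapD(1)[OF g] c by simp
    have geo: "(\<lambda>n. K * \<theta> ^ n) \<longlonglongrightarrow> 0" for K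
      using tendsto_mult_left[OF LIMSEQ_power_zero[of \<theta>], of K] \<theta> by simp
    have "(\<lambda>n. laplace \<gamma> (Suc n) 0 / laplace \<gamma> n 0 - \<rho>) \<longlonglongrightarrow> 0"
      by (rule Lim_null_comparison[OF _ geo[of "4 * M / c"]])
        (use spectral_gap_ratio[OF g M \<theta> c] in \<open>simp add: laplace_def\<close>)
    then have "(\<lambda>n. laplace \<gamma> (Suc n) 0 / laplace \<gamma> n 0) \<longlonglongrightarrow> \<rho>" by (simp add: LIM_zero_iff)
    then have rho: "rho \<gamma> = \<rho>" unfolding rho_def by (rule limI)
    have eig: "eig \<gamma> = H"
    proof
      fix x
      have "\<bar>laplace \<gamma> n x / \<rho> ^ n - H x\<bar> \<le> M * \<theta> ^ n" for n
      proof -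
        have "\<bar>laplace \<gamma> n x / \<rho> ^ n - H x\<bar> = \<bar>(laplace \<gamma> n x - \<rho> ^ n * H x) / \<rho> ^ n\<bar>"
          using \<rho>0 by (simp add: diff_divide_distrib)
        also have "\<dots> = \<bar>laplace \<gamma> n x - \<rho> ^ n * H x\<bar> / \<rho> ^ n" using \<rho>0 by simp
        also have "\<dots> \<le> M * (\<theta> * \<rho>) ^ n / \<rho> ^ n"
          unfolding laplace_def using \<rho>0 by (intro divide_right_mono spectral_gapD(8)[OF g]) auto
        finally show ?thesis using \<rho>0 by (simp add: power_mult_distrib)
      qed
      then have "(\<lambda>n. laplace \<gamma> n x / \<rho> ^ n - H x) \<longlonglongrightarrow> 0"
        by (intro Lim_null_comparison[OF _ geo[of M]]) auto
      then have "(\<lambda>n. laplace \<gamma> n x / \<rho> ^ n) \<longlonglongrightarrow> H x" by (simp add: LIM_zero_iff)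
      then show "eig \<gamma> x = H x" unfolding eig_def rho by (rule limI)
    qed
    show ?thesis unfolding rho eig by (rule g)
  qed
  then have "\<forall>\<gamma>\<in>{a..b}. spectral_gap (wt \<gamma>) (rho \<gamma>) (eig \<gamma>) M \<theta> c" by simp
  with M \<theta> c show ?thesis by blast
qed

lemma spectral_gap_at:
  assumes "0 < \<gamma>"
  obtains M \<theta> c where "0 < M" "0 < \<theta>" "\<theta> < 1" "0 < c" "spectral_gap (wt \<gamma>) (rho \<gamma>) (eig \<gamma>) M \<theta> c"
proof -
  from spectral_gap_on_interval[OF assms, of \<gamma>] obtain M \<theta> c
    where "0 < M" "0 < \<theta>" "\<theta> < 1" "0 < c" "\<forall>\<gamma>'\<in>{\<gamma>..\<gamma>}. spectral_gap (wt \<gamma>') (rho \<gamma>') (eig \<gamma>') M \<theta> c"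
    by blast
  then show thesis by (intro that[of M \<theta> c]) auto
qed

lemma
  assumes "0 < \<gamma>"
  shows rho_pos: "0 < rho \<gamma>"
    and eig_bounded_measurable: "bounded_measurable (eig \<gamma>)"
    and eig_pos: "0 < eig \<gamma> x"
    and Q_eig: "Q (wt \<gamma>) (eig \<gamma>) x = rho \<gamma> * eig \<gamma> x"
proof -
  obtain M \<theta> c where "0 < c" and g: "spectral_gap (wt \<gamma>) (rho \<gamma>) (eig \<gamma>) M \<theta> c"
    using spectral_gap_at[OF assms] by blast
  then show "0 < rho \<gamma>" using spectral_gapD(1)[OF g] by simp
  show "bounded_measurable (eig \<gamma>)" "0 < eig \<gamma> x" "Q (wt \<gamma>) (eig \<gamma>) x = rho \<gamma> * eig \<gamma> x"
    by (rule spectral_gapD[OF g])+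
qed

lemma dual_limit:
  assumes \<gamma>: "0 < \<gamma>" and f: "bounded_measurable f"
  shows "(\<lambda>n. (Q (wt \<gamma>) ^^ n) f x / (rho \<gamma> ^ n * eig \<gamma> x)) \<longlonglongrightarrow> dual \<gamma> f"
proof -
  obtain M \<theta> c where M: "0 < M" and \<theta>: "0 < \<theta>" "\<theta> < 1"
    and gap: "spectral_gap (wt \<gamma>) (rho \<gamma>) (eig \<gamma>) M \<theta> c"
    using spectral_gap_at[OF \<gamma>] by blast
  obtain B where B: "0 < B" "\<And>x. \<bar>f x\<bar> \<le> B" using bounded_measurable_bound[OF f] by blast
  define g where "g x = (1/B) * f x" for x
  have g: "bounded_measurable g" unfolding g_def[abs_def] by (rule bounded_measurable_cmult[OF f])
  have fg: "f = (\<lambda>x. B * g x)" using B(1) by (simp add: g_def)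
  have "\<bar>g x\<bar> \<le> 1" for x using B by (simp add: g_def abs_mult)
  from spectral_gapD(9)[OF gap g this] obtain \<Lambda> where
    \<Lambda>: "\<And>n x. \<bar>(Q (wt \<gamma>) ^^ n) g x - rho \<gamma> ^ n * \<Lambda> * eig \<gamma> x\<bar> \<le> M * (\<theta> * rho \<gamma>) ^ n" by auto
  have lim: "(\<lambda>n. (Q (wt \<gamma>) ^^ n) f x / (rho \<gamma> ^ n * eig \<gamma> x)) \<longlonglongrightarrow> B * \<Lambda>" for x
  proof -
    have "(\<lambda>n. (Q (wt \<gamma>) ^^ n) g x / (rho \<gamma> ^ n * eig \<gamma> x)) \<longlonglongrightarrow> \<Lambda>"
      by (rule LIMSEQ_geometric_error[OF \<theta>
          geometric_relative_error[OF eig_pos[OF \<gamma>] rho_pos[OF \<gamma>] \<Lambda>]])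
    from tendsto_mult_left[OF this, of B]
    show ?thesis unfolding fg Q_pow_cmult by (simp only: times_divide_eq_right)
  qed
  from lim[of 0] have "dual \<gamma> f = B * \<Lambda>" unfolding dual_def by (rule limI)
  with lim[of x] show ?thesis by (simp only:)
qed

lemma dual_add:
  assumes "0 < \<gamma>" "bounded_measurable f" "bounded_measurable g"
  shows "dual \<gamma> (\<lambda>x. f x + g x) = dual \<gamma> f + dual \<gamma> g"
  by (rule LIMSEQ_unique[OF dual_limit[where x = 0]])
    (auto simp: Q_pow_add wt_vanishing_weight add_divide_distrib assms
      intro!: tendsto_add dual_limit bounded_measurable_add)

lemma dual_cmult:
  assumes "0 < \<gamma>" "bounded_measurable f"
  shows "dual \<gamma> (\<lambda>x. c * f x) = c * dual \<gamma> f"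
proof (rule LIMSEQ_unique[OF dual_limit[where x = 0]])
  have "(\<lambda>n. c * ((Q (wt \<gamma>) ^^ n) f 0 / (rho \<gamma> ^ n * eig \<gamma> 0))) \<longlonglongrightarrow> c * dual \<gamma> f"
    by (intro tendsto_mult_left dual_limit assms)
  then show "(\<lambda>n. (Q (wt \<gamma>) ^^ n) (\<lambda>x. c * f x) 0 / (rho \<gamma> ^ n * eig \<gamma> 0)) \<longlonglongrightarrow> c * dual \<gamma> f"
    unfolding Q_pow_cmult by simp
qed (auto intro: assms bounded_measurable_cmult)

lemma dual_diff:
  assumes "0 < \<gamma>" "bounded_measurable f" "bounded_measurable g"
  shows "dual \<gamma> (\<lambda>x. f x - g x) = dual \<gamma> f - dual \<gamma> g"
  using dual_add[OF assms(1,2) bounded_measurable_cmult[OF assms(3)], of "-1"]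
    dual_cmult[OF assms(1,3), of "-1"] by simp

lemma dual_mono:
  assumes "0 < \<gamma>" "bounded_measurable f" "bounded_measurable g" "\<And>x. f x \<le> g x"
  shows "dual \<gamma> f \<le> dual \<gamma> g"
  using assms eig_pos[OF assms(1), of 0] rho_pos[OF assms(1)]
  by (intro LIMSEQ_le[OF dual_limit[of _ _ 0] dual_limit[of _ _ 0]])
    (auto intro!: divide_right_mono Q_pow_mono wt_vanishing_weight)

lemma dual_eig:
  assumes "0 < \<gamma>"
  shows "dual \<gamma> (eig \<gamma>) = 1"
proof -
  have "(Q (wt \<gamma>) ^^ n) (eig \<gamma>) 0 / (rho \<gamma> ^ n * eig \<gamma> 0) = 1" for n
    unfolding Q_pow_eigen[of "wt \<gamma>" "eig \<gamma>" "rho \<gamma>", OF Q_eig[OF assms]]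
    using eig_pos[OF assms, of 0] rho_pos[OF assms] by simp
  then have "(\<lambda>n::nat. 1) \<longlonglongrightarrow> dual \<gamma> (eig \<gamma>)"
    using dual_limit[OF assms eig_bounded_measurable[OF assms], of 0] by (simp only:)
  then show ?thesis by (simp add: LIMSEQ_const_iff)
qed

lemma dual_one:
  assumes "0 < \<gamma>"
  shows "dual \<gamma> (\<lambda>_. 1) = 1"
proof -
  obtain M \<theta> c where M: "0 < M" and \<theta>: "0 < \<theta>" "\<theta> < 1"
    and gap: "spectral_gap (wt \<gamma>) (rho \<gamma>) (eig \<gamma>) M \<theta> c"
    using spectral_gap_at[OF assms] by blast
  have "\<bar>laplace \<gamma> n 0 - rho \<gamma> ^ n * 1 * eig \<gamma> 0\<bar> \<le> M * (\<theta> * rho \<gamma>) ^ n" for n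
    using spectral_gapD(8)[OF gap, of n 0] by (simp only: laplace_def mult_1_right)
  from LIMSEQ_geometric_error[OF \<theta> geometric_relative_error[OF eig_pos[OF assms] rho_pos[OF assms] this]]
  show ?thesis
    unfolding laplace_def by (rule LIMSEQ_unique[OF dual_limit[OF assms bounded_measurable_const[of 1], of 0]])
qed

lemma dual_abs_le:
  assumes "0 < \<gamma>" "bounded_measurable f" "\<And>x. \<bar>f x\<bar> \<le> B"
  shows "\<bar>dual \<gamma> f\<bar> \<le> B"
proof -
  have B: "dual \<gamma> (\<lambda>_. B) = B" using dual_cmult[OF assms(1) bounded_measurable_const[of 1], of B] dual_one[OF assms(1)] by simp
  have "dual \<gamma> f \<le> dual \<gamma> (\<lambda>_. B)"
    using assms by (intro dual_mono bounded_measurable_const) (auto simp: abs_le_iff)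
  moreover have "dual \<gamma> (\<lambda>x. (-1) * f x) \<le> dual \<gamma> (\<lambda>_. B)"
    using assms by (intro dual_mono bounded_measurable_const bounded_measurable_cmult) (auto simp: abs_le_iff)
  ultimately show ?thesis using dual_cmult[OF assms(1,2), of "-1"] B by simp
qed

lemma dual_Q:
  assumes "0 < \<gamma>" "bounded_measurable f"
  shows "dual \<gamma> (Q (wt \<gamma>) f) = rho \<gamma> * dual \<gamma> f"
proof (rule LIMSEQ_unique)
  show "(\<lambda>n. (Q (wt \<gamma>) ^^ n) (Q (wt \<gamma>) f) 0 / (rho \<gamma> ^ n * eig \<gamma> 0)) \<longlonglongrightarrow> dual \<gamma> (Q (wt \<gamma>) f)"
    by (intro dual_limit assms Q_bounded_measurable wt_vanishing_weight)
  have "(\<lambda>n. rho \<gamma> * ((Q (wt \<gamma>) ^^ Suc n) f 0 / (rho \<gamma> ^ Suc n * eig \<gamma> 0))) \<longlonglongrightarrow> rho \<gamma> * dual \<gamma> f"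
    by (intro tendsto_mult_left LIMSEQ_Suc dual_limit assms)
  moreover have "rho \<gamma> * ((Q (wt \<gamma>) ^^ Suc n) f 0 / (rho \<gamma> ^ Suc n * eig \<gamma> 0))
      = (Q (wt \<gamma>) ^^ n) (Q (wt \<gamma>) f) 0 / (rho \<gamma> ^ n * eig \<gamma> 0)" for n
    using rho_pos[OF assms(1)] by (simp add: funpow_Suc_right del: funpow.simps)
  ultimately show "(\<lambda>n. (Q (wt \<gamma>) ^^ n) (Q (wt \<gamma>) f) 0 / (rho \<gamma> ^ n * eig \<gamma> 0)) \<longlonglongrightarrow> rho \<gamma> * dual \<gamma> f"
    by simp
qed

text \<open>
  The normalisation \<open>dual \<gamma> (eig \<gamma>) = 1\<close> and the decay of the eigenfunction show that the functional
  charges some interval \<open>[-N, N]\<close>, and \<open>Q f\<close> is bounded below on this interval.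
\<close>

lemma dual_pos:
  assumes \<gamma>: "0 < \<gamma>" and f: "bounded_measurable f" "\<And>x. 0 \<le> f x" "AE x in lborel. 0 < f x"
  shows "0 < dual \<gamma> f"
proof -
  have W: "vanishing_weight (wt \<gamma>)" by (rule wt_vanishing_weight[OF \<gamma>])
  have r: "0 < rho \<gamma>" by (rule rho_pos[OF \<gamma>])
  obtain M where M: "0 < M" "\<And>x. \<bar>eig \<gamma> x\<bar> \<le> M" using bounded_measurable_bound[OF eig_bounded_measurable[OF \<gamma>]] by blast
  obtain N where N: "N > 0" "\<And>y. N < \<bar>y\<bar> \<Longrightarrow> wt \<gamma> y < rho \<gamma> / (2 * M)"
    using vanishing_weight_tail[OF W, of "rho \<gamma> / (2 * M)"] r M by auto
  let ?I = "indicator {-N..N} :: real \<Rightarrow> real"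
  have I: "bounded_measurable ?I" by (intro bounded_measurable_indicator) auto
  have "eig \<gamma> x \<le> M * ?I x + 1/2" for x
  proof (cases "\<bar>x\<bar> \<le> N")
    case True
    then show ?thesis using M(2)[of x] by (simp add: indicator_def abs_le_iff)
  next
    case False
    have "\<bar>P (eig \<gamma>) x\<bar> \<le> M" by (intro P_abs_le_const eig_bounded_measurable \<gamma> M)
    then have "rho \<gamma> * eig \<gamma> x \<le> wt \<gamma> x * M"
      unfolding Q_eig[OF \<gamma>, symmetric] Q_def using wt_nonneg by (intro mult_left_mono) auto
    also have "\<dots> \<le> rho \<gamma> / (2 * M) * M" using N(2)[of x] False M by (intro mult_right_mono) auto
    also have "\<dots> = rho \<gamma> * (1/2)" using M by simp
    finally have "eig \<gamma> x \<le> 1/2" using r by (simp only: mult_le_cancel_left_pos)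
    then show ?thesis using M(1) by (auto simp: indicator_def)
  qed
  then have "dual \<gamma> (eig \<gamma>) \<le> dual \<gamma> (\<lambda>x. M * ?I x + (1/2) * 1)"
    by (intro dual_mono \<gamma> eig_bounded_measurable bounded_measurable_intros) auto
  also have "\<dots> = dual \<gamma> (\<lambda>x. M * ?I x) + dual \<gamma> (\<lambda>x. (1/2) * 1)"
    by (intro dual_add \<gamma> bounded_measurable_cmult I bounded_measurable_const)
  also have "\<dots> = M * dual \<gamma> ?I + (1/2) * 1"
    by (simp only: dual_cmult[OF \<gamma> I] dual_cmult[OF \<gamma> bounded_measurable_const] dual_one[OF \<gamma>])
  finally have "0 < M * dual \<gamma> ?I" using dual_eig[OF \<gamma>] by linarith
  then have dI: "0 < dual \<gamma> ?I" using M(1) by (simp only: zero_less_mult_iff) linarith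
  obtain s where s: "s > 0" "\<And>x y. \<bar>x\<bar> \<le> N \<Longrightarrow> \<bar>y\<bar> \<le> N \<Longrightarrow> s \<le> wt \<gamma> x * k x y"
    using kernel_lower_bound[OF wt_continuous[of UNIV \<gamma>] wt_pos, of N N] N(1) by auto
  have mass: "0 < mass N f"
  proof (rule ccontr)
    assume "\<not> 0 < mass N f"
    moreover have "0 \<le> mass N f" unfolding mass_def using f(2) by (intro integral_nonneg_AE AE_I2) auto
    ultimately have "(\<integral>y. indicator {-N..N} y * f y \<partial>lborel) = 0" by (simp add: mass_def)
    then have "AE y in lborel. indicator {-N..N} y * f y = 0"
      using f by (subst (asm) integral_nonneg_eq_0_iff_AE) (auto intro: mass_integrable)
    with f(3) have "AE y in lborel. y \<notin> {-N..N}" by eventually_elim auto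
    then have "emeasure lborel {-N..N} = 0" by (subst (asm) AE_iff_measurable[of "{-N..N}"]) auto
    then show False using N(1) by (simp add: emeasure_lborel_Icc_eq)
  qed
  have "(s * mass N f) * ?I x \<le> Q (wt \<gamma>) f x" for x
  proof (cases "\<bar>x\<bar> \<le> N")
    case True
    then show ?thesis using minorization[OF W f(1,2) s(2)[OF True]] by (simp add: indicator_def abs_le_iff)
  next
    case False
    have "0 \<le> Q (wt \<gamma>) f x" unfolding Q_def using wt_nonneg by (auto intro!: mult_nonneg_nonneg P_nonneg f)
    then show ?thesis using False by (auto simp: indicator_def abs_le_iff)
  qed
  then have "dual \<gamma> (\<lambda>x. (s * mass N f) * ?I x) \<le> dual \<gamma> (Q (wt \<gamma>) f)"
    by (intro dual_mono \<gamma> Q_bounded_measurable W f bounded_measurable_cmult I)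
  then have "s * mass N f * dual \<gamma> ?I \<le> rho \<gamma> * dual \<gamma> f"
    by (simp add: dual_cmult dual_Q \<gamma> I f)
  moreover have "0 < s * mass N f * dual \<gamma> ?I" using s mass dI by simp
  ultimately have "0 < rho \<gamma> * dual \<gamma> f" by linarith
  then show ?thesis using r by (simp only: zero_less_mult_iff) linarith
qed

end

section \<open>Dependence of the growth rate on the tilt\<close>

lemma mult_exp_uminus_le:
  fixes a x :: real
  assumes "0 < a"
  shows "x * exp (- (a * x)) \<le> 1 / a"
proof -
  have "a * x \<le> exp (a * x)" using exp_ge_add_one_self[of "a * x"] by linarith
  then have "a * x * exp (- (a * x)) \<le> exp (a * x) * exp (- (a * x))" by (intro mult_right_mono) auto
  also have "\<dots> = 1" by (simp flip: exp_add)
  finally show ?thesis using assms by (simp add: pos_le_divide_eq mult_ac)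
qed

lemma exp_uminus_lipschitz:
  fixes a s t x :: real
  assumes "0 < a" "a \<le> s" "a \<le> t" "0 \<le> x"
  shows "\<bar>exp (- s * x) - exp (- t * x)\<bar> \<le> \<bar>s - t\<bar> / a"
proof -
  have *: "exp (- s * x) - exp (- t * x) \<le> (t - s) / a" if "a \<le> s" "s \<le> t" for s t
  proof -
    have x: "x * exp (- (a * x)) \<le> 1 / a" by (rule mult_exp_uminus_le[OF assms(1)])
    have "exp (- s * x) - exp (- t * x) = exp (- s * x) * (1 - exp (- ((t - s) * x)))"
      by (simp add: algebra_simps flip: exp_add)
    also have "\<dots> \<le> exp (- (a * x)) * ((t - s) * x)"
    proof (rule mult_mono)
      show "exp (- s * x) \<le> exp (- (a * x))" using that assms(4) by (simp add: mult_right_mono)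
      show "1 - exp (- ((t - s) * x)) \<le> (t - s) * x"
        using exp_ge_add_one_self[of "- ((t - s) * x)"] by simp
      show "0 \<le> 1 - exp (- ((t - s) * x))" using that assms(4) by simp
    qed auto
    also have "\<dots> = (t - s) * (x * exp (- (a * x)))" by simp
    also have "\<dots> \<le> (t - s) * (1 / a)" using that x by (intro mult_left_mono) auto
    finally show ?thesis by simp
  qed
  show ?thesis
  proof (cases "s \<le> t")
    case True
    then have "exp (- t * x) \<le> exp (- s * x)" using assms by (simp add: mult_right_mono)
    then show ?thesis using *[OF assms(2) True] True by simp
  next
    case False
    then have "exp (- s * x) \<le> exp (- t * x)" using assms by (simp add: mult_right_mono)
    then show ?thesis using *[OF assms(3), of s] False by simp
  qed
qed

context tilted_markov_density
begin

lemma wt_lipschitz: "0 < a \<Longrightarrow> a \<le> \<gamma> \<Longrightarrow> a \<le> \<gamma>' \<Longrightarrow> \<bar>wt \<gamma> x - wt \<gamma>' x\<bar> \<le> \<bar>\<gamma> - \<gamma>'\<bar> / a"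
  unfolding wt_def by (intro exp_uminus_lipschitz \<xi>_nonneg)

lemma \<xi>_wt_le: "0 < \<gamma> \<Longrightarrow> \<xi> x * wt \<gamma> x \<le> 1 / \<gamma>"
  using mult_exp_uminus_le[of \<gamma> "\<xi> x"] by (simp add: wt_def)

text \<open>
  The bound \<open>1 / a\<close> for \<open>\<bar>wt \<gamma> x - wt \<gamma>' x\<bar> / \<bar>\<gamma> - \<gamma>'\<bar>\<close> does not depend on \<open>x\<close>, so the operators differ by
  at most \<open>\<bar>\<gamma> - \<gamma>'\<bar> / a\<close> in norm, and the errors of \<open>n\<close> steps add up.
\<close>

lemma laplace_lipschitz:
  assumes a: "0 < a" "a \<le> \<gamma>" "a \<le> \<gamma>'"
  shows "\<bar>laplace \<gamma> n x - laplace \<gamma>' n x\<bar> \<le> n * (\<bar>\<gamma> - \<gamma>'\<bar> / a)"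
proof (induction n arbitrary: x)
  case 0
  show ?case by (simp add: laplace_0)
next
  case (Suc n)
  have pos: "0 < \<gamma>" "0 < \<gamma>'" using a by auto
  note bm = laplace_bounded_measurable[OF pos(1), of n] laplace_bounded_measurable[OF pos(2), of n]
  have eq: "laplace \<gamma> (Suc n) x - laplace \<gamma>' (Suc n) x
      = (wt \<gamma> x - wt \<gamma>' x) * P (laplace \<gamma> n) x + wt \<gamma>' x * P (\<lambda>y. laplace \<gamma> n y - laplace \<gamma>' n y) x"
    by (simp add: laplace_Suc Q_def P_diff bm algebra_simps)
  have "\<bar>laplace \<gamma> (Suc n) x - laplace \<gamma>' (Suc n) x\<bar>
      \<le> \<bar>wt \<gamma> x - wt \<gamma>' x\<bar> * \<bar>P (laplace \<gamma> n) x\<bar> + \<bar>wt \<gamma>' x\<bar> * \<bar>P (\<lambda>y. laplace \<gamma> n y - laplace \<gamma>' n y) x\<bar>"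
    unfolding eq by (intro order_trans[OF abs_triangle_ineq]) (simp add: abs_mult)
  also have "\<dots> \<le> (\<bar>\<gamma> - \<gamma>'\<bar> / a) * 1 + 1 * (n * (\<bar>\<gamma> - \<gamma>'\<bar> / a))"
  proof (rule add_mono[OF mult_mono mult_mono])
    show "\<bar>wt \<gamma> x - wt \<gamma>' x\<bar> \<le> \<bar>\<gamma> - \<gamma>'\<bar> / a" by (rule wt_lipschitz[OF a])
    show "\<bar>P (laplace \<gamma> n) x\<bar> \<le> 1"
      using laplace_nonneg[OF pos(1)] laplace_le_one[OF pos(1)] by (intro P_abs_le_const bm) auto
    show "\<bar>wt \<gamma>' x\<bar> \<le> 1" using wt_le_one[of \<gamma>' x] wt_pos[of \<gamma>' x] pos by simp
    show "\<bar>P (\<lambda>y. laplace \<gamma> n y - laplace \<gamma>' n y) x\<bar> \<le> n * (\<bar>\<gamma> - \<gamma>'\<bar> / a)"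
      by (intro P_abs_le_const bounded_measurable_diff bm Suc)
  qed (use a in auto)
  finally show ?case by (simp add: algebra_simps add_divide_distrib)
qed

lemma interval_around:
  fixes \<gamma> :: real
  assumes "0 < \<gamma>"
  shows "\<forall>\<^sub>F g in at \<gamma>. g \<in> {\<gamma> / 2..2 * \<gamma>}"
proof -
  have "\<forall>\<^sub>F g in at \<gamma>. \<gamma> / 2 < g" "\<forall>\<^sub>F g in at \<gamma>. g < 2 * \<gamma>"
    using assms by (intro order_tendstoD[OF tendsto_ident_at]; simp)+
  then show ?thesis by eventually_elim auto
qed

lemma laplace_isCont:
  assumes "0 < \<gamma>"
  shows "isCont (\<lambda>\<gamma>. laplace \<gamma> n x) \<gamma>"
proof -
  have lim: "((\<lambda>g. n * (\<bar>g - \<gamma>\<bar> / (\<gamma> / 2))) \<longlongrightarrow> 0) (at \<gamma>)"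
    using assms by (auto intro!: tendsto_eq_intros)
  have "\<forall>\<^sub>F g in at \<gamma>. norm (laplace g n x - laplace \<gamma> n x) \<le> n * (\<bar>g - \<gamma>\<bar> / (\<gamma> / 2))"
    using interval_around[OF assms]
  proof eventually_elim
    case (elim g)
    then show ?case using laplace_lipschitz[of "\<gamma> / 2" g \<gamma> n x] assms by simp
  qed
  then have "((\<lambda>g. laplace g n x - laplace \<gamma> n x) \<longlongrightarrow> 0) (at \<gamma>)"
    by (rule Lim_null_comparison[OF _ lim])
  then show ?thesis by (simp add: isCont_def LIM_zero_iff)
qed

text \<open>
  The continuous quotients of consecutive Laplace transforms converge to \<open>rho\<close> locally uniformly.
\<close>

lemma rho_isCont:
  assumes "0 < \<gamma>"
  shows "isCont rho \<gamma>"
proof -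
  let ?I = "{\<gamma> / 2..2 * \<gamma>}"
  obtain M \<theta> c where M: "0 < M" and \<theta>: "0 < \<theta>" "\<theta> < 1" and c: "0 < c"
    and gap: "\<forall>g\<in>?I. spectral_gap (wt g) (rho g) (eig g) M \<theta> c"
    using spectral_gap_on_interval[of "\<gamma> / 2" "2 * \<gamma>"] assms by auto
  have pos: "0 < laplace g n 0" if "g \<in> ?I" for g n
  proof -
    have "0 < c * rho g ^ n" using spectral_gapD(1)[OF gap[rule_format, OF that]] c by simp
    also have "\<dots> \<le> laplace g n 0" unfolding laplace_def by (rule spectral_gapD(7)[OF gap[rule_format, OF that]])
    finally show ?thesis .
  qed
  have "uniform_limit ?I (\<lambda>n g. laplace g (Suc n) 0 / laplace g n 0) rho sequentially"
  proof (rule uniform_limitI)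
    fix e :: real assume "0 < e"
    have "(\<lambda>n. 4 * M / c * \<theta> ^ n) \<longlonglongrightarrow> 0"
      using tendsto_mult_left[OF LIMSEQ_power_zero[of \<theta>], of "4 * M / c"] \<theta> by simp
    from order_tendstoD(2)[OF this \<open>0 < e\<close>]
    show "\<forall>\<^sub>F n in sequentially. \<forall>g\<in>?I. dist (laplace g (Suc n) 0 / laplace g n 0) (rho g) < e"
    proof eventually_elim
      case (elim n)
      show ?case
      proof
        fix g assume "g \<in> ?I"
        from spectral_gap_ratio[OF gap[rule_format, OF this] M \<theta> c, of n] elim
        show "dist (laplace g (Suc n) 0 / laplace g n 0) (rho g) < e"
          unfolding dist_real_def laplace_def by linarith
      qed
    qed
  qed
  moreover have "\<forall>n. continuous_on ?I (\<lambda>g. laplace g (Suc n) 0 / laplace g n 0)"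
  proof (intro allI continuous_at_imp_continuous_on ballI isCont_divide laplace_isCont)
    show "0 < g" "0 < g" if "g \<in> ?I" for g using that assms by auto
    show "laplace g n 0 \<noteq> 0" if "g \<in> ?I" for g n using pos[OF that, of n] by simp
  qed
  ultimately have "continuous_on ?I rho"
    using uniform_limit_theorem[OF always_eventually] by fastforce
  then show ?thesis
    by (rule continuous_on_interior) (use assms in auto)
qed

lemma rho_continuous_on: "continuous_on {0<..} rho"
  by (intro continuous_at_imp_continuous_on ballI rho_isCont) auto

lemma eig_uniformly_continuous:
  assumes "0 < \<gamma>" "0 < e"
  shows "\<forall>\<^sub>F g in at \<gamma>. \<forall>x. \<bar>eig g x - eig \<gamma> x\<bar> < e"
proof -
  let ?I = "{\<gamma> / 2..2 * \<gamma>}"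
  obtain M \<theta> c where M: "0 < M" and \<theta>: "0 < \<theta>" "\<theta> < 1" and c: "0 < c"
    and gap: "\<forall>g\<in>?I. spectral_gap (wt g) (rho g) (eig g) M \<theta> c"
    using spectral_gap_on_interval[of "\<gamma> / 2" "2 * \<gamma>"] assms by auto
  have approx: "\<bar>laplace g n x / rho g ^ n - eig g x\<bar> \<le> M * \<theta> ^ n" if "g \<in> ?I" for g n x
  proof -
    note G = gap[rule_format, OF that]
    have r: "0 < rho g" using spectral_gapD(1)[OF G] c by simp
    have "\<bar>laplace g n x - rho g ^ n * eig g x * 1\<bar> \<le> M * (\<theta> * rho g) ^ n"
      unfolding laplace_def using spectral_gapD(8)[OF G, of n x] by simp
    from geometric_relative_error[OF _ r this] show ?thesis by simp
  qed
  have "(\<lambda>n. M * \<theta> ^ n) \<longlonglongrightarrow> 0"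
    using tendsto_mult_left[OF LIMSEQ_power_zero[of \<theta>], of M] \<theta> by simp
  from order_tendstoD(2)[OF this, of "e / 4"] assms(2) obtain n where n: "M * \<theta> ^ n < e / 4"
    unfolding eventually_sequentially by fastforce
  have "((\<lambda>g. n * (\<bar>g - \<gamma>\<bar> / (\<gamma> / 2)) / c ^ n + \<bar>1 / rho g ^ n - 1 / rho \<gamma> ^ n\<bar>) \<longlongrightarrow>
      n * (\<bar>\<gamma> - \<gamma>\<bar> / (\<gamma> / 2)) / c ^ n + \<bar>1 / rho \<gamma> ^ n - 1 / rho \<gamma> ^ n\<bar>) (at \<gamma>)"
    using rho_isCont[OF assms(1)] rho_pos[OF assms(1)] c assms(1)
    unfolding isCont_def by (intro tendsto_intros) simp_all
  then have "((\<lambda>g. n * (\<bar>g - \<gamma>\<bar> / (\<gamma> / 2)) / c ^ n + \<bar>1 / rho g ^ n - 1 / rho \<gamma> ^ n\<bar>) \<longlongrightarrow> 0) (at \<gamma>)"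
    by simp
  from order_tendstoD(2)[OF this, of "e / 4"] assms(2)
  have "\<forall>\<^sub>F g in at \<gamma>. n * (\<bar>g - \<gamma>\<bar> / (\<gamma> / 2)) / c ^ n + \<bar>1 / rho g ^ n - 1 / rho \<gamma> ^ n\<bar> < e / 4" by simp
  with interval_around[OF assms(1)] show ?thesis
  proof eventually_elim
    case (elim g)
    show ?case
    proof
      fix x
      have g: "\<gamma> / 2 \<le> g" "0 < g" using elim(1) assms(1) by auto
      have r: "0 < rho g" by (rule rho_pos[OF g(2)])
      have cr: "c ^ n \<le> rho g ^ n" using spectral_gapD(1)[OF gap[rule_format, OF elim(1)]] c by (intro power_mono) auto
      have eq: "laplace g n x / rho g ^ n - laplace \<gamma> n x / rho \<gamma> ^ n
        = (laplace g n x - laplace \<gamma> n x) / rho g ^ n + laplace \<gamma> n x * (1 / rho g ^ n - 1 / rho \<gamma> ^ n)"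
        by (simp add: diff_divide_distrib right_diff_distrib)
      have "\<bar>laplace g n x / rho g ^ n - laplace \<gamma> n x / rho \<gamma> ^ n\<bar>
          \<le> \<bar>laplace g n x - laplace \<gamma> n x\<bar> / rho g ^ n + \<bar>laplace \<gamma> n x\<bar> * \<bar>1 / rho g ^ n - 1 / rho \<gamma> ^ n\<bar>"
        unfolding eq using r by (intro order_trans[OF abs_triangle_ineq]) (simp add: abs_mult)
      also have "\<dots> \<le> n * (\<bar>g - \<gamma>\<bar> / (\<gamma> / 2)) / c ^ n + 1 * \<bar>1 / rho g ^ n - 1 / rho \<gamma> ^ n\<bar>"
      proof (rule add_mono[OF frac_le mult_right_mono])
        show "\<bar>laplace g n x - laplace \<gamma> n x\<bar> \<le> n * (\<bar>g - \<gamma>\<bar> / (\<gamma> / 2))" using g assms(1) by (intro laplace_lipschitz) auto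
        show "\<bar>laplace \<gamma> n x\<bar> \<le> 1" using laplace_nonneg[OF assms(1), of n x] laplace_le_one[OF assms(1), of n x] by simp
      qed (use c cr assms(1) in auto)
      also have "\<dots> < e / 4" using elim(2) by simp
      finally have mid: "\<bar>laplace g n x / rho g ^ n - laplace \<gamma> n x / rho \<gamma> ^ n\<bar> < e / 4" .
      have "\<gamma> \<in> ?I" using assms(1) by simp
      from approx[OF this, of n x] approx[OF elim(1), of n x] mid n
      show "\<bar>eig g x - eig \<gamma> x\<bar> < e" by linarith
    qed
  qed
qed

text \<open>
  The difference quotients converge to the derivative \<open>- \<xi> wt\<close> uniformly in \<open>x\<close>, although \<open>\<xi>\<close> is unbounded.
\<close>

lemma wt_difference_quotient:
  assumes a: "0 < a" "a \<le> \<gamma>" "a \<le> g" "g \<noteq> \<gamma>"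
  shows "\<bar>(wt g x - wt \<gamma> x) / (g - \<gamma>) + \<xi> x * wt \<gamma> x\<bar> \<le> 4 / a\<^sup>2 * \<bar>g - \<gamma>\<bar>"
proof -
  have D: "((\<lambda>g. wt g x) has_real_derivative - (\<xi> x * wt z x)) (at z)" for z
    unfolding wt_def by (auto intro!: derivative_eq_intros)
  have "\<exists>z. a \<le> z \<and> \<bar>z - \<gamma>\<bar> \<le> \<bar>g - \<gamma>\<bar> \<and> wt g x - wt \<gamma> x = (g - \<gamma>) * - (\<xi> x * wt z x)"
  proof (cases "g < \<gamma>")
    case True
    from MVT2[OF this D] obtain z where "g < z" "z < \<gamma>"
      "wt \<gamma> x - wt g x = (\<gamma> - g) * - (\<xi> x * wt z x)" by blast
    then show ?thesis using a by (intro exI[of _ z]) (auto simp: algebra_simps)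
  next
    case False
    then have "\<gamma> < g" using a by simp
    from MVT2[OF this D] obtain z where "\<gamma> < z" "z < g"
      "wt g x - wt \<gamma> x = (g - \<gamma>) * - (\<xi> x * wt z x)" by blast
    then show ?thesis using a by (intro exI[of _ z]) auto
  qed
  then obtain z where z: "a \<le> z" "\<bar>z - \<gamma>\<bar> \<le> \<bar>g - \<gamma>\<bar>" "wt g x - wt \<gamma> x = (g - \<gamma>) * - (\<xi> x * wt z x)" by blast
  \<comment> \<open>half of the decay absorbs \<open>\<xi>\<close>, the other half gives the Lipschitz bound\<close>
  have split: "wt b x = wt (a / 2) x * wt (b - a / 2) x" for b
    by (simp add: wt_def algebra_simps flip: exp_add)
  have "(wt g x - wt \<gamma> x) / (g - \<gamma>) + \<xi> x * wt \<gamma> x = \<xi> x * (wt \<gamma> x - wt z x)"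
    using z(3) a(4) by (simp add: right_diff_distrib)
  also have "\<dots> = (\<xi> x * wt (a / 2) x) * (wt (\<gamma> - a / 2) x - wt (z - a / 2) x)"
    by (subst split[of \<gamma>], subst split[of z]) (simp add: right_diff_distrib)
  finally have eq: "(wt g x - wt \<gamma> x) / (g - \<gamma>) + \<xi> x * wt \<gamma> x
      = (\<xi> x * wt (a / 2) x) * (wt (\<gamma> - a / 2) x - wt (z - a / 2) x)" .
  have "\<bar>(wt g x - wt \<gamma> x) / (g - \<gamma>) + \<xi> x * wt \<gamma> x\<bar> \<le> (1 / (a / 2)) * (\<bar>(\<gamma> - a / 2) - (z - a / 2)\<bar> / (a / 2))"
    unfolding eq abs_mult
  proof (rule mult_mono)
    show "\<bar>\<xi> x\<bar> * \<bar>wt (a / 2) x\<bar> \<le> 1 / (a / 2)"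
      using \<xi>_wt_le[of "a / 2" x] \<xi>_nonneg[of x] wt_nonneg[of "a / 2" x] a by simp
    show "\<bar>wt (\<gamma> - a / 2) x - wt (z - a / 2) x\<bar> \<le> \<bar>(\<gamma> - a / 2) - (z - a / 2)\<bar> / (a / 2)"
      using a z by (intro wt_lipschitz) auto
  qed (use a in auto)
  also have "\<dots> = 4 / a\<^sup>2 * \<bar>z - \<gamma>\<bar>" by (simp add: power2_eq_square abs_minus_commute)
  also have "\<dots> \<le> 4 / a\<^sup>2 * \<bar>g - \<gamma>\<bar>" using z by (intro mult_left_mono) auto
  finally show ?thesis .
qed

lemma \<xi>_eig_bounded_measurable:
  assumes "0 < \<gamma>"
  shows "bounded_measurable (\<lambda>x. \<xi> x * eig \<gamma> x)"
proof -
  obtain B where B: "0 < B" "\<And>x. \<bar>eig \<gamma> x\<bar> \<le> B" using bounded_measurable_bound[OF eig_bounded_measurable[OF assms]] by blast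
  show ?thesis
  proof (rule bounded_measurableI)
    show "(\<lambda>x. \<xi> x * eig \<gamma> x) \<in> borel_measurable borel"
      by (intro borel_measurable_times borel_measurable_continuous_onI[OF \<xi>_continuous]
          bounded_measurable_measurable eig_bounded_measurable assms)
    fix x
    have r: "0 < rho \<gamma>" by (rule rho_pos[OF assms])
    have "rho \<gamma> * (\<xi> x * eig \<gamma> x) = (\<xi> x * wt \<gamma> x) * P (eig \<gamma>) x"
      using Q_eig[OF assms, of x] by (simp add: Q_def mult.left_commute mult.assoc)
    also have "\<bar>\<dots>\<bar> \<le> (1 / \<gamma>) * B"
      unfolding abs_mult[of "\<xi> x * wt \<gamma> x"]
      using \<xi>_wt_le[OF assms, of x] \<xi>_nonneg[of x] wt_nonneg[of \<gamma> x] assms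
      by (intro mult_mono P_abs_le_const eig_bounded_measurable B) auto
    finally have "\<bar>rho \<gamma> * z\<bar> \<le> B / \<gamma>" if "z = \<xi> x * eig \<gamma> x" for z using that by simp
    then have "\<bar>z\<bar> * rho \<gamma> \<le> B / \<gamma>" if "z = \<xi> x * eig \<gamma> x" for z
      using that r unfolding abs_mult by (simp only: abs_of_pos mult.commute)
    then show "\<bar>\<xi> x * eig \<gamma> x\<bar> \<le> B / \<gamma> / rho \<gamma>"
      by (simp only: pos_le_divide_eq[OF r])
  qed
qed

text \<open>
  Apply \<open>L = dual \<gamma>\<close> to the eigenvalue equation at a second parameter \<open>g\<close>. Since \<open>L\<close> is a left
  eigenfunctional of the operator at \<open>\<gamma>\<close>, the difference quotient of \<open>rho\<close> is \<open>L (q g) / L (eig g)\<close> with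
  \<open>q g\<close> the difference quotient of the operators on \<open>eig g\<close>. The numerator converges because \<open>eig g\<close> and
  the quotients of the weights converge uniformly, and the denominator tends to \<open>L (eig \<gamma>) = 1\<close>.
\<close>

theorem rho_has_derivative:
  assumes \<gamma>: "0 < \<gamma>"
  shows "(rho has_real_derivative - (rho \<gamma> * dual \<gamma> (\<lambda>x. \<xi> x * eig \<gamma> x))) (at \<gamma>)"
proof -
  define L where "L = dual \<gamma>"
  define q where "q g x = (wt g x - wt \<gamma> x) / (g - \<gamma>) * P (eig g) x" for g x
  define q0 where "q0 x = - (rho \<gamma> * (\<xi> x * eig \<gamma> x))" for x
  have W: "vanishing_weight (wt \<gamma>)" by (rule wt_vanishing_weight[OF \<gamma>])
  note e_bm = eig_bounded_measurable[OF \<gamma>]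
  have q0_bm: "bounded_measurable q0"
    using bounded_measurable_cmult[OF \<xi>_eig_bounded_measurable[OF \<gamma>], of "- rho \<gamma>"] by (simp add: q0_def[abs_def])
  have q_eq: "q g = (\<lambda>x. (1 / (g - \<gamma>)) * (Q (wt g) (eig g) x - Q (wt \<gamma>) (eig g) x))" for g
    by (rule ext) (simp add: q_def Q_def left_diff_distrib)
  have q_bm: "bounded_measurable (q g)" if "0 < g" for g
    unfolding q_eq by (intro bounded_measurable_cmult bounded_measurable_diff Q_bounded_measurable
        wt_vanishing_weight eig_bounded_measurable that \<gamma>)
  have quotient: "(rho g - rho \<gamma>) / (g - \<gamma>) * L (eig g) = L (q g)" if "0 < g" "g \<noteq> \<gamma>" for g
  proof -
    have bm: "bounded_measurable (Q (wt g) (eig g))" "bounded_measurable (Q (wt \<gamma>) (eig g))"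
      by (intro Q_bounded_measurable wt_vanishing_weight eig_bounded_measurable that \<gamma>)+
    have "L (q g) = (1 / (g - \<gamma>)) * (L (Q (wt g) (eig g)) - L (Q (wt \<gamma>) (eig g)))"
      unfolding q_eq L_def dual_cmult[OF \<gamma> bounded_measurable_diff[OF bm]] dual_diff[OF \<gamma> bm] ..
    also have "L (Q (wt \<gamma>) (eig g)) = rho \<gamma> * L (eig g)"
      unfolding L_def by (intro dual_Q \<gamma> eig_bounded_measurable that)
    also have "Q (wt g) (eig g) = (\<lambda>x. rho g * eig g x)" using Q_eig[OF that(1)] by blast
    also have "L (\<lambda>x. rho g * eig g x) = rho g * L (eig g)"
      unfolding L_def by (intro dual_cmult \<gamma> eig_bounded_measurable that)
    finally show ?thesis unfolding left_diff_distrib[symmetric] by simp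
  qed
  obtain B where B: "0 < B" "\<And>x. \<bar>eig \<gamma> x\<bar> \<le> B" using bounded_measurable_bound[OF e_bm] by blast
  have L_eig: "((\<lambda>g. L (eig g)) \<longlongrightarrow> 1) (at \<gamma>)"
  proof (rule tendstoI)
    fix e :: real assume "0 < e"
    then have "0 < e / 2" by simp
    have "\<forall>\<^sub>F g in at \<gamma>. 0 < g" using interval_around[OF \<gamma>] \<gamma> by (auto elim!: eventually_mono)
    with eig_uniformly_continuous[OF \<gamma> \<open>0 < e / 2\<close>]
    show "\<forall>\<^sub>F g in at \<gamma>. dist (L (eig g)) 1 < e"
    proof eventually_elim
      case (elim g)
      have "L (eig g) - 1 = L (\<lambda>x. eig g x - eig \<gamma> x)"
        unfolding L_def by (simp add: dual_diff dual_eig \<gamma> e_bm eig_bounded_measurable elim)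
      moreover have "\<bar>L (\<lambda>x. eig g x - eig \<gamma> x)\<bar> \<le> e / 2"
        unfolding L_def using elim
        by (intro dual_abs_le \<gamma> bounded_measurable_diff e_bm eig_bounded_measurable) (auto intro: less_imp_le)
      ultimately show ?case using \<open>0 < e\<close> by (simp add: dist_real_def)
    qed
  qed
  have L_q: "((\<lambda>g. L (q g)) \<longlongrightarrow> L q0) (at \<gamma>)"
  proof (rule tendstoI)
    fix e :: real assume e: "0 < e"
    \<comment> \<open>tolerance for \<open>eig g\<close>; it gets multiplied by \<open>\<xi> wt \<le> 1 / \<gamma>\<close>\<close>
    define d where "d = min 1 (e * \<gamma> / 4)"
    have d: "0 < d" "d \<le> 1" "d \<le> e * \<gamma> / 4" using e \<gamma> by (auto simp: d_def)
    have d3: "(1 / \<gamma>) * d \<le> e / 4" using d(3) \<gamma> by (simp add: pos_divide_le_eq)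
    have "((\<lambda>g. 4 / (\<gamma> / 2)\<^sup>2 * \<bar>g - \<gamma>\<bar> * (B + 1)) \<longlongrightarrow> 4 / (\<gamma> / 2)\<^sup>2 * \<bar>\<gamma> - \<gamma>\<bar> * (B + 1)) (at \<gamma>)"
      by (intro tendsto_intros)
    then have "((\<lambda>g. 4 / (\<gamma> / 2)\<^sup>2 * \<bar>g - \<gamma>\<bar> * (B + 1)) \<longlongrightarrow> 0) (at \<gamma>)" by simp
    from order_tendstoD(2)[OF this, of "e / 4"] e
    have "\<forall>\<^sub>F g in at \<gamma>. 4 / (\<gamma> / 2)\<^sup>2 * \<bar>g - \<gamma>\<bar> * (B + 1) < e / 4" by simp
    moreover have "\<forall>\<^sub>F g in at \<gamma>. g \<noteq> \<gamma>" by (simp add: eventually_at_filter)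
    ultimately show "\<forall>\<^sub>F g in at \<gamma>. dist (L (q g)) (L q0) < e"
      using eig_uniformly_continuous[OF \<gamma> d(1)] interval_around[OF \<gamma>]
    proof eventually_elim
      case (elim g)
      have g: "0 < g" "\<gamma> / 2 \<le> g" using elim(4) \<gamma> by auto
      have "\<bar>q g x - q0 x\<bar> \<le> e / 2" for x
      proof -
        have alg: "d * p - - (a * (w * p')) = (d + a * w) * p - a * w * (p - p')" for d p p' a w :: real
          by (simp add: algebra_simps)
        have "q0 x = - (\<xi> x * (wt \<gamma> x * P (eig \<gamma>) x))"
          using Q_eig[OF \<gamma>, of x] by (simp only: q0_def Q_def mult.left_commute)
        moreover have "P (\<lambda>y. eig g y - eig \<gamma> y) x = P (eig g) x - P (eig \<gamma>) x"
          by (intro P_diff eig_bounded_measurable g \<gamma>)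
        ultimately have eq: "q g x - q0 x = ((wt g x - wt \<gamma> x) / (g - \<gamma>) + \<xi> x * wt \<gamma> x) * P (eig g) x
            - (\<xi> x * wt \<gamma> x) * P (\<lambda>y. eig g y - eig \<gamma> y) x"
          unfolding q_def by (simp only: alg)
        have "\<bar>q g x - q0 x\<bar> \<le> \<bar>(wt g x - wt \<gamma> x) / (g - \<gamma>) + \<xi> x * wt \<gamma> x\<bar> * \<bar>P (eig g) x\<bar>
            + \<bar>\<xi> x * wt \<gamma> x\<bar> * \<bar>P (\<lambda>y. eig g y - eig \<gamma> y) x\<bar>"
          unfolding eq abs_mult[symmetric] by (rule abs_triangle_ineq4)
        also have "\<dots> \<le> (4 / (\<gamma> / 2)\<^sup>2 * \<bar>g - \<gamma>\<bar>) * (B + 1) + (1 / \<gamma>) * d"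
        proof (rule add_mono[OF mult_mono mult_mono])
          show "\<bar>(wt g x - wt \<gamma> x) / (g - \<gamma>) + \<xi> x * wt \<gamma> x\<bar> \<le> 4 / (\<gamma> / 2)\<^sup>2 * \<bar>g - \<gamma>\<bar>"
            using g \<gamma> elim(2) by (intro wt_difference_quotient) auto
          show "\<bar>P (eig g) x\<bar> \<le> B + 1"
          proof (intro P_abs_le_const eig_bounded_measurable g)
            fix y show "\<bar>eig g y\<bar> \<le> B + 1" using B(2)[of y] elim(3)[rule_format, of y] d(2) by linarith
          qed
          show "\<bar>\<xi> x * wt \<gamma> x\<bar> \<le> 1 / \<gamma>"
            using \<xi>_wt_le[OF \<gamma>, of x] \<xi>_nonneg[of x] wt_nonneg[of \<gamma> x] by simp
          show "\<bar>P (\<lambda>y. eig g y - eig \<gamma> y) x\<bar> \<le> d"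
            using elim(3) by (intro P_abs_le_const bounded_measurable_diff eig_bounded_measurable g \<gamma>) (auto intro: less_imp_le)
        qed (use \<gamma> B in auto)
        also have "\<dots> \<le> e / 4 + e / 4" using elim(1) d3 by (intro add_mono) simp_all
        finally show ?thesis by simp
      qed
      then have "\<bar>L (\<lambda>x. q g x - q0 x)\<bar> \<le> e / 2"
        unfolding L_def by (intro dual_abs_le \<gamma> bounded_measurable_diff q_bm q0_bm g)
      moreover have "L (\<lambda>x. q g x - q0 x) = L (q g) - L q0"
        unfolding L_def by (intro dual_diff \<gamma> q_bm q0_bm g)
      ultimately show ?case using e by (simp add: dist_real_def)
    qed
  qed
  have lim: "((\<lambda>g. L (q g) / L (eig g)) \<longlongrightarrow> L q0 / 1) (at \<gamma>)"
    by (intro tendsto_divide L_q L_eig) auto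
  have "\<forall>\<^sub>F g in at \<gamma>. L (eig g) \<noteq> 0"
    using tendsto_imp_eventually_ne[OF L_eig, of 0] by simp
  moreover have "\<forall>\<^sub>F g in at \<gamma>. g \<noteq> \<gamma>" by (simp add: eventually_at_filter)
  ultimately have "\<forall>\<^sub>F g in at \<gamma>. L (q g) / L (eig g) = (rho g - rho \<gamma>) / (g - \<gamma>)"
    using interval_around[OF \<gamma>]
  proof eventually_elim
    case (elim g)
    have "0 < g" using elim(3) \<gamma> by auto
    from quotient[OF this elim(2)] elim(1) show ?case by (metis nonzero_mult_div_cancel_right)
  qed
  from Lim_transform_eventually[OF lim this]
  have "((\<lambda>g. (rho g - rho \<gamma>) / (g - \<gamma>)) \<longlongrightarrow> L q0) (at \<gamma>)" by simp
  moreover have "L q0 = - (rho \<gamma> * dual \<gamma> (\<lambda>x. \<xi> x * eig \<gamma> x))"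
    using dual_cmult[OF \<gamma> \<xi>_eig_bounded_measurable[OF \<gamma>], of "- rho \<gamma>"] by (simp add: L_def q0_def[abs_def])
  ultimately show ?thesis by (simp add: has_field_derivative_iff)
qed

lemma rho_derivative_neg:
  assumes \<gamma>: "0 < \<gamma>"
  shows "- (rho \<gamma> * dual \<gamma> (\<lambda>x. \<xi> x * eig \<gamma> x)) < 0"
proof -
  have "0 < dual \<gamma> (\<lambda>x. \<xi> x * eig \<gamma> x)"
    using \<xi>_pos_AE eig_pos[OF \<gamma>] \<xi>_nonneg
    by (intro dual_pos \<gamma> \<xi>_eig_bounded_measurable) (auto simp: less_imp_le elim!: eventually_mono)
  then show ?thesis using rho_pos[OF \<gamma>] by simp
qed

lemma rho_strict_antimono:
  assumes "0 < \<gamma>" "\<gamma> < \<gamma>'"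
  shows "rho \<gamma>' < rho \<gamma>"
proof (rule DERIV_neg_imp_decreasing[OF assms(2)])
  fix z assume "\<gamma> \<le> z" "z \<le> \<gamma>'"
  with assms have "0 < z" by simp
  then show "\<exists>y. (rho has_real_derivative y) (at z) \<and> y < 0"
    using rho_has_derivative rho_derivative_neg by blast
qed

text \<open>
  If \<open>\<bar>x\<bar>\<close> is large, the first factor is at most \<open>exp (- \<gamma>)\<close>. Otherwise the chain either jumps to a point
  with \<open>\<xi> \<ge> 1\<close>, or it stays in a compact set, on which \<open>wt \<gamma>\<close> has small integral because \<open>\<xi> > 0\<close> almost
  everywhere. One step is not enough, as \<open>\<xi>\<close> may have zeros.
\<close>

lemma two_step_weight_vanishes:
  assumes "0 < e"
  shows "\<exists>g>0. \<forall>\<gamma>\<ge>g. \<forall>x. Q (wt \<gamma>) (wt \<gamma>) x \<le> e"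
proof -
  have "\<forall>\<^sub>F x in at_infinity. 1 \<le> \<xi> x" using \<xi>_coercive by (simp add: filterlim_at_top)
  then obtain b0 where b0: "\<And>x. b0 \<le> \<bar>x\<bar> \<Longrightarrow> 1 \<le> \<xi> x" by (auto simp: eventually_at_infinity)
  define b where "b = \<bar>b0\<bar>"
  have off: "wt \<gamma> x \<le> exp (- \<gamma>)" if "b < \<bar>x\<bar>" "0 \<le> \<gamma>" for \<gamma> x
    using b0[of x] that mult_left_mono[of 1 "\<xi> x" \<gamma>] by (simp add: wt_def b_def)
  obtain K where K: "K > 0" "\<And>x y. \<bar>x\<bar> \<le> b \<Longrightarrow> \<bar>y\<bar> \<le> b \<Longrightarrow> k x y \<le> K" using kernel_upper_bound by blast
  have wt_bm: "bounded_measurable (wt \<gamma>)" if "0 \<le> \<gamma>" for \<gamma>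
    using wt_le_one[OF that] wt_nonneg
    by (intro bounded_measurableI[of _ 1] borel_measurable_continuous_onI wt_continuous) auto
  have "(\<lambda>n. mass b (wt (real n))) \<longlonglongrightarrow> (\<integral>y. 0 \<partial>(lborel :: real measure))"
    unfolding mass_def
  proof (rule integral_dominated_convergence[where w = "indicator {-b..b}"])
    show "integrable lborel (indicator {-b..b} :: real \<Rightarrow> real)"
      by (intro integrable_real_indicator) (auto simp: emeasure_lborel_Icc_eq)
    show "AE y in lborel. (\<lambda>n. indicator {-b..b} y * wt (real n) y) \<longlonglongrightarrow> 0"
      using \<xi>_pos_AE
    proof eventually_elim
      case (elim y)
      have "wt (real n) y = exp (- \<xi> y) ^ n" for n by (simp add: wt_def flip: exp_of_nat_mult)
      moreover have "(\<lambda>n. exp (- \<xi> y) ^ n) \<longlonglongrightarrow> 0" using elim by (intro LIMSEQ_power_zero) simp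
      ultimately have "(\<lambda>n. wt (real n) y) \<longlonglongrightarrow> 0" by simp
      from tendsto_mult_left[OF this, of "indicator {-b..b} y"] show ?case by simp
    qed
    show "AE y in lborel. norm (indicator {-b..b} y * wt (real n) y) \<le> indicator {-b..b} y" for n
      using wt_le_one[of "real n"] wt_nonneg by (intro AE_I2) (auto simp: indicator_def)
  qed (auto intro!: borel_measurable_times bounded_measurable_measurable[OF wt_bm])
  then have mass_lim: "(\<lambda>n. mass b (wt (real n))) \<longlonglongrightarrow> 0" by simp
  have exp_lim: "(\<lambda>n. exp (- real n)) \<longlonglongrightarrow> 0"
    by (rule filterlim_compose[OF exp_at_bot]) (simp add: filterlim_uminus_at_bot filterlim_real_sequentially)
  have "(\<lambda>n. K * mass b (wt (real n)) + exp (- real n)) \<longlonglongrightarrow> K * 0 + 0"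
    by (intro tendsto_intros mass_lim exp_lim)
  then have "\<forall>\<^sub>F n in sequentially. K * mass b (wt (real n)) + exp (- real n) < e"
    using assms by (intro order_tendstoD(2)) auto
  then obtain m where m: "\<And>n. m \<le> n \<Longrightarrow> K * mass b (wt (real n)) + exp (- real n) < e"
    unfolding eventually_sequentially by blast
  define n where "n = Suc m"
  have n: "K * mass b (wt (real n)) + exp (- real n) < e" using m[of n] by (simp add: n_def)
  have mass0: "0 \<le> mass b (wt g)" for g
    unfolding mass_def using wt_nonneg by (intro integral_nonneg_AE AE_I2) auto
  have "Q (wt \<gamma>) (wt \<gamma>) x \<le> e" if \<gamma>: "real n \<le> \<gamma>" for \<gamma> x
  proof -
    have \<gamma>0: "0 \<le> \<gamma>" using that by simp
    have P01: "0 \<le> P (wt \<gamma>) x" "P (wt \<gamma>) x \<le> 1"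
      using P_nonneg[OF wt_bm[OF \<gamma>0] wt_nonneg, of x] P_abs_le_const[OF wt_bm[OF \<gamma>0], of 1 x] wt_nonneg wt_le_one[OF \<gamma>0]
      by (auto simp: abs_of_nonneg)
    have exp_le: "exp (- \<gamma>) \<le> exp (- real n)" using \<gamma> by simp
    have "Q (wt \<gamma>) (wt \<gamma>) x \<le> K * mass b (wt (real n)) + exp (- real n)"
    proof (cases "\<bar>x\<bar> \<le> b")
      case True
      have "Q (wt \<gamma>) (wt \<gamma>) x \<le> 1 * P (wt \<gamma>) x"
        unfolding Q_def using P01 wt_le_one[OF \<gamma>0] by (intro mult_right_mono) auto
      also have "\<dots> \<le> K * mass b (wt \<gamma>) + exp (- \<gamma>)"
        using P_upper[OF wt_bm[OF \<gamma>0] wt_nonneg, of b x K "exp (- \<gamma>)"] K True off[OF _ \<gamma>0] by simp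
      also have "\<dots> \<le> K * mass b (wt (real n)) + exp (- real n)"
        using K \<gamma> exp_le by (intro add_mono mult_left_mono mass_mono wt_bm wt_antimono) auto
      finally show ?thesis .
    next
      case False
      then have "Q (wt \<gamma>) (wt \<gamma>) x \<le> exp (- \<gamma>) * 1"
        unfolding Q_def using P01 off[OF _ \<gamma>0] by (intro mult_mono) auto
      also have "\<dots> \<le> K * mass b (wt (real n)) + exp (- real n)"
        using mult_nonneg_nonneg[OF less_imp_le[OF K(1)] mass0[of "real n"]] exp_le by linarith
      finally show ?thesis .
    qed
    with n show ?thesis by simp
  qed
  then show ?thesis by (intro exI[of _ "real n"]) (auto simp: n_def)
qed

text \<open>
  Evaluate \<open>rho\<^sup>2 eig = Q\<^sup>2 eig\<close> at a point where \<open>eig\<close> exceeds half of its supremum.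
\<close>

lemma rho_tendsto_zero: "(rho \<longlongrightarrow> 0) at_top"
proof (rule tendstoI)
  fix e :: real assume e: "0 < e"
  obtain g where g: "g > 0" "\<And>\<gamma> x. g \<le> \<gamma> \<Longrightarrow> Q (wt \<gamma>) (wt \<gamma>) x \<le> e\<^sup>2 / 4"
    using two_step_weight_vanishes[of "e\<^sup>2 / 4"] e by auto
  have "rho \<gamma> < e" if "g \<le> \<gamma>" for \<gamma>
  proof -
    have \<gamma>: "0 < \<gamma>" using g(1) that by simp
    have W: "vanishing_weight (wt \<gamma>)" by (rule wt_vanishing_weight[OF \<gamma>])
    define S where "S = Sup (range (eig \<gamma>))"
    obtain B where B: "\<And>x. \<bar>eig \<gamma> x\<bar> \<le> B" using bounded_measurable_bound[OF eig_bounded_measurable[OF \<gamma>]] by blast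
    have bdd: "bdd_above (range (eig \<gamma>))"
    proof (rule bdd_aboveI2)
      show "eig \<gamma> x \<le> B" for x using B[of x] by simp
    qed
    have S: "eig \<gamma> x \<le> S" for x unfolding S_def by (rule cSup_upper[OF _ bdd]) auto
    have S0: "0 < S" using eig_pos[OF \<gamma>, of 0] S[of 0] by simp
    obtain x where x: "S / 2 < eig \<gamma> x"
      using less_cSup_iff[OF _ bdd, of "S / 2"] S0 by (auto simp flip: S_def)
    have abs: "\<bar>eig \<gamma> y\<bar> \<le> S" for y using S[of y] eig_pos[OF \<gamma>, of y] by simp
    have "rho \<gamma> ^ 2 * eig \<gamma> x = (Q (wt \<gamma>) ^^ 2) (eig \<gamma>) x"
      using Q_pow_eigen[of "wt \<gamma>" "eig \<gamma>" "rho \<gamma>" 2, OF Q_eig[OF \<gamma>]] by simp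
    also have "\<dots> \<le> S * (Q (wt \<gamma>) ^^ 2) (\<lambda>_. 1) x"
      using Q_pow_bound[OF W eig_bounded_measurable[OF \<gamma>] abs, of 2 x] by simp
    also have "(Q (wt \<gamma>) ^^ 2) (\<lambda>_. 1) x = Q (wt \<gamma>) (wt \<gamma>) x"
    proof -
      have "Q (wt \<gamma>) (\<lambda>_. 1) = wt \<gamma>" by (rule ext) (simp add: Q_const)
      then show ?thesis by (simp add: numeral_2_eq_2)
    qed
    also have "S * \<dots> \<le> S * (e\<^sup>2 / 4)" using S0 g(2)[OF that] by (intro mult_left_mono) auto
    also have "\<dots> < e\<^sup>2 * (S / 2)" using S0 e by simp
    also have "\<dots> \<le> e\<^sup>2 * eig \<gamma> x" using x by (intro mult_left_mono) auto
    finally have "rho \<gamma> ^ 2 < e ^ 2" using eig_pos[OF \<gamma>, of x] by simp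
    then show ?thesis using e by (simp add: power_less_imp_less_base)
  qed
  moreover have "0 < rho \<gamma>" if "g \<le> \<gamma>" for \<gamma> using g(1) that by (intro rho_pos) simp
  ultimately show "\<forall>\<^sub>F \<gamma> in at_top. dist (rho \<gamma>) 0 < e"
    unfolding eventually_at_top_linorder by (intro exI[of _ g]) (simp add: abs_of_pos)
qed

text \<open>
  An interval that the chain keeps with probability at least \<open>l\<close> forces \<open>rho \<gamma> \<ge> l exp (- \<gamma> C)\<close>, where \<open>C\<close>
  is a bound for \<open>\<xi>\<close> on the interval; \<open>\<gamma>\<close> is taken such that the right-hand side is \<open>l'\<close>.
\<close>

lemma rho_near_zero:
  assumes b: "0 \<le> b" and stay: "\<And>x. \<bar>x\<bar> \<le> b \<Longrightarrow> l \<le> P (indicator {-b..b}) x" and l: "0 < l'" "l' < l"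
  shows "\<exists>\<gamma>>0. l' \<le> rho \<gamma>"
proof -
  have "compact (\<xi> ` {-b..b})" by (intro compact_continuous_image continuous_on_subset[OF \<xi>_continuous]) auto
  then obtain C where C: "C > 0" "\<And>x. x \<in> {-b..b} \<Longrightarrow> \<bar>\<xi> x\<bar> \<le> C"
    by (auto simp: bounded_pos dest!: compact_imp_bounded)
  define \<gamma> where "\<gamma> = ln (l / l') / C"
  have \<gamma>: "0 < \<gamma>" using l C by (simp add: \<gamma>_def)
  have I: "bounded_measurable (indicator {-b..b} :: real \<Rightarrow> real)" by (intro bounded_measurable_indicator) auto
  have "l' \<le> rho \<gamma>"
  proof (rule eigenvalue_lower_bound[OF wt_vanishing_weight[OF \<gamma>] rho_pos[OF \<gamma>] eig_bounded_measurable[OF \<gamma>]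
        eig_pos[OF \<gamma>] Q_eig[OF \<gamma>] b])
    fix x assume x: "\<bar>x\<bar> \<le> b"
    have "l' / l = exp (- (\<gamma> * C))" using l C by (simp add: \<gamma>_def exp_minus)
    also have "\<dots> \<le> wt \<gamma> x" using C(2)[of x] x \<gamma> by (simp add: wt_def abs_le_iff)
    finally have "(l' / l) * l \<le> wt \<gamma> x * P (indicator {-b..b}) x"
      using stay[OF x] l wt_nonneg by (intro mult_mono) auto
    then show "l' \<le> Q (wt \<gamma>) (indicator {-b..b}) x" using l by (simp add: Q_def)
  qed
  with \<gamma> show ?thesis by blast
qed

end

section \<open>Laplace transforms of the additive functional\<close>

text \<open>
  Constant factors disappear under the \<open>n\<close>-th root.
\<close>

lemma root_tendsto_growth_rate:
  fixes L :: "nat \<Rightarrow> real"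
  assumes \<rho>: "0 < \<rho>" and A: "0 < A" and lim: "(\<lambda>n. L n / \<rho> ^ n) \<longlonglongrightarrow> A"
  shows "(\<lambda>n. root n (L n)) \<longlonglongrightarrow> \<rho>"
proof -
  have lo: "\<forall>\<^sub>F n in sequentially. A / 2 < L n / \<rho> ^ n" and hi: "\<forall>\<^sub>F n in sequentially. L n / \<rho> ^ n < 2 * A"
    using A by (intro order_tendstoD[OF lim]; simp)+
  have "(\<lambda>n. root n (L n / \<rho> ^ n)) \<longlonglongrightarrow> 1"
  proof (rule tendsto_sandwich)
    show "\<forall>\<^sub>F n in sequentially. root n (A / 2) \<le> root n (L n / \<rho> ^ n)"
      using lo eventually_gt_at_top[of 0] by eventually_elim (auto intro: real_root_le_mono)
    show "\<forall>\<^sub>F n in sequentially. root n (L n / \<rho> ^ n) \<le> root n (2 * A)"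
      using hi eventually_gt_at_top[of 0] by eventually_elim (auto intro: real_root_le_mono)
    show "(\<lambda>n. root n (A / 2)) \<longlonglongrightarrow> 1" "(\<lambda>n. root n (2 * A)) \<longlonglongrightarrow> 1"
      using A by (auto intro: LIMSEQ_root_const)
  qed
  from tendsto_mult_left[OF this, of \<rho>] have "(\<lambda>n. \<rho> * root n (L n / \<rho> ^ n)) \<longlonglongrightarrow> \<rho>" by simp
  moreover have "\<forall>\<^sub>F n in sequentially. \<rho> * root n (L n / \<rho> ^ n) = root n (L n)"
    using eventually_gt_at_top[of 0]
  proof eventually_elim
    case (elim n)
    have "root n (\<rho> ^ n * (L n / \<rho> ^ n)) = \<rho> * root n (L n / \<rho> ^ n)"
      using elim \<rho> by (simp only: real_root_mult) (simp add: real_root_power_cancel)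
    then show ?case using \<rho> by simp
  qed
  ultimately show ?thesis by (rule Lim_transform_eventually)
qed

lemma bounded_measurable_integrable:
  assumes "prob_space \<mu>" "sets \<mu> = sets borel" "bounded_measurable f"
  shows "integrable \<mu> f"
proof -
  interpret prob_space \<mu> by (rule assms)
  obtain B where B: "\<And>x. \<bar>f x\<bar> \<le> B" using bounded_measurable_bound[OF assms(3)] by blast
  have "f \<in> borel_measurable \<mu>"
    using bounded_measurable_measurable[OF assms(3)] assms(2) by (simp cong: measurable_cong_sets)
  then show ?thesis using B by (intro integrable_const_bound[of _ B]) auto
qed

lemma prob_integral_abs_le:
  assumes "prob_space \<mu>" "sets \<mu> = sets borel" "bounded_measurable f" "\<And>x. \<bar>f x\<bar> \<le> B"
  shows "\<bar>\<integral>x. f x \<partial>\<mu>\<bar> \<le> B"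
proof -
  interpret prob_space \<mu> by (rule assms)
  have int: "integrable \<mu> f" by (rule bounded_measurable_integrable[OF assms(1-3)])
  have "\<bar>\<integral>x. f x \<partial>\<mu>\<bar> \<le> (\<integral>x. \<bar>f x\<bar> \<partial>\<mu>)" by (rule integral_abs_bound)
  also have "\<dots> \<le> (\<integral>x. B \<partial>\<mu>)" using int assms(4) by (intro integral_mono) auto
  also have "\<dots> = B" by (simp add: prob_space)
  finally show ?thesis .
qed

context tilted_markov_density
begin

context
  fixes \<mu> :: "real measure" and law :: "(nat \<Rightarrow> real) measure"
  assumes \<mu>: "prob_space \<mu>" "sets \<mu> = sets borel"
    and law: "\<And>n \<gamma>. 0 < \<gamma> \<Longrightarrow> L_Y law \<xi> n \<gamma> = (\<integral>x. laplace \<gamma> (Suc n) x \<partial>\<mu>)"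
begin

definition amplitude :: "real \<Rightarrow> real" where
  "amplitude \<gamma> = rho \<gamma> * (\<integral>x. eig \<gamma> x \<partial>\<mu>)"

lemma amplitude_pos: "0 < \<gamma> \<Longrightarrow> 0 < amplitude \<gamma>"
proof -
  assume \<gamma>: "0 < \<gamma>"
  interpret prob_space \<mu> by (rule \<mu>)
  have "0 < (\<integral>x. eig \<gamma> x \<partial>\<mu>)"
    using eig_pos[OF \<gamma>] by (intro expectation_greater bounded_measurable_integrable \<mu> eig_bounded_measurable \<gamma>) auto
  then show ?thesis using rho_pos[OF \<gamma>] by (simp add: amplitude_def)
qed

lemma amplitude_isCont:
  assumes \<gamma>: "0 < \<gamma>"
  shows "isCont amplitude \<gamma>"
proof -
  have "((\<lambda>g. \<integral>x. eig g x \<partial>\<mu>) \<longlongrightarrow> (\<integral>x. eig \<gamma> x \<partial>\<mu>)) (at \<gamma>)"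
  proof (rule tendstoI)
    fix e :: real assume e: "0 < e"
    then have "0 < e / 2" by simp
    from eig_uniformly_continuous[OF \<gamma> this] interval_around[OF \<gamma>]
    show "\<forall>\<^sub>F g in at \<gamma>. dist (\<integral>x. eig g x \<partial>\<mu>) (\<integral>x. eig \<gamma> x \<partial>\<mu>) < e"
    proof eventually_elim
      case (elim g)
      have g: "0 < g" using elim(2) \<gamma> by auto
      have "(\<integral>x. eig g x \<partial>\<mu>) - (\<integral>x. eig \<gamma> x \<partial>\<mu>) = (\<integral>x. eig g x - eig \<gamma> x \<partial>\<mu>)"
        by (intro Bochner_Integration.integral_diff[symmetric] bounded_measurable_integrable \<mu> eig_bounded_measurable \<gamma> g)
      moreover have "\<bar>\<integral>x. eig g x - eig \<gamma> x \<partial>\<mu>\<bar> \<le> e / 2"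
        using elim(1) by (intro prob_integral_abs_le \<mu> bounded_measurable_diff eig_bounded_measurable \<gamma> g) (auto intro: less_imp_le)
      ultimately show ?case using e by (simp add: dist_real_def)
    qed
  qed
  then show ?thesis
    unfolding amplitude_def[abs_def] using rho_isCont[OF \<gamma>] by (intro isCont_mult) (auto simp: isCont_def)
qed

text \<open>
  The expansion of the powers of the operator is uniform in the starting point, so it can be integrated
  against any initial distribution. The index is shifted by one because \<open>S\<^sub>n\<close> has \<open>n + 1\<close> summands; this
  is why \<open>amplitude\<close> contains a factor \<open>rho\<close>.
\<close>

theorem laplace_transform_expansion:
  assumes a: "0 < a"
  shows "\<exists>M \<theta>. 0 < M \<and> 0 < \<theta> \<and> \<theta> < 1 \<and>
    (\<forall>\<gamma>\<in>{a..b}. \<forall>n. \<bar>L_Y law \<xi> n \<gamma> - amplitude \<gamma> * rho \<gamma> ^ n\<bar> \<le> M * (rho \<gamma> * \<theta>) ^ n)"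
proof -
  obtain M \<theta> c where M: "0 < M" and \<theta>: "0 < \<theta>" "\<theta> < 1" and "0 < c"
    and gap: "\<forall>\<gamma>\<in>{a..b}. spectral_gap (wt \<gamma>) (rho \<gamma>) (eig \<gamma>) M \<theta> c"
    using spectral_gap_on_interval[OF a, of b] by blast
  have "\<bar>L_Y law \<xi> n \<gamma> - amplitude \<gamma> * rho \<gamma> ^ n\<bar> \<le> (2 * M) * (rho \<gamma> * \<theta>) ^ n" if ab: "\<gamma> \<in> {a..b}" for \<gamma> n
  proof -
    note g = spectral_gapD[OF gap[rule_format, OF ab]]
    have \<gamma>: "0 < \<gamma>" using ab a by auto
    have r: "0 < rho \<gamma>" by (rule rho_pos[OF \<gamma>])
    note bm = laplace_bounded_measurable[OF \<gamma>, of "Suc n"] bounded_measurable_cmult[OF eig_bounded_measurable[OF \<gamma>], of "rho \<gamma> ^ Suc n"]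
    have "L_Y law \<xi> n \<gamma> - amplitude \<gamma> * rho \<gamma> ^ n = (\<integral>x. laplace \<gamma> (Suc n) x \<partial>\<mu>) - (\<integral>x. rho \<gamma> ^ Suc n * eig \<gamma> x \<partial>\<mu>)"
      unfolding law[OF \<gamma>] amplitude_def by simp
    also have "\<dots> = (\<integral>x. laplace \<gamma> (Suc n) x - rho \<gamma> ^ Suc n * eig \<gamma> x \<partial>\<mu>)"
      by (intro Bochner_Integration.integral_diff[symmetric] bounded_measurable_integrable \<mu> bm)
    finally have eq: "L_Y law \<xi> n \<gamma> - amplitude \<gamma> * rho \<gamma> ^ n = (\<integral>x. laplace \<gamma> (Suc n) x - rho \<gamma> ^ Suc n * eig \<gamma> x \<partial>\<mu>)" .
    have "\<bar>L_Y law \<xi> n \<gamma> - amplitude \<gamma> * rho \<gamma> ^ n\<bar> \<le> M * (\<theta> * rho \<gamma>) ^ Suc n"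
      unfolding eq by (intro prob_integral_abs_le \<mu> bounded_measurable_diff bm) (simp only: laplace_def g(8))
    also have "\<dots> = (\<theta> * rho \<gamma>) * (M * (rho \<gamma> * \<theta>) ^ n)" by (simp add: mult_ac)
    also have "\<dots> \<le> (1 * 2) * (M * (rho \<gamma> * \<theta>) ^ n)"
      using \<theta> g(2) r M by (intro mult_right_mono mult_mono) auto
    finally show ?thesis by (simp add: mult.assoc)
  qed
  then show ?thesis using M \<theta> by - (rule exI[of _ "2 * M"], rule exI[of _ \<theta>], simp)
qed

lemma expansion_at:
  assumes "0 < \<gamma>"
  obtains M \<theta> where "0 < M" "0 < \<theta>" "\<theta> < 1"
    "\<And>n. \<bar>L_Y law \<xi> n \<gamma> - amplitude \<gamma> * rho \<gamma> ^ n\<bar> \<le> M * (rho \<gamma> * \<theta>) ^ n"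
proof -
  from laplace_transform_expansion[OF assms, of \<gamma>] obtain M \<theta> where "0 < M" "0 < \<theta>" "\<theta> < 1"
    "\<forall>g\<in>{\<gamma>..\<gamma>}. \<forall>n. \<bar>L_Y law \<xi> n g - amplitude g * rho g ^ n\<bar> \<le> M * (rho g * \<theta>) ^ n" by blast
  then show thesis by (intro that[of M \<theta>]) auto
qed

lemma L_Y_ratio_limit:
  assumes \<gamma>: "0 < \<gamma>"
  shows "(\<lambda>n. L_Y law \<xi> n \<gamma> / rho \<gamma> ^ n) \<longlonglongrightarrow> amplitude \<gamma>"
proof -
  obtain M \<theta> where M: "0 < M" and \<theta>: "0 < \<theta>" "\<theta> < 1" and
    ex: "\<And>n. \<bar>L_Y law \<xi> n \<gamma> - amplitude \<gamma> * rho \<gamma> ^ n\<bar> \<le> M * (rho \<gamma> * \<theta>) ^ n"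
    using expansion_at[OF \<gamma>] by blast
  have "\<bar>L_Y law \<xi> n \<gamma> - rho \<gamma> ^ n * amplitude \<gamma> * 1\<bar> \<le> M * (\<theta> * rho \<gamma>) ^ n" for n
    using ex[of n] by (simp add: mult.commute)
  from geometric_relative_error[OF zero_less_one rho_pos[OF \<gamma>] this]
  have "\<bar>L_Y law \<xi> n \<gamma> / rho \<gamma> ^ n - amplitude \<gamma>\<bar> \<le> M * \<theta> ^ n" for n by simp
  then show ?thesis by (rule LIMSEQ_geometric_error[OF \<theta>])
qed

lemma \<rho>_Y_eq_rho:
  assumes \<gamma>: "0 < \<gamma>"
  shows "\<rho>_Y law \<xi> \<gamma> = rho \<gamma>"
proof -
  have "(\<lambda>n. root n (L_Y law \<xi> n \<gamma>)) \<longlonglongrightarrow> rho \<gamma>"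
    by (rule root_tendsto_growth_rate[OF rho_pos[OF \<gamma>] amplitude_pos[OF \<gamma>] L_Y_ratio_limit[OF \<gamma>]])
  then have "(\<lambda>n. ereal (root n (L_Y law \<xi> n \<gamma>))) \<longlonglongrightarrow> ereal (rho \<gamma>)" by (rule tendsto_ereal)
  then have "limsup (\<lambda>n. ereal (root n (L_Y law \<xi> n \<gamma>))) = ereal (rho \<gamma>)"
    by (intro lim_imp_Limsup) simp_all
  then show ?thesis by (simp add: \<rho>_Y_def)
qed

theorem law_multiplicatively_ergodic: "multiplicatively_ergodic law \<xi> {0<..}"
  unfolding multiplicatively_ergodic_def
proof (intro conjI)
  show "\<exists>\<gamma>\<^sub>1::ereal. 0 < \<gamma>\<^sub>1 \<and> ({0<..} = {\<gamma>. 0 \<le> \<gamma> \<and> ereal \<gamma> < \<gamma>\<^sub>1} \<or> {0<..} = {\<gamma>. 0 < \<gamma> \<and> ereal \<gamma> < \<gamma>\<^sub>1})"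
    by (intro exI[of _ \<infinity>]) auto
  have "\<exists>M>0. \<exists>\<theta>. 0 < \<theta> \<and> \<theta> < 1 \<and>
      (\<forall>n\<ge>1. \<forall>\<gamma>\<in>K. \<bar>L_Y law \<xi> n \<gamma> - amplitude \<gamma> * rho \<gamma> ^ n\<bar> \<le> M * (rho \<gamma> * \<theta>) ^ n)"
    if K: "compact K" "K \<subseteq> {0<..} - {0}" for K
  proof (cases "K = {}")
    case True
    then show ?thesis by (intro exI[of _ 1] conjI exI[of _ "1/2"]) auto
  next
    case False
    obtain a where a: "a \<in> K" "\<And>t. t \<in> K \<Longrightarrow> a \<le> t" using compact_attains_inf[OF K(1) False] by blast
    obtain b where b: "b \<in> K" "\<And>t. t \<in> K \<Longrightarrow> t \<le> b" using compact_attains_sup[OF K(1) False] by blast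
    have "0 < a" using a(1) K(2) by auto
    from laplace_transform_expansion[OF this, of b] obtain M \<theta> where M: "0 < M" "0 < \<theta>" "\<theta> < 1"
      and ex: "\<forall>\<gamma>\<in>{a..b}. \<forall>n. \<bar>L_Y law \<xi> n \<gamma> - amplitude \<gamma> * rho \<gamma> ^ n\<bar> \<le> M * (rho \<gamma> * \<theta>) ^ n" by blast
    have "K \<subseteq> {a..b}" using a b by auto
    with ex M show ?thesis by blast
  qed
  moreover have "continuous_on {0<..} amplitude"
    by (intro continuous_at_imp_continuous_on ballI amplitude_isCont) auto
  ultimately show "\<exists>A \<rho> :: real \<Rightarrow> real.
        continuous_on {0<..} A \<and> continuous_on {0<..} \<rho> \<and> (\<forall>\<gamma>\<in>{0<..}. 0 < A \<gamma> \<and> 0 < \<rho> \<gamma>) \<and>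
        (\<forall>K. compact K \<and> K \<subseteq> {0<..} - {0} \<longrightarrow>
           (\<exists>M>0. \<exists>\<theta>. 0 < \<theta> \<and> \<theta> < 1 \<and>
              (\<forall>n\<ge>1. \<forall>\<gamma>\<in>K. \<bar>L_Y law \<xi> n \<gamma> - A \<gamma> * \<rho> \<gamma> ^ n\<bar> \<le> M * (\<rho> \<gamma> * \<theta>) ^ n)))"
    using rho_continuous_on amplitude_pos rho_pos
    by - (rule exI[of _ amplitude], rule exI[of _ rho], simp)
qed

lemma L_Y_nonneg: "0 \<le> L_Y law \<xi> n \<gamma>"
  unfolding L_Y_def by (intro integral_nonneg_AE AE_I2) simp

definition remainder :: "real \<Rightarrow> real" where
  "remainder \<gamma> = (\<Sum>n. 2 ^ n * (L_Y law \<xi> n \<gamma> - amplitude \<gamma> * rho \<gamma> ^ n))"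

lemma g_Y_subcritical:
  assumes \<gamma>: "0 < \<gamma>" and half: "rho \<gamma> < 1/2" and M: "0 < M" and \<theta>: "0 < \<theta>" "\<theta> < 1"
    and ex: "\<And>n. \<bar>L_Y law \<xi> n \<gamma> - amplitude \<gamma> * rho \<gamma> ^ n\<bar> \<le> M * (rho \<gamma> * \<theta>) ^ n"
  shows "g_Y law \<xi> \<gamma> 2 = ennreal (amplitude \<gamma> / (1 - 2 * rho \<gamma>) + remainder \<gamma>)"
    and "\<bar>remainder \<gamma>\<bar> \<le> M / (1 - \<theta>)"
proof -
  have r: "0 < rho \<gamma>" by (rule rho_pos[OF \<gamma>])
  define e where "e n = 2 ^ n * (L_Y law \<xi> n \<gamma> - amplitude \<gamma> * rho \<gamma> ^ n)" for n
  have e_le: "norm (e n) \<le> M * \<theta> ^ n" for n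
  proof -
    have "norm (e n) = 2 ^ n * \<bar>L_Y law \<xi> n \<gamma> - amplitude \<gamma> * rho \<gamma> ^ n\<bar>" by (simp add: e_def abs_mult)
    also have "\<dots> \<le> 2 ^ n * (M * (rho \<gamma> * \<theta>) ^ n)" by (intro mult_left_mono ex) simp
    also have "\<dots> = (2 * rho \<gamma>) ^ n * (M * \<theta> ^ n)" by (simp add: power_mult_distrib)
    also have "\<dots> \<le> 1 * (M * \<theta> ^ n)" using half r M \<theta> by (intro mult_right_mono power_le_one) auto
    finally show ?thesis by simp
  qed
  have geo: "summable (\<lambda>n. M * \<theta> ^ n)" using \<theta> by (intro summable_mult summable_geometric) auto
  have "e sums remainder \<gamma>"
    unfolding remainder_def e_def[symmetric]
    by (rule summable_sums[OF summable_comparison_test'[OF geo, of 0]]) (use e_le in auto)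
  moreover have "(\<lambda>n. amplitude \<gamma> * (2 * rho \<gamma>) ^ n) sums (amplitude \<gamma> * (1 / (1 - 2 * rho \<gamma>)))"
    using half r by (intro sums_mult geometric_sums) auto
  ultimately have "(\<lambda>n. amplitude \<gamma> * (2 * rho \<gamma>) ^ n + e n) sums (amplitude \<gamma> * (1 / (1 - 2 * rho \<gamma>)) + remainder \<gamma>)"
    by (rule sums_add[rotated])
  moreover have "amplitude \<gamma> * (2 * rho \<gamma>) ^ n + e n = 2 ^ n * L_Y law \<xi> n \<gamma>" for n
    by (simp add: e_def power_mult_distrib algebra_simps)
  ultimately have "(\<lambda>n. 2 ^ n * L_Y law \<xi> n \<gamma>) sums (amplitude \<gamma> / (1 - 2 * rho \<gamma>) + remainder \<gamma>)" by simp
  then show "g_Y law \<xi> \<gamma> 2 = ennreal (amplitude \<gamma> / (1 - 2 * rho \<gamma>) + remainder \<gamma>)"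
    unfolding g_Y_def using L_Y_nonneg by (intro suminf_ennreal_eq) auto
  have "norm (remainder \<gamma>) \<le> (\<Sum>n. M * \<theta> ^ n)"
    unfolding remainder_def e_def[symmetric] by (rule norm_suminf_le[OF e_le geo])
  also have "\<dots> = M / (1 - \<theta>)" using \<theta> by (subst suminf_mult) (auto simp: suminf_geometric summable_geometric)
  finally show "\<bar>remainder \<gamma>\<bar> \<le> M / (1 - \<theta>)" by simp
qed

text \<open>
  If \<open>rho \<gamma> \<ge> 1/2\<close>, the terms of the series do not tend to \<open>0\<close>: they dominate the quotients
  \<open>L_Y law \<xi> n \<gamma> / rho \<gamma> ^ n\<close>, which converge to the amplitude. This covers the critical case too.
\<close>

lemma g_Y_finite_iff:
  assumes \<gamma>: "0 < \<gamma>"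
  shows "g_Y law \<xi> \<gamma> 2 < \<infinity> \<longleftrightarrow> rho \<gamma> < 1/2"
proof
  assume "rho \<gamma> < 1/2"
  then show "g_Y law \<xi> \<gamma> 2 < \<infinity>" using expansion_at[OF \<gamma>] g_Y_subcritical(1)[OF \<gamma>] by (metis ennreal_less_top infinity_ennreal_def)
next
  assume fin: "g_Y law \<xi> \<gamma> 2 < \<infinity>"
  show "rho \<gamma> < 1/2"
  proof (rule ccontr)
    assume "\<not> rho \<gamma> < 1/2"
    then have half: "1 \<le> 2 * rho \<gamma>" by simp
    have r: "0 < rho \<gamma>" by (rule rho_pos[OF \<gamma>])
    have "summable (\<lambda>n. 2 ^ n * L_Y law \<xi> n \<gamma>)"
      using fin L_Y_nonneg unfolding g_Y_def by (intro summable_suminf_not_top) auto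
    then have "(\<lambda>n. 2 ^ n * L_Y law \<xi> n \<gamma>) \<longlonglongrightarrow> 0" by (rule summable_LIMSEQ_zero)
    moreover have "L_Y law \<xi> n \<gamma> / rho \<gamma> ^ n \<le> 2 ^ n * L_Y law \<xi> n \<gamma>" for n
    proof -
      have "1 * (L_Y law \<xi> n \<gamma> / rho \<gamma> ^ n) \<le> (2 * rho \<gamma>) ^ n * (L_Y law \<xi> n \<gamma> / rho \<gamma> ^ n)"
        using half r L_Y_nonneg by (intro mult_right_mono one_le_power divide_nonneg_nonneg) auto
      also have "\<dots> = 2 ^ n * L_Y law \<xi> n \<gamma>" using r by (simp add: power_mult_distrib)
      finally show ?thesis by simp
    qed
    ultimately have "amplitude \<gamma> \<le> 0"
      using LIMSEQ_le[OF L_Y_ratio_limit[OF \<gamma>]] by blast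
    with amplitude_pos[OF \<gamma>] show False by simp
  qed
qed

lemma \<nu>_Y_finite: "\<nu>_Y law \<xi> < \<infinity>"
proof -
  have "\<forall>\<^sub>F \<gamma> in at_top. rho \<gamma> < 1/2" by (rule order_tendstoD(2)[OF rho_tendsto_zero]) simp
  then have "\<forall>\<^sub>F \<gamma> in at_top. rho \<gamma> < 1/2 \<and> 0 < \<gamma>" using eventually_gt_at_top[of 0] by eventually_elim simp
  then obtain \<gamma> where "rho \<gamma> < 1/2" "0 < \<gamma>" by (auto simp: eventually_at_top_linorder)
  then have "ereal \<gamma> \<in> ereal ` {\<gamma>. 0 < \<gamma> \<and> g_Y law \<xi> \<gamma> 2 < \<infinity>}" using g_Y_finite_iff by auto
  then have "\<nu>_Y law \<xi> \<le> ereal \<gamma>" unfolding \<nu>_Y_def by (rule Inf_lower)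
  then show ?thesis by (rule order_le_less_trans) simp
qed

lemma \<nu>_Y_critical:
  assumes \<nu>: "0 < \<nu>" "rho \<nu> = 1/2"
  shows "\<nu>_Y law \<xi> = ereal \<nu>"
proof -
  have "{\<gamma>. 0 < \<gamma> \<and> g_Y law \<xi> \<gamma> 2 < \<infinity>} = {\<nu><..}"
  proof (intro set_eqI iffI)
    fix \<gamma> assume "\<gamma> \<in> {\<gamma>. 0 < \<gamma> \<and> g_Y law \<xi> \<gamma> 2 < \<infinity>}"
    then have \<gamma>: "0 < \<gamma>" "rho \<gamma> < rho \<nu>" using g_Y_finite_iff \<nu> by auto
    then have "\<not> \<gamma> \<le> \<nu>" using rho_strict_antimono[OF \<gamma>(1), of \<nu>] by (cases "\<gamma> = \<nu>") auto
    then show "\<gamma> \<in> {\<nu><..}" by simp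
  next
    fix \<gamma> assume "\<gamma> \<in> {\<nu><..}"
    then show "\<gamma> \<in> {\<gamma>. 0 < \<gamma> \<and> g_Y law \<xi> \<gamma> 2 < \<infinity>}"
      using g_Y_finite_iff[of \<gamma>] rho_strict_antimono[OF \<nu>(1), of \<gamma>] \<nu> by auto
  qed
  moreover have "ereal ` {\<nu><..} = {ereal \<nu><..<\<infinity>}"
  proof (intro set_eqI iffI)
    fix z assume "z \<in> {ereal \<nu><..<\<infinity>}"
    then show "z \<in> ereal ` {\<nu><..}" by (cases z) auto
  qed auto
  ultimately show ?thesis unfolding \<nu>_Y_def by (simp add: Inf_greaterThanLessThan)
qed

text \<open>
  To the right of \<open>\<nu>\<close> the factor \<open>(\<gamma> - \<nu>) / (1 - 2 rho \<gamma>)\<close> is minus one half of the reciprocal of a difference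
  quotient of \<open>rho\<close>, hence it converges; the remainder stays bounded and is annihilated by \<open>\<gamma> - \<nu>\<close>.
\<close>

theorem g_Y_simple_pole:
  assumes \<nu>: "0 < \<nu>" "rho \<nu> = 1/2"
  shows "\<exists>C::real. ((\<lambda>\<gamma>. ennreal ((\<gamma> - \<nu>) / \<gamma>) * g_Y law \<xi> \<gamma> 2) \<longlongrightarrow> ennreal C) (at_right \<nu>)"
proof -
  define D where "D = - (rho \<nu> * dual \<nu> (\<lambda>x. \<xi> x * eig \<nu> x))"
  have D: "D < 0" unfolding D_def by (rule rho_derivative_neg[OF \<nu>(1)])
  obtain M \<theta> where M: "0 < M" and \<theta>: "0 < \<theta>" "\<theta> < 1"
    and ex: "\<forall>\<gamma>\<in>{\<nu>..\<nu> + 1}. \<forall>n. \<bar>L_Y law \<xi> n \<gamma> - amplitude \<gamma> * rho \<gamma> ^ n\<bar> \<le> M * (rho \<gamma> * \<theta>) ^ n"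
    using laplace_transform_expansion[OF \<nu>(1), of "\<nu> + 1"] by blast
  have le: "at_right \<nu> \<le> at \<nu>" by (rule at_le) simp
  have near: "\<forall>\<^sub>F \<gamma> in at_right \<nu>. \<nu> < \<gamma> \<and> \<gamma> < \<nu> + 1"
    using eventually_at_right_real[of \<nu> "\<nu> + 1"] by simp
  have g_val: "g_Y law \<xi> \<gamma> 2 = ennreal (amplitude \<gamma> / (1 - 2 * rho \<gamma>) + remainder \<gamma>)"
    "\<bar>remainder \<gamma>\<bar> \<le> M / (1 - \<theta>)" if "\<nu> < \<gamma> \<and> \<gamma> < \<nu> + 1" for \<gamma>
  proof -
    have \<gamma>: "0 < \<gamma>" "\<gamma> \<in> {\<nu>..\<nu> + 1}" using that \<nu> by auto
    have half: "rho \<gamma> < 1/2" using rho_strict_antimono[OF \<nu>(1), of \<gamma>] that \<nu>(2) by simp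
    note ex' = ex[rule_format, OF \<gamma>(2)]
    from g_Y_subcritical[OF \<gamma>(1) half M \<theta> ex']
    show "g_Y law \<xi> \<gamma> 2 = ennreal (amplitude \<gamma> / (1 - 2 * rho \<gamma>) + remainder \<gamma>)"
      "\<bar>remainder \<gamma>\<bar> \<le> M / (1 - \<theta>)" by auto
  qed
  have id: "((\<lambda>\<gamma>. \<gamma>) \<longlongrightarrow> \<nu>) (at_right \<nu>)" by (rule tendsto_ident_at)
  have slope: "((\<lambda>\<gamma>. 1 / (-2 * ((rho \<gamma> - rho \<nu>) / (\<gamma> - \<nu>)))) \<longlongrightarrow> 1 / (-2 * D)) (at_right \<nu>)"
    using rho_has_derivative[OF \<nu>(1), folded D_def] D
    by (intro tendsto_intros tendsto_mono[OF le]) (auto simp: has_field_derivative_iff)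
  have amp: "(amplitude \<longlongrightarrow> amplitude \<nu>) (at_right \<nu>)"
    using amplitude_isCont[OF \<nu>(1)] by (intro tendsto_mono[OF le]) (simp add: isCont_def)
  have rem: "((\<lambda>\<gamma>. (\<gamma> - \<nu>) / \<gamma> * remainder \<gamma>) \<longlongrightarrow> 0) (at_right \<nu>)"
  proof (rule Lim_null_comparison)
    show "\<forall>\<^sub>F \<gamma> in at_right \<nu>. norm ((\<gamma> - \<nu>) / \<gamma> * remainder \<gamma>) \<le> (\<gamma> - \<nu>) / \<gamma> * (M / (1 - \<theta>))"
      using near
    proof eventually_elim
      case (elim \<gamma>)
      have q: "0 \<le> (\<gamma> - \<nu>) / \<gamma>" using elim \<nu>(1) by simp
      show ?case
        unfolding real_norm_def abs_mult abs_of_nonneg[OF q] by (rule mult_left_mono[OF g_val(2)[OF elim] q])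
    qed
    have "((\<lambda>\<gamma>. (\<gamma> - \<nu>) / \<gamma> * (M / (1 - \<theta>))) \<longlongrightarrow> (\<nu> - \<nu>) / \<nu> * (M / (1 - \<theta>))) (at_right \<nu>)"
      using \<nu>(1) \<theta> by (intro tendsto_intros id) auto
    then show "((\<lambda>\<gamma>. (\<gamma> - \<nu>) / \<gamma> * (M / (1 - \<theta>))) \<longlongrightarrow> 0) (at_right \<nu>)" by simp
  qed
  define C where "C = amplitude \<nu> / \<nu> * (1 / (-2 * D)) + 0"
  have "((\<lambda>\<gamma>. amplitude \<gamma> / \<gamma> * (1 / (-2 * ((rho \<gamma> - rho \<nu>) / (\<gamma> - \<nu>)))) + (\<gamma> - \<nu>) / \<gamma> * remainder \<gamma>)
      \<longlongrightarrow> C) (at_right \<nu>)"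
    unfolding C_def using \<nu>(1) by (intro tendsto_add tendsto_mult tendsto_divide slope amp id rem) auto
  then have "((\<lambda>\<gamma>. ennreal (amplitude \<gamma> / \<gamma> * (1 / (-2 * ((rho \<gamma> - rho \<nu>) / (\<gamma> - \<nu>)))) + (\<gamma> - \<nu>) / \<gamma> * remainder \<gamma>))
      \<longlongrightarrow> ennreal C) (at_right \<nu>)"
    by (rule tendsto_ennrealI)
  moreover have "\<forall>\<^sub>F \<gamma> in at_right \<nu>.
      ennreal (amplitude \<gamma> / \<gamma> * (1 / (-2 * ((rho \<gamma> - rho \<nu>) / (\<gamma> - \<nu>)))) + (\<gamma> - \<nu>) / \<gamma> * remainder \<gamma>)
      = ennreal ((\<gamma> - \<nu>) / \<gamma>) * g_Y law \<xi> \<gamma> 2"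
    using near
  proof eventually_elim
    case (elim \<gamma>)
    have pos: "0 < \<gamma>" "0 < \<gamma> - \<nu>" using elim \<nu>(1) by auto
    have half: "0 < 1 - 2 * rho \<gamma>" using rho_strict_antimono[OF \<nu>(1), of \<gamma>] elim \<nu>(2) by simp
    have "-2 * ((rho \<gamma> - rho \<nu>) / (\<gamma> - \<nu>)) = (1 - 2 * rho \<gamma>) / (\<gamma> - \<nu>)"
      using pos by (simp add: \<nu>(2) field_simps)
    then have eq: "amplitude \<gamma> / \<gamma> * (1 / (-2 * ((rho \<gamma> - rho \<nu>) / (\<gamma> - \<nu>)))) + (\<gamma> - \<nu>) / \<gamma> * remainder \<gamma>
        = (\<gamma> - \<nu>) / \<gamma> * (amplitude \<gamma> / (1 - 2 * rho \<gamma>) + remainder \<gamma>)"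
      by (simp only: distrib_left) simp
    have q: "0 \<le> (\<gamma> - \<nu>) / \<gamma>" using pos by simp
    show ?case unfolding eq g_val(1)[OF elim] by (rule ennreal_mult'[OF q])
  qed
  ultimately show ?thesis by (intro exI[of _ C]) (rule Lim_transform_eventually)
qed

end

lemma critical_exponent_exists:
  assumes "0 < \<gamma>\<^sub>0" "1/2 \<le> rho \<gamma>\<^sub>0"
  shows "\<exists>\<nu>>0. rho \<nu> = 1/2"
proof -
  have "\<forall>\<^sub>F \<gamma> in at_top. rho \<gamma> < 1/2" by (rule order_tendstoD(2)[OF rho_tendsto_zero]) simp
  then have "\<forall>\<^sub>F \<gamma> in at_top. rho \<gamma> < 1/2 \<and> \<gamma>\<^sub>0 < \<gamma>" using eventually_gt_at_top[of "\<gamma>\<^sub>0"] by eventually_elim simp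
  then obtain \<gamma>\<^sub>1 where "rho \<gamma>\<^sub>1 < 1/2" "\<gamma>\<^sub>0 < \<gamma>\<^sub>1" by (auto simp: eventually_at_top_linorder)
  moreover have "continuous_on {\<gamma>\<^sub>0..\<gamma>\<^sub>1} rho"
    by (rule continuous_on_subset[OF rho_continuous_on]) (use assms in auto)
  ultimately obtain \<nu> where "\<gamma>\<^sub>0 \<le> \<nu>" "rho \<nu> = 1/2"
    using IVT2'[of rho "\<gamma>\<^sub>1" "1/2" "\<gamma>\<^sub>0"] assms by auto
  with assms show ?thesis by (intro exI[of _ \<nu>]) auto
qed

end

section \<open>The linear autoregressive chain\<close>

lemma (in prob_space) indep_var_expectation:
  fixes F :: "'b \<times> 'b \<Rightarrow> real"
  assumes ind: "indep_var S Y T Z" and F: "F \<in> borel_measurable (S \<Otimes>\<^sub>M T)" "\<And>z. \<bar>F z\<bar> \<le> B"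
  shows "expectation (\<lambda>\<omega>. F (Y \<omega>, Z \<omega>)) = expectation (\<lambda>\<omega>. \<integral>z. F (Y \<omega>, z) \<partial>distr M T Z)"
proof -
  have Y: "Y \<in> measurable M S" and Z: "Z \<in> measurable M T"
    using ind by (auto dest: indep_var_rv1 indep_var_rv2)
  interpret DY: prob_space "distr M S Y" by (rule prob_space_distr[OF Y])
  interpret DZ: prob_space "distr M T Z" by (rule prob_space_distr[OF Z])
  interpret YZ: pair_prob_space "distr M S Y" "distr M T Z" ..
  have F': "F \<in> borel_measurable (distr M S Y \<Otimes>\<^sub>M distr M T Z)"
    using F(1) by (simp cong: measurable_cong_sets)
  have int: "integrable (distr M S Y \<Otimes>\<^sub>M distr M T Z) F"
    by (rule YZ.P.integrable_const_bound[of _ B]) (use F F' in auto)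
  have inner: "(\<lambda>y. \<integral>z. F (y, z) \<partial>distr M T Z) \<in> borel_measurable S"
    using DZ.borel_measurable_lebesgue_integral[of "\<lambda>y z. F (y, z)" S] F(1) by (simp cong: measurable_cong_sets)
  have "expectation (\<lambda>\<omega>. F (Y \<omega>, Z \<omega>)) = (\<integral>z. F z \<partial>distr M (S \<Otimes>\<^sub>M T) (\<lambda>\<omega>. (Y \<omega>, Z \<omega>)))"
    by (rule integral_distr[symmetric]) (use Y Z F in auto)
  also have "\<dots> = (\<integral>z. F z \<partial>(distr M S Y \<Otimes>\<^sub>M distr M T Z))"
    using ind by (simp add: indep_var_distribution_eq)
  also have "\<dots> = (\<integral>y. (\<integral>z. F (y, z) \<partial>distr M T Z) \<partial>distr M S Y)"
    by (rule YZ.integral_fst'[OF int, symmetric])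
  also have "\<dots> = expectation (\<lambda>\<omega>. \<integral>z. F (Y \<omega>, z) \<partial>distr M T Z)"
    by (rule integral_distr[OF Y inner])
  finally show ?thesis .
qed

lemma ar_chain_cong:
  "(\<And>k. 1 \<le> k \<Longrightarrow> k \<le> n \<Longrightarrow> \<theta> k = \<theta>' k) \<Longrightarrow> ar_chain \<alpha> x \<theta> n = ar_chain \<alpha> x \<theta>' n"
  by (induction n) auto

lemma ar_chain_measurable_PiM:
  "m \<le> n \<Longrightarrow> (\<lambda>y. ar_chain \<alpha> x y m) \<in> borel_measurable (PiM {1..n} (\<lambda>_. borel))"
proof (induction m)
  case (Suc m)
  then have "(\<lambda>y. y (Suc m)) \<in> borel_measurable (PiM {1..n} (\<lambda>_. borel :: real measure))"
    by (intro measurable_component_singleton) auto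
  with Suc show ?case by simp
qed simp

locale ar_innovations = prob_space M for M :: "'a measure" +
  fixes \<alpha> :: real and \<theta> :: "nat \<Rightarrow> 'a \<Rightarrow> real" and p :: "real \<Rightarrow> real"
  assumes innovations_indep: "indep_vars (\<lambda>_. borel) \<theta> {1..}"
    and innovations_ident: "\<And>n. 1 \<le> n \<Longrightarrow> distr M borel (\<theta> n) = distr M borel (\<theta> 1)"
    and p_continuous: "continuous_on UNIV p" and p_pos: "\<And>x. 0 < p x"
    and innovations_density: "distributed M lborel (\<theta> 1) (\<lambda>x. ennreal (p x))"
begin

definition transition :: "real \<Rightarrow> real \<Rightarrow> real" where
  "transition x y = p (y - \<alpha> * x)"

lemma p_measurable[measurable]: "p \<in> borel_measurable borel"
  by (rule borel_measurable_continuous_onI[OF p_continuous])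

lemma innovations_measurable: "1 \<le> n \<Longrightarrow> \<theta> n \<in> borel_measurable M"
  using innovations_indep by (auto simp: indep_vars_def)

lemma innovations_distr: "1 \<le> n \<Longrightarrow> distr M borel (\<theta> n) = density lborel (\<lambda>x. ennreal (p x))"
proof -
  assume "1 \<le> n"
  then have "distr M borel (\<theta> n) = distr M borel (\<theta> 1)" by (rule innovations_ident)
  also have "\<dots> = distr M lborel (\<theta> 1)" by (rule distr_cong) auto
  also have "\<dots> = density lborel (\<lambda>x. ennreal (p x))"
    using innovations_density by (rule distributed_distr_eq_density)
  finally show ?thesis .
qed

lemma p_nn_integral: "(\<integral>\<^sup>+ y. ennreal (p y) \<partial>lborel) = 1"
proof -
  interpret D: prob_space "distr M borel (\<theta> 1)" by (rule prob_space_distr[OF innovations_measurable]) simp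
  show ?thesis using D.emeasure_space_1 unfolding innovations_distr[OF order_refl] by (simp add: emeasure_density)
qed

lemma p_has_integral: "has_bochner_integral lborel p 1"
  using p_nn_integral p_pos by (intro has_bochner_integral_nn_integral) (auto simp: less_imp_le)

lemma transition_markov_density: "positive_markov_density transition"
proof
  have "continuous_on UNIV (\<lambda>z::real \<times> real. p (snd z - \<alpha> * fst z))"
    by (intro continuous_on_compose2[OF p_continuous] continuous_intros) auto
  then show "continuous_on UNIV (\<lambda>z. transition (fst z) (snd z))" by (simp add: transition_def)
  show "0 < transition x y" for x y by (simp add: transition_def p_pos)
  show "has_bochner_integral lborel (transition x) 1" for x
    using lborel_has_bochner_integral_real_affine_iff[of 1 p 1 "- \<alpha> * x"] p_has_integral
    by (simp add: transition_def[abs_def] algebra_simps)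
qed

sublocale positive_markov_density transition by (rule transition_markov_density)

lemma P_eq_integral: "P f x = (\<integral>t. p t * f (\<alpha> * x + t) \<partial>lborel)"
  unfolding P_def transition_def
  using lborel_integral_real_affine[of 1 "\<lambda>y. p (y - \<alpha> * x) * f y" "\<alpha> * x"] by simp

lemma P_eq_expectation:
  assumes "bounded_measurable f" "1 \<le> n"
  shows "(\<integral>z. f (\<alpha> * x + z) \<partial>distr M borel (\<theta> n)) = P f x"
proof -
  have [measurable]: "f \<in> borel_measurable borel" by (rule bounded_measurable_measurable[OF assms(1)])
  show ?thesis
    unfolding innovations_distr[OF assms(2)] P_eq_integral
    by (subst integral_density) (auto simp: p_pos less_imp_le)
qed

abbreviation chain :: "real \<Rightarrow> 'a \<Rightarrow> nat \<Rightarrow> real" where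
  "chain x \<omega> \<equiv> ar_chain \<alpha> x (\<lambda>k. \<theta> k \<omega>)"

text \<open>
  Induction on the last step: \<open>\<theta>\<^sub>n\<^sub>+\<^sub>1\<close> is independent of the first \<open>n\<close> innovations, of which the chain up to
  time \<open>n\<close> is a function, so integrating it out replaces \<open>w f\<close> by its image under the transition
  operator. The function \<open>f\<close> of the final state is general to make the induction work.
\<close>

theorem expectation_killed_chain:
  assumes w: "vanishing_weight w" and f: "bounded_measurable f"
  shows "expectation (\<lambda>\<omega>. (\<Prod>k\<le>n. w (chain x \<omega> k)) * f (chain x \<omega> n)) = (Q w ^^ n) (\<lambda>y. w y * f y) x"
  using f
proof (induction n arbitrary: f)
  case 0
  then show ?case by (simp add: prob_space)
next
  case (Suc n)
  have w_bm: "bounded_measurable w"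
    using w weight_nonneg[OF w] weight_le_one[OF w]
    by (intro bounded_measurableI[of _ 1] borel_measurable_continuous_onI) (auto simp: vanishing_weight_def)
  have wf: "bounded_measurable (\<lambda>y. w y * f y)" by (intro bounded_measurable_mult w_bm Suc)
  obtain B where B: "0 < B" "\<And>y. \<bar>w y * f y\<bar> \<le> B" using bounded_measurable_bound[OF wf] by blast
  define F where "F = (\<lambda>(y, z). (\<Prod>k\<le>n. w (ar_chain \<alpha> x y k)) *
      (\<lambda>v. w v * f v) (\<alpha> * ar_chain \<alpha> x y n + z (Suc n)))"
  define Y where "Y \<omega> = restrict (\<lambda>k. \<theta> k \<omega>) {1..n}" for \<omega>
  define Z where "Z \<omega> = restrict (\<lambda>k. \<theta> k \<omega>) {Suc n}" for \<omega>
  let ?S = "PiM {1..n} (\<lambda>_. borel :: real measure)" and ?T = "PiM {Suc n} (\<lambda>_. borel :: real measure)"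
  have ind: "indep_var ?S Y ?T Z"
    unfolding Y_def[abs_def] Z_def[abs_def] by (rule indep_var_restrict[OF innovations_indep]) auto
  have chain_Y: "ar_chain \<alpha> x (Y \<omega>) k = chain x \<omega> k" if "k \<le> n" for k \<omega>
    using that by (intro ar_chain_cong) (auto simp: Y_def)
  have [measurable]: "w \<in> borel_measurable borel" "(\<lambda>v. w v * f v) \<in> borel_measurable borel"
    by (rule bounded_measurable_measurable[OF w_bm], rule bounded_measurable_measurable[OF wf])
  have c_meas: "(\<lambda>a. ar_chain \<alpha> x (fst a) k) \<in> borel_measurable (?S \<Otimes>\<^sub>M ?T)" if "k \<le> n" for k
    by (rule measurable_compose[OF measurable_fst ar_chain_measurable_PiM[OF that]])
  have z_meas: "(\<lambda>a. snd a (Suc n)) \<in> borel_measurable (?S \<Otimes>\<^sub>M ?T)"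
    by (rule measurable_compose[OF measurable_snd measurable_component_singleton]) auto
  have F_meas: "F \<in> borel_measurable (?S \<Otimes>\<^sub>M ?T)"
    unfolding F_def case_prod_beta
    by (intro borel_measurable_times borel_measurable_prod borel_measurable_add borel_measurable_const z_meas
        measurable_compose[OF c_meas \<open>w \<in> borel_measurable borel\<close>] c_meas
        measurable_compose[OF _ \<open>(\<lambda>v. w v * f v) \<in> borel_measurable borel\<close>]) auto
  have prod_le: "\<bar>\<Prod>k\<le>n. w (c k)\<bar> \<le> 1" for c :: "nat \<Rightarrow> real"
    using weight_nonneg[OF w] weight_le_one[OF w] by (simp add: abs_prod prod_le_1)
  have F_le: "\<bar>F a\<bar> \<le> B" for a
  proof -
    have "\<bar>\<Prod>k\<le>n. w (ar_chain \<alpha> x (fst a) k)\<bar> *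
        \<bar>w (\<alpha> * ar_chain \<alpha> x (fst a) n + snd a (Suc n)) * f (\<alpha> * ar_chain \<alpha> x (fst a) n + snd a (Suc n))\<bar> \<le> 1 * B"
      by (intro mult_mono prod_le B) auto
    then show ?thesis by (simp add: F_def case_prod_beta abs_mult)
  qed
  have "expectation (\<lambda>\<omega>. (\<Prod>k\<le>Suc n. w (chain x \<omega> k)) * f (chain x \<omega> (Suc n)))
      = expectation (\<lambda>\<omega>. F (Y \<omega>, Z \<omega>))"
  proof (rule Bochner_Integration.integral_cong[OF refl])
    fix \<omega>
    have "(\<Prod>k\<le>n. w (ar_chain \<alpha> x (Y \<omega>) k)) = (\<Prod>k\<le>n. w (chain x \<omega> k))"
      by (intro prod.cong) (auto simp: chain_Y)
    then show "(\<Prod>k\<le>Suc n. w (chain x \<omega> k)) * f (chain x \<omega> (Suc n)) = F (Y \<omega>, Z \<omega>)"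
      by (simp add: F_def chain_Y Z_def)
  qed
  also have "\<dots> = expectation (\<lambda>\<omega>. \<integral>z. F (Y \<omega>, z) \<partial>distr M ?T Z)"
    by (rule indep_var_expectation[OF ind F_meas F_le])
  also have "\<dots> = expectation (\<lambda>\<omega>. (\<Prod>k\<le>n. w (chain x \<omega> k)) * P (\<lambda>y. w y * f y) (chain x \<omega> n))"
  proof (rule Bochner_Integration.integral_cong[OF refl])
    fix \<omega>
    have Z: "Z \<in> measurable M ?T" using ind by (rule indep_var_rv2)
    define c where "c = (\<Prod>k\<le>n. w (chain x \<omega> k))"
    have "F (Y \<omega>, z) = c * (\<lambda>v. w v * f v) (\<alpha> * chain x \<omega> n + z (Suc n))" for z
    proof -
      have "(\<Prod>k\<le>n. w (ar_chain \<alpha> x (Y \<omega>) k)) = c"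
        unfolding c_def by (intro prod.cong) (auto simp: chain_Y)
      then show ?thesis by (simp add: F_def chain_Y)
    qed
    then have "(\<integral>z. F (Y \<omega>, z) \<partial>distr M ?T Z)
        = c * (\<integral>z. (\<lambda>v. w v * f v) (\<alpha> * chain x \<omega> n + z (Suc n)) \<partial>distr M ?T Z)" by simp
    also have "(\<integral>z. (\<lambda>v. w v * f v) (\<alpha> * chain x \<omega> n + z (Suc n)) \<partial>distr M ?T Z)
        = expectation (\<lambda>\<omega>'. (\<lambda>v. w v * f v) (\<alpha> * chain x \<omega> n + Z \<omega>' (Suc n)))"
      by (intro integral_distr Z measurable_compose[OF _ \<open>(\<lambda>v. w v * f v) \<in> borel_measurable borel\<close>]
          borel_measurable_add borel_measurable_const measurable_component_singleton) auto
    also have "\<dots> = expectation (\<lambda>\<omega>'. (\<lambda>v. w v * f v) (\<alpha> * chain x \<omega> n + \<theta> (Suc n) \<omega>'))"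
      by (simp add: Z_def)
    also have "\<dots> = (\<integral>z. (\<lambda>v. w v * f v) (\<alpha> * chain x \<omega> n + z) \<partial>distr M borel (\<theta> (Suc n)))"
      by (intro integral_distr[symmetric] innovations_measurable measurable_compose[OF _ \<open>(\<lambda>v. w v * f v) \<in> borel_measurable borel\<close>]
          borel_measurable_add borel_measurable_const) auto
    also have "\<dots> = P (\<lambda>y. w y * f y) (chain x \<omega> n)" by (rule P_eq_expectation[OF wf]) simp
    finally show "(\<integral>z. F (Y \<omega>, z) \<partial>distr M ?T Z)
        = (\<Prod>k\<le>n. w (chain x \<omega> k)) * P (\<lambda>y. w y * f y) (chain x \<omega> n)" by (simp add: c_def)
  qed
  also have "\<dots> = (Q w ^^ n) (\<lambda>y. w y * P (\<lambda>y. w y * f y) y) x"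
    by (rule Suc.IH[OF P_bounded_measurable[OF wf]])
  also have "\<dots> = (Q w ^^ Suc n) (\<lambda>y. w y * f y) x"
    by (simp add: funpow_Suc_right Q_def[abs_def] del: funpow.simps)
  finally show ?case .
qed

lemma chain_measurable:
  "(\<lambda>z. ar_chain \<alpha> (fst z) (\<lambda>k. \<theta> k (snd z)) n) \<in> borel_measurable (borel \<Otimes>\<^sub>M M)"
proof (induction n)
  case (Suc n)
  have "(\<lambda>z. \<theta> (Suc n) (snd z)) \<in> borel_measurable (borel \<Otimes>\<^sub>M M)"
    by (rule measurable_compose[OF measurable_snd innovations_measurable]) simp
  then show ?case
    by (simp only: ar_chain.simps) (intro borel_measurable_add borel_measurable_times borel_measurable_const Suc)
qed simp

lemma path_measurable:
  assumes "sets \<mu> = sets borel"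
  shows "(\<lambda>(x, \<omega>). chain x \<omega>) \<in> measurable (\<mu> \<Otimes>\<^sub>M M) (\<Pi>\<^sub>M n\<in>UNIV. borel)"
proof (rule measurable_PiM_single')
  show "(\<lambda>z. (case z of (x, \<omega>) \<Rightarrow> chain x \<omega>) n) \<in> borel_measurable (\<mu> \<Otimes>\<^sub>M M)" for n
    using chain_measurable[of n] assms by (simp add: case_prod_beta' cong: measurable_cong_sets sets_pair_measure_cong)
qed auto

theorem ar_law_integral:
  assumes \<mu>: "prob_space \<mu>" "sets \<mu> = sets borel"
    and w: "vanishing_weight w"
  shows "(\<integral>X. (\<Prod>k\<le>n. w (X k)) \<partial>ar_law \<alpha> M \<theta> \<mu>) = (\<integral>x. (Q w ^^ Suc n) (\<lambda>_. 1) x \<partial>\<mu>)"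
proof -
  interpret \<mu>: prob_space \<mu> by (rule \<mu>)
  interpret \<mu>M: pair_prob_space \<mu> M ..
  have [measurable]: "w \<in> borel_measurable borel"
    using w by (auto simp: vanishing_weight_def intro: borel_measurable_continuous_onI)
  have G: "(\<lambda>X. \<Prod>k\<le>n. w (X k)) \<in> borel_measurable (\<Pi>\<^sub>M n\<in>UNIV. borel)"
    using measurable_component_singleton[of _ UNIV "\<lambda>_. borel :: real measure"]
    by (intro borel_measurable_prod measurable_compose[OF _ \<open>w \<in> borel_measurable borel\<close>]) auto
  have prod_le: "\<bar>\<Prod>k\<le>n. w (c k)\<bar> \<le> 1" for c :: "nat \<Rightarrow> real"
    using weight_nonneg[OF w] weight_le_one[OF w] by (simp add: abs_prod prod_le_1)
  have "(\<integral>X. (\<Prod>k\<le>n. w (X k)) \<partial>ar_law \<alpha> M \<theta> \<mu>)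
      = (\<integral>z. (\<Prod>k\<le>n. w ((case z of (x, \<omega>) \<Rightarrow> chain x \<omega>) k)) \<partial>(\<mu> \<Otimes>\<^sub>M M))"
    unfolding ar_law_def by (rule integral_distr[OF path_measurable[OF \<mu>(2)] G])
  also have "\<dots> = (\<integral>x. expectation (\<lambda>\<omega>. \<Prod>k\<le>n. w (chain x \<omega> k)) \<partial>\<mu>)"
  proof -
    have "integrable (\<mu> \<Otimes>\<^sub>M M) (\<lambda>z. \<Prod>k\<le>n. w ((case z of (x, \<omega>) \<Rightarrow> chain x \<omega>) k))"
      by (rule \<mu>M.P.integrable_const_bound[of _ 1])
        (use prod_le measurable_compose[OF path_measurable[OF \<mu>(2)] G] in auto)
    from \<mu>M.integral_fst'[OF this] show ?thesis by simp
  qed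
  also have "\<dots> = (\<integral>x. (Q w ^^ Suc n) (\<lambda>_. 1) x \<partial>\<mu>)"
  proof (rule Bochner_Integration.integral_cong[OF refl])
    fix x
    have "expectation (\<lambda>\<omega>. \<Prod>k\<le>n. w (chain x \<omega> k)) = (Q w ^^ n) (\<lambda>y. w y * 1) x"
      using expectation_killed_chain[OF w bounded_measurable_const[of 1], of x n] by simp
    also have "(\<lambda>y. w y * 1) = Q w (\<lambda>_. 1)" by (rule ext) (simp add: Q_const)
    finally show "expectation (\<lambda>\<omega>. \<Prod>k\<le>n. w (chain x \<omega> k)) = (Q w ^^ Suc n) (\<lambda>_. 1) x"
      by (simp add: funpow_Suc_right del: funpow.simps)
  qed
  finally show ?thesis .
qed

text \<open>
  From \<open>\<bar>x\<bar> \<le> b\<close> the chain stays in \<open>[-b, b]\<close> whenever the innovation is at most \<open>(1 - \<bar>\<alpha>\<bar>) b\<close> in modulus.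
\<close>

lemma staying_probability:
  assumes "\<bar>\<alpha>\<bar> < 1" "l < 1"
  shows "\<exists>b\<ge>0. \<forall>x. \<bar>x\<bar> \<le> b \<longrightarrow> l \<le> P (indicator {-b..b}) x"
proof -
  define d where "d = 1 - \<bar>\<alpha>\<bar>"
  have d: "0 < d" using assms by (simp add: d_def)
  have p_int: "integrable lborel p" using p_has_integral by (rule integrable.intros)
  have "(\<lambda>n. \<integral>t. p t * indicator {-d * real n..d * real n} t \<partial>lborel) \<longlonglongrightarrow> (\<integral>t. p t \<partial>lborel)"
  proof (rule integral_dominated_convergence[where w = p])
    show "AE t in lborel. (\<lambda>n. p t * indicator {-d * real n..d * real n} t) \<longlonglongrightarrow> p t"
    proof (rule AE_I2)
      fix t
      obtain m :: nat where m: "\<bar>t\<bar> / d \<le> real m" using real_arch_simple by blast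
      have "p t * indicator {-d * real n..d * real n} t = p t" if "m \<le> n" for n
      proof -
        have "\<bar>t\<bar> / d \<le> real n" using m that by simp
        then have "\<bar>t\<bar> \<le> d * real n" using d by (simp add: pos_divide_le_eq mult.commute)
        then show ?thesis by (auto simp: indicator_def abs_le_iff)
      qed
      then show "(\<lambda>n. p t * indicator {-d * real n..d * real n} t) \<longlonglongrightarrow> p t"
        by (intro tendsto_eventually) (auto simp: eventually_sequentially)
    qed
    show "AE t in lborel. norm (p t * indicator {-d * real n..d * real n} t) \<le> p t" for n
      using p_pos by (intro AE_I2) (auto simp: indicator_def less_imp_le abs_of_pos)
  qed (use p_int in auto)
  then have "(\<lambda>n. \<integral>t. p t * indicator {-d * real n..d * real n} t \<partial>lborel) \<longlonglongrightarrow> 1"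
    using p_has_integral by (simp add: has_bochner_integral_integral_eq)
  from order_tendstoD(1)[OF this assms(2)] obtain n :: nat where
    n: "l < (\<integral>t. p t * indicator {-d * real n..d * real n} t \<partial>lborel)"
    unfolding eventually_sequentially by blast
  show ?thesis
  proof (intro exI[of _ "real n"] conjI allI impI)
    fix x assume x: "\<bar>x\<bar> \<le> real n"
    have "(\<integral>t. p t * indicator {-d * real n..d * real n} t \<partial>lborel)
      \<le> (\<integral>t. p t * indicator {-real n..real n} (\<alpha> * x + t) \<partial>lborel)"
    proof (rule integral_mono)
      show "integrable lborel (\<lambda>t. p t * indicator {-d * real n..d * real n} t)"
        by (rule Bochner_Integration.integrable_bound[OF p_int]) (auto simp: indicator_def)
      show "integrable lborel (\<lambda>t. p t * indicator {-real n..real n} (\<alpha> * x + t))"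
        by (rule Bochner_Integration.integrable_bound[OF p_int]) (auto simp: indicator_def)
      fix t
      have "\<bar>\<alpha> * x + t\<bar> \<le> real n" if "\<bar>t\<bar> \<le> d * real n"
      proof -
        have "\<bar>\<alpha> * x\<bar> \<le> \<bar>\<alpha>\<bar> * real n" using x by (simp add: abs_mult mult_left_mono)
        then show ?thesis using that abs_triangle_ineq[of "\<alpha> * x" t] by (simp add: d_def left_diff_distrib)
      qed
      then have "indicator {-d * real n..d * real n} t \<le> (indicator {-real n..real n} (\<alpha> * x + t) :: real)"
        by (auto simp: indicator_def abs_le_iff)
      then show "p t * indicator {-d * real n..d * real n} t \<le> p t * indicator {-real n..real n} (\<alpha> * x + t)"
        using p_pos[of t] by (intro mult_left_mono) auto
    qed
    with n show "l \<le> P (indicator {-real n..real n}) x" unfolding P_eq_integral by simp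
  qed simp
qed

end

lemma (in ar_innovations) L_Y_ar_law:
  assumes \<mu>: "prob_space \<mu>" "sets \<mu> = sets borel" and w: "vanishing_weight (\<lambda>x. exp (- \<gamma> * \<xi> x))"
  shows "L_Y (ar_law \<alpha> M \<theta> \<mu>) \<xi> n \<gamma> = (\<integral>x. (Q (\<lambda>x. exp (- \<gamma> * \<xi> x)) ^^ Suc n) (\<lambda>_. 1) x \<partial>\<mu>)"
proof -
  have "exp (- \<gamma> * additive_functional \<xi> n X) = (\<Prod>k\<le>n. exp (- \<gamma> * \<xi> (X k)))" for X
    by (simp add: additive_functional_def sum_distrib_left atLeast0AtMost exp_sum flip: sum_negf)
  then show ?thesis unfolding L_Y_def ar_law_integral[OF \<mu> w, symmetric] by simp
qed

text \<open>
  The operators with \<open>\<gamma> = 0\<close> are not killed, so the endpoint is treated by hand. The root of index \<open>0\<close> is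
  \<open>0\<close>, but this does not affect the upper limit.
\<close>

lemma (in ar_innovations) \<rho>_Y_ar_law_0:
  assumes \<mu>: "prob_space \<mu>" "sets \<mu> = sets borel"
  shows "\<rho>_Y (ar_law \<alpha> M \<theta> \<mu>) \<xi> 0 = 1"
proof -
  interpret \<mu>: prob_space \<mu> by (rule \<mu>)
  interpret \<mu>M: pair_prob_space \<mu> M ..
  interpret law: prob_space "ar_law \<alpha> M \<theta> \<mu>"
    unfolding ar_law_def by (rule \<mu>M.P.prob_space_distr[OF path_measurable[OF \<mu>(2)]])
  have "L_Y (ar_law \<alpha> M \<theta> \<mu>) \<xi> n 0 = 1" for n by (simp add: L_Y_def law.prob_space)
  moreover have "\<forall>\<^sub>F n in sequentially. ereal (root n 1) = ereal 1"
    using eventually_gt_at_top[of 0] by eventually_elim simp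
  then have "limsup (\<lambda>n. ereal (root n 1)) = ereal 1"
    by (intro lim_imp_Limsup tendsto_eventually) simp_all
  ultimately have "limsup (\<lambda>n. ereal (root n (L_Y (ar_law \<alpha> M \<theta> \<mu>) \<xi> n 0))) = ereal 1"
    by (simp only:)
  then show ?thesis by (simp add: \<rho>_Y_def)
qed

theorem theorem2p4:
  fixes \<alpha> r\<^sub>0 :: real
    and M :: "'a measure" and \<theta> :: "nat \<Rightarrow> 'a \<Rightarrow> real"
    and \<pi> :: "real measure"
    and p \<xi> :: "real \<Rightarrow> real"
  assumes "-1 < \<alpha>" and "\<alpha> < 1" and "0 < r\<^sub>0"
    and "prob_space M"
    and "prob_space.indep_vars M (\<lambda>_. borel) \<theta> {1..}"
    and "\<And>n. 1 \<le> n \<Longrightarrow> distr M borel (\<theta> n) = distr M borel (\<theta> 1)"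
    and "integrable M (\<lambda>\<omega>. \<bar>\<theta> 1 \<omega>\<bar> powr r\<^sub>0)"
    and "invariant_probability \<alpha> M \<theta> \<pi>"
    and "continuous_on UNIV p" and "\<And>x. 0 < p x"
    and "distributed M lborel (\<theta> 1) (\<lambda>x. ennreal (p x))"
    and "\<And>x. \<exists>\<epsilon>>0. (\<integral>\<^sup>+ y. (SUP z\<in>{z. \<bar>z\<bar> < \<epsilon>}. ennreal (p (y + x + z))) \<partial>lborel) < \<infinity>"
    and "continuous_on UNIV \<xi>" and "\<And>x. 0 \<le> \<xi> x"
    and "filterlim \<xi> at_top at_infinity"
    and "AE x in lborel. 0 < \<xi> x"
    and "bdd_above (range (\<lambda>x. \<xi> x / (1 + \<bar>x\<bar>) powr r\<^sub>0))"
  shows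
    "((\<forall>x. \<forall>\<gamma>\<ge>0. \<rho>_Y (ar_law \<alpha> M \<theta> (return borel x)) \<xi> \<gamma> = \<rho>_Y (ar_law \<alpha> M \<theta> \<pi>) \<xi> \<gamma>) \<and>
      multiplicatively_ergodic (ar_law \<alpha> M \<theta> \<pi>) \<xi> {0<..} \<and>
      (\<forall>x. multiplicatively_ergodic (ar_law \<alpha> M \<theta> (return borel x)) \<xi> {0<..})) \<and>
     ((\<rho>_Y (ar_law \<alpha> M \<theta> \<pi>) \<xi> \<longlongrightarrow> 0) at_top \<and>
      \<nu>_Y (ar_law \<alpha> M \<theta> \<pi>) \<xi> < \<infinity> \<and>
      (\<forall>x. \<nu>_Y (ar_law \<alpha> M \<theta> (return borel x)) \<xi> < \<infinity>)) \<and>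
     ((\<exists>\<tau>>0. bdd_above (range (\<lambda>x. \<xi> x powr (1 + \<tau>) / (1 + \<bar>x\<bar>) powr r\<^sub>0))) \<longrightarrow>
      (\<forall>\<gamma>>0. \<exists>D<0. (\<rho>_Y (ar_law \<alpha> M \<theta> \<pi>) \<xi> has_real_derivative D) (at \<gamma>)) \<and>
      (\<forall>\<mu>\<in>insert \<pi> (range (return borel)).
         let P = ar_law \<alpha> M \<theta> \<mu>; \<nu> = real_of_ereal (\<nu>_Y P \<xi>) in
         \<exists>C::real. ((\<lambda>\<gamma>. ennreal ((\<gamma> - \<nu>) / \<gamma>) * g_Y P \<xi> \<gamma> 2) \<longlongrightarrow> ennreal C) (at_right \<nu>)))"
proof -
  interpret ar_innovations M \<alpha> \<theta> p
    by (intro ar_innovations.intro ar_innovations_axioms.intro assms(4,5,6,9,10,11))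
  interpret T: tilted_markov_density transition \<xi>
    by unfold_locales (fact assms(13-16))+
  have \<pi>: "prob_space \<pi>" "sets \<pi> = sets borel" using assms(8) by (auto simp: invariant_probability_def)
  have \<delta>: "prob_space (return borel x)" "sets (return borel x) = sets borel" for x :: real
    by (auto intro: prob_space_return)
  have law: "L_Y (ar_law \<alpha> M \<theta> \<mu>) \<xi> n \<gamma> = (\<integral>x. T.laplace \<gamma> (Suc n) x \<partial>\<mu>)"
    if "prob_space \<mu>" "sets \<mu> = sets borel" "0 < \<gamma>" for \<mu> n \<gamma>
    using L_Y_ar_law[OF that(1,2) T.wt_vanishing_weight[OF that(3), unfolded T.wt_def[abs_def]]]
    by (simp add: T.laplace_def T.wt_def[abs_def])
  note law_facts = T.\<rho>_Y_eq_rho[OF _ _ law] T.law_multiplicatively_ergodic[OF _ _ law]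
    T.\<nu>_Y_finite[OF _ _ law] T.\<nu>_Y_critical[OF _ _ law] T.g_Y_simple_pole[OF _ _ law]
  have \<rho>_eq: "\<rho>_Y (ar_law \<alpha> M \<theta> \<mu>) \<xi> \<gamma> = T.rho \<gamma>" if "prob_space \<mu>" "sets \<mu> = sets borel" "0 < \<gamma>" for \<mu> \<gamma>
    by (rule law_facts(1)) (use that in auto)
  \<comment> \<open>any staying probability above \<open>1/2\<close> would do\<close>
  obtain b where "0 \<le> b" "\<forall>x. \<bar>x\<bar> \<le> b \<longrightarrow> 3/4 \<le> P (indicator {-b..b}) x"
    using staying_probability[of "3/4"] assms(1,2) by (auto simp: abs_less_iff)
  then obtain \<gamma>\<^sub>0 where "0 < \<gamma>\<^sub>0" "1/2 \<le> T.rho \<gamma>\<^sub>0" using T.rho_near_zero[of b "3/4" "1/2"] by auto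
  then obtain \<nu> where \<nu>: "0 < \<nu>" "T.rho \<nu> = 1/2" using T.critical_exponent_exists by blast
  show ?thesis
  proof (intro conjI allI impI ballI)
    fix x \<gamma> :: real assume "0 \<le> \<gamma>"
    then show "\<rho>_Y (ar_law \<alpha> M \<theta> (return borel x)) \<xi> \<gamma> = \<rho>_Y (ar_law \<alpha> M \<theta> \<pi>) \<xi> \<gamma>"
      using \<rho>_eq[OF \<pi>, of \<gamma>] \<rho>_eq[OF \<delta>, of \<gamma> x] \<rho>_Y_ar_law_0[OF \<pi>, of \<xi>] \<rho>_Y_ar_law_0[OF \<delta>, of x \<xi>]
      by (cases "\<gamma> = 0") auto
  next
    show "multiplicatively_ergodic (ar_law \<alpha> M \<theta> \<pi>) \<xi> {0<..}" by (rule law_facts(2)[OF \<pi> \<pi>])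
    show "multiplicatively_ergodic (ar_law \<alpha> M \<theta> (return borel x)) \<xi> {0<..}" for x by (rule law_facts(2)[OF \<delta> \<delta>])
    show "\<nu>_Y (ar_law \<alpha> M \<theta> \<pi>) \<xi> < \<infinity>" by (rule law_facts(3)[OF \<pi> \<pi>])
    show "\<nu>_Y (ar_law \<alpha> M \<theta> (return borel x)) \<xi> < \<infinity>" for x by (rule law_facts(3)[OF \<delta> \<delta>])
    show "(\<rho>_Y (ar_law \<alpha> M \<theta> \<pi>) \<xi> \<longlongrightarrow> 0) at_top"
    proof (rule Lim_transform_eventually[OF T.rho_tendsto_zero])
      show "\<forall>\<^sub>F \<gamma> in at_top. T.rho \<gamma> = \<rho>_Y (ar_law \<alpha> M \<theta> \<pi>) \<xi> \<gamma>"
        using eventually_gt_at_top[of 0] by eventually_elim (simp add: \<rho>_eq[OF \<pi>])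
    qed
  next
    fix \<gamma> :: real assume \<gamma>: "0 < \<gamma>"
    have "(\<rho>_Y (ar_law \<alpha> M \<theta> \<pi>) \<xi> has_real_derivative - (T.rho \<gamma> * T.dual \<gamma> (\<lambda>x. \<xi> x * T.eig \<gamma> x))) (at \<gamma>)"
      by (rule has_field_derivative_transform_within_open[OF T.rho_has_derivative[OF \<gamma>], of "{0<..}"])
        (use \<gamma> in \<open>auto simp: \<rho>_eq[OF \<pi>]\<close>)
    then show "\<exists>D<0. (\<rho>_Y (ar_law \<alpha> M \<theta> \<pi>) \<xi> has_real_derivative D) (at \<gamma>)"
      using T.rho_derivative_neg[OF \<gamma>] by blast
  next
    fix \<mu> assume "\<mu> \<in> insert \<pi> (range (return borel))"
    then have \<mu>: "prob_space \<mu>" "sets \<mu> = sets borel" using \<pi> \<delta> by auto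
    have \<nu>_eq: "real_of_ereal (\<nu>_Y (ar_law \<alpha> M \<theta> \<mu>) \<xi>) = \<nu>"
      using law_facts(4)[OF \<mu> \<mu> _ \<nu>] by simp
    show "let P = ar_law \<alpha> M \<theta> \<mu>; \<nu> = real_of_ereal (\<nu>_Y P \<xi>) in
         \<exists>C::real. ((\<lambda>\<gamma>. ennreal ((\<gamma> - \<nu>) / \<gamma>) * g_Y P \<xi> \<gamma> 2) \<longlongrightarrow> ennreal C) (at_right \<nu>)"
      unfolding Let_def \<nu>_eq using law_facts(5)[OF \<mu> \<mu> _ \<nu>] by simp
  qed
qed

end
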